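(* Let \(\varphi\) and \(\psi\) be Dirichlet series satisfying the setup described in the context. Let \(C\) be a curve encircling all elements of \(S\), i.e., all poles of \(\varphi\) and \(\psi\). Suppose \(\gamma\) is a real number such that \[ \gamma > \max(\sigma_{a, \varphi}, \sigma_{a, \psi}), \quad \gamma > \frac{\delta}{2}, \] and the curve \(C\) is entirely contained within the strip \(\delta - \gamma < \Re s < \gamma\). Let \(k\) be an integer such that \(k > 2\gamma - \delta\). Suppose that \(u\) and \(v\) are complex numbers such that \(\Re u > \sigma_{a, \varphi}\), \(\Re v > \sigma_{a, \psi}\), and \[ \Re u + \Re v - \gamma > \max(\sigma_{a, \varphi}, \sigma_{a, \psi}). \] Then, \begin{align*} \varphi(u)\psi(v) &= -\sum_{i=1}^{n_\psi} \frac{r_{\psi, i}}{p_{\psi, i} - v} \varphi(v + u - p_{\psi, i}) - \sum_{i=1}^{n_\varphi} \frac{r_{\varphi, i}}{p_{\varphi, i} - u} \psi(v + u - p_{\varphi, i}) \\ &\quad - \left. \frac{d^{(k)}}{dx} \right|_{x=1} G_{f, k}(v, u, x) - \left. \frac{d^{(k)}}{dx} \right|_{x=1} G_{g, k}(u, v, x), \end{align*} where \[ G_{f, k}(v, u, x) := \frac{(2\pi)^\delta}{2\pi i} \sum_{n=1}^\infty f_{\delta - v - u}(n) x^{\delta - v + k} G^{1, 1}_{3, 1}\left( {}^{1, \delta - v + k + 1, \delta}_{\delta - v} \, \middle| \, \frac{1}{4\pi^2 \lambda_n x} \right),\qquad f_a(n) := \sum_{d \mid n} \lambda_d^a f(d)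 f\left(\frac{n}{d}\right), \] \[ G_{g, k}(u, v, x) := \frac{(2\pi)^\delta}{2\pi i} \sum_{n=1}^\infty g_{\delta - u - v}(n) x^{\delta - u + k} G^{1, 1}_{3, 1}\left( {}^{1, \delta - u + k + 1, \delta}_{\delta - u} \, \middle| \, \frac{1}{4\pi^2 \mu_n x} \right),\qquad g_a(n) := \sum_{d \mid n} \mu_d^a g(d) g\left(\frac{n}{d}\right), \] and \(p_{\varphi, i}, p_{\psi, i}\) denote the poles of \(\varphi\) and \(\psi\) (there being \(n_\varphi\), resp. \(n_\psi\), of them), with \(r_{\varphi, i}, r_{\psi, i}\) being the corresponding residues. Moreover, for any \(x > 0\), \begin{align*} \frac{1}{\Gamma(k+1)} \sum_{n=1}^\infty \frac{g(n)}{\mu_n^{v + k}} {\sum_{m \leq nx}}' \frac{f(m)}{\lambda_m^u} (nx - m)^k &= \frac{1}{2\pi i} \int_C \frac{\Gamma(z - u)}{\Gamma(z - u + k + 1)} \varphi(z) \psi(v + u - z) x^{z - u + k} \, dz + G_{g, k}(u, v, x), \end{align*} \begin{align*} \frac{1}{\Gamma(k+1)} \sum_{m=1}^\infty \frac{f(m)}{\lambda_m^{u + k}} {\sum_{n \leq mx}}' \frac{g(n)}{\mu_n^v} (mx - n)^k &= \frac{1}{2\pi i} \int_C \frac{\Gamma(z - v)}{\Gamma(z - v + k + 1)} \psi(z) \varphi(v + u - z) x^{z - v + k} \, dz + G_{f, k}(v, u, x). \end{align*}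
   Context: Setup: Let \(\{\lambda_n\}\), \(\{\mu_n\}\) be sequences of positive reals with \(0<\lambda_1<\lambda_2<\cdots\to\infty\), \(0<\mu_1<\mu_2<\cdots\to\infty\), such that \(\lambda_k\lambda_l=\lambda_m \iff kl=m\) and \(\mu_k\mu_l=\mu_m \iff kl=m\). Let \(\{f(n)\}\), \(\{g(n)\}\) be nonzero sequences of complex numbers, \(s=\sigma+it\), and \(\delta>0\). Let \(\varphi(s)=\sum_{n\ge1} f(n)\lambda_n^{-s}\) for \(\sigma>\sigma_{a,\varphi}\) and \(\psi(s)=\sum_{n\ge1} g(n)\mu_n^{-s}\) for \(\sigma>\sigma_{a,\psi}\), with finite abscissae of absolute convergence \(\sigma_{a,\varphi},\sigma_{a,\psi}\). Assume \(\varphi,\psi\) extend meromorphically to \(\mathbb{C}\) and satisfy \((2\pi)^{-s}\Gamma(s)\varphi(s)=(2\pi)^{s-\delta}\Gamma(\delta-s)\psi(\delta-s)\) and \((2\pi)^{-s}\Gamma(s)\psi(s)=(2\pi)^{s-\delta}\Gamma(\delta-s)\varphi(\delta-s)\), in the sense that there is a domain \(D\), the exterior of a bounded closed set \(S\), and a holomorphic \(\chi(s)\) on \(D\) with \(\chi(\sigma+it)e^{-\epsilon|t|}=O(1)\) (\(0<\epsilon<\pi/2\)) as \(|t|\to\infty\) uniformly in every vertical strip, and \(\chi(s)=(2\pi)^{-s}\Gamma(s)\varphi(s)\) for \(\sigma>\alpha\), \(\chi(s)=(2\pi)^{s-\delta}\Gamma(\delta-s)\varphi(\delta-s)\) for \(\sigma<\beta\)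 (constants \(\alpha,\beta\)). Assume \(\varphi,\psi\) have finitely many poles, all simple and on the real axis; if \(\varphi\) (resp. \(\psi\)) has a pole, assume \(\sigma_{a,\varphi}\le\delta\) (resp. \(\sigma_{a,\psi}\le\delta\)). The Meijer \(G\)-function here is \(G^{1,1}_{3,1}\left({}^{1,b,c}_{d}\,\middle|\,z\right)=\frac{1}{2\pi i}\int_L \frac{\Gamma(d-s)\Gamma(s)}{\Gamma(b-s)\Gamma(c-s)}z^s\,ds\), with \(L\) a vertical line separating the poles of \(\Gamma(d-s)\) (to the right) from those of \(\Gamma(s)\) (to the left). \(\frac{d^{(k)}}{dx}\big|_{x=1}\) denotes the \(k\)-th derivative in \(x\) evaluated at \(x=1\). The primed sum \({\sum}'\) means the last term is weighted by \(1/2\) if \(k=0\) and equality holds in the summation condition.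
   Formalization: Riesz sums use λ_m ≤ μ_n x, (μ_n x−λ_m)^k (and symmetrically); extra 1/(2πi) in G_{f,k}, G_{g,k} dropped; L is Re s=γ, off poles; last derivative symmetric; χ uses ψ(δ−s) for σ<β; the x-identities need C to encircle all u−j (resp. v−j), 0≤j≤k, with Re>δ−γ. *)

theory Defs
  imports "HOL-Complex_Analysis.Complex_Analysis"
begin

text \<open>Sequences are functions on \<^typ>\<open>nat\<close> of which only the values at \<open>n \<ge> 1\<close> matter;
  series over \<open>n \<ge> 1\<close> are therefore written with \<^const>\<open>Suc\<close>.\<close>

definition multiplicative_frequencies :: "(nat \<Rightarrow> real) \<Rightarrow> bool" where
  "multiplicative_frequencies l \<longleftrightarrow>
     0 < l 1 \<and>
     (\<forall>m n. 1 \<le> m \<longrightarrow> m < n \<longrightarrow> l m < l n) \<and>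
     filterlim l at_top sequentially \<and>
     (\<forall>i j m. 1 \<le> i \<longrightarrow> 1 \<le> j \<longrightarrow> 1 \<le> m \<longrightarrow> (l i * l j = l m \<longleftrightarrow> i * j = m))"

definition dirichlet_series :: "(nat \<Rightarrow> complex) \<Rightarrow> (nat \<Rightarrow> real) \<Rightarrow> complex \<Rightarrow> complex" where
  "dirichlet_series f l s = (\<Sum>n. f (Suc n) * of_real (l (Suc n)) powr (- s))"

definition abs_conv_abscissa :: "(nat \<Rightarrow> complex) \<Rightarrow> (nat \<Rightarrow> real) \<Rightarrow> ereal" where
  "abs_conv_abscissa f l =
     Inf {ereal \<sigma> |\<sigma>. summable (\<lambda>n. norm (f (Suc n)) * l (Suc n) powr (- \<sigma>))}"

text \<open>\<open>\<phi>\<close> is the meromorphic continuation to the whole plane of the Dirichlet series with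
  coefficients \<open>f\<close> and frequencies \<open>l\<close>, whose abscissa of absolute convergence is the (finite)
  real number \<open>\<sigma>a\<close>.  The predicate \<open>nicely_meromorphic_on\<close> rules out removable singularities,
  so that \<open>\<phi>\<close> is analytic wherever it does not have a pole.\<close>

definition meromorphic_dirichlet ::
    "(complex \<Rightarrow> complex) \<Rightarrow> (nat \<Rightarrow> complex) \<Rightarrow> (nat \<Rightarrow> real) \<Rightarrow> real \<Rightarrow> bool" where
  "meromorphic_dirichlet \<phi> f l \<sigma>a \<longleftrightarrow>
     abs_conv_abscissa f l = ereal \<sigma>a \<and>
     \<phi> nicely_meromorphic_on UNIV \<and>
     (\<forall>s. Re s > \<sigma>a \<longrightarrow> \<phi> s = dirichlet_series f l s)"

definition simple_real_poles :: "(complex \<Rightarrow> complex) \<Rightarrow> bool" where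
  "simple_real_poles \<phi> \<longleftrightarrow>
     finite {p. is_pole \<phi> p} \<and> (\<forall>p. is_pole \<phi> p \<longrightarrow> zorder \<phi> p = -1 \<and> p \<in> \<real>)"

text \<open>The functional equation
  \<open>(2\<pi>)\<^sup>-\<^sup>s \<Gamma>(s) \<phi>(s) = (2\<pi>)\<^sup>s\<^sup>-\<^sup>\<delta> \<Gamma>(\<delta> - s) \<psi>(\<delta> - s)\<close> in the sense of Bochner and of
  Chandrasekharan and Narasimhan: both sides are restrictions of one function \<open>X\<close> that is
  holomorphic outside \<open>S\<close>.  The companion equation with \<open>\<phi>\<close> and \<open>\<psi>\<close> exchanged is the same
  statement for \<open>\<delta> - s\<close>.\<close>

definition hecke_functional_equation ::
    "real \<Rightarrow> complex set \<Rightarrow> (complex \<Rightarrow> complex) \<Rightarrow> (complex \<Rightarrow> complex) \<Rightarrow> bool" where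
  "hecke_functional_equation \<delta> S \<phi> \<psi> \<longleftrightarrow>
     bounded S \<and> closed S \<and> connected (- S) \<and>
     (\<exists>X. X holomorphic_on (- S) \<and>
        (\<exists>\<epsilon>. 0 < \<epsilon> \<and> \<epsilon> < pi / 2 \<and>
           (\<forall>a b. \<exists>T M. \<forall>s. a \<le> Re s \<longrightarrow> Re s \<le> b \<longrightarrow> \<bar>Im s\<bar> \<ge> T \<longrightarrow>
              norm (X s) * exp (- \<epsilon> * \<bar>Im s\<bar>) \<le> M)) \<and>
        (\<exists>\<alpha> \<beta>.
           (\<forall>s. Re s > \<alpha> \<longrightarrow> s \<notin> S \<longrightarrow>
              X s = of_real (2 * pi) powr (- s) * Gamma s * \<phi> s) \<and>
           (\<forall>s. Re s < \<beta> \<longrightarrow> s \<notin> S \<longrightarrow>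
              X s = of_real (2 * pi) powr (s - of_real \<delta>)
                      * Gamma (of_real \<delta> - s) * \<psi> (of_real \<delta> - s))))"

definition encircles :: "(real \<Rightarrow> complex) \<Rightarrow> complex \<Rightarrow> bool" where
  "encircles C z \<longleftrightarrow> z \<notin> path_image C \<and> winding_number C z = 1"

text \<open>The Meijer function \<open>G\<close> of type \<open>(1,1;3,1)\<close> with upper parameters \<open>1, b, c\<close> and lower
  parameter \<open>d\<close>, the Mellin--Barnes integral being taken along the upward vertical line
  \<open>Re s = \<kappa>\<close>.  The value depends on the position of \<open>\<kappa>\<close> relative to the poles of
  \<open>\<Gamma>(d - s)\<close> and \<open>\<Gamma>(s)\<close>, so the line is kept as a parameter.\<close>

definition meijer_G :: "real \<Rightarrow> complex \<Rightarrow> complex \<Rightarrow> complex \<Rightarrow> complex \<Rightarrow> complex" where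
  "meijer_G \<kappa> b c d z =
     1 / (2 * of_real pi * \<i>) *
     (LINT t|lborel.
        (let s = Complex \<kappa> t
         in Gamma (d - s) * Gamma s / (Gamma (b - s) * Gamma (c - s)) * z powr s) * \<i>)"

definition twisted_convolution ::
    "(nat \<Rightarrow> complex) \<Rightarrow> (nat \<Rightarrow> real) \<Rightarrow> complex \<Rightarrow> nat \<Rightarrow> complex" where
  "twisted_convolution f l a n = (\<Sum>d | d dvd n. of_real (l d) powr a * f d * f (n div d))"

text \<open>The function \<open>G\<^sub>f\<^sub>,\<^sub>k(v, u, x)\<close>, the line of integration \<open>Re s = \<kappa>\<close> of the Meijer
  functions being explicit.  As \<^const>\<open>meijer_G\<close> already contains the factor \<open>1/(2\<pi>i)\<close>,
  the series is multiplied by \<open>(2\<pi>)\<^sup>\<delta>\<close> only.\<close>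

definition G_series ::
    "real \<Rightarrow> real \<Rightarrow> nat \<Rightarrow> (nat \<Rightarrow> complex) \<Rightarrow> (nat \<Rightarrow> real) \<Rightarrow>
     complex \<Rightarrow> complex \<Rightarrow> real \<Rightarrow> complex" where
  "G_series \<kappa> \<delta> k f l v u x =
     of_real ((2 * pi) powr \<delta>) *
     (\<Sum>n. twisted_convolution f l (of_real \<delta> - v - u) (Suc n)
            * of_real x powr (of_real \<delta> - v + of_nat k)
            * meijer_G \<kappa> (of_real \<delta> - v + of_nat k + 1) (of_real \<delta>) (of_real \<delta> - v)
                (of_real (1 / (4 * pi\<^sup>2 * l (Suc n) * x))))"

text \<open>The inner sum of the Riesz type double series: the terms \<open>f(m) \<lambda>\<^sub>m\<^sup>-\<^sup>u (y - \<lambda>\<^sub>m)\<^sup>k\<close>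
  over \<open>\<lambda>\<^sub>m \<le> y\<close>, where for \<open>k = 0\<close> a term with \<open>\<lambda>\<^sub>m = y\<close> has weight \<open>1/2\<close>.\<close>

definition riesz_sum ::
    "nat \<Rightarrow> (nat \<Rightarrow> complex) \<Rightarrow> (nat \<Rightarrow> real) \<Rightarrow> complex \<Rightarrow> real \<Rightarrow> complex" where
  "riesz_sum k f l u y =
     (\<Sum>m | 1 \<le> m \<and> l m \<le> y.
        (if k = 0 \<and> l m = y then 1 / 2 else 1)
          * (f m / of_real (l m) powr u) * of_real ((y - l m) ^ k))"

text \<open>\<open>A\<close> is the \<open>k\<close>-th derivative of \<open>F\<close> at \<open>a\<close>, where only the last of the \<open>k\<close>
  differentiations is a symmetric one.  A \<open>k\<close>-th antiderivative of a step function has a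
  corner in its \<open>(k-1)\<close>-st derivative at each jump; there the ordinary \<open>k\<close>-th derivative does
  not exist, while the symmetric one is the mean of the two one-sided values, i.e. it counts
  the jump with weight \<open>1/2\<close>.\<close>

definition iterated_deriv :: "nat \<Rightarrow> (real \<Rightarrow> complex) \<Rightarrow> real \<Rightarrow> complex" where
  "iterated_deriv j F = ((\<lambda>H x. vector_derivative H (at x)) ^^ j) F"

definition has_kth_deriv :: "nat \<Rightarrow> (real \<Rightarrow> complex) \<Rightarrow> complex \<Rightarrow> real \<Rightarrow> bool" where
  "has_kth_deriv k F A a \<longleftrightarrow>
     (\<forall>j. Suc j < k \<longrightarrow> (\<forall>\<^sub>F x in nhds a. iterated_deriv j F differentiable (at x))) \<and>
     (if k = 0 then A = F a
      else ((\<lambda>h. (iterated_deriv (k - 1) F (a + h) - iterated_deriv (k - 1) F (a - h))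
                   / of_real (2 * h)) \<longlongrightarrow> A) (at_right 0))"

lemma symmetric_quotient_tendsto:
  fixes H :: "real \<Rightarrow> complex"
  assumes "(H has_vector_derivative A) (at a)"
  shows "((\<lambda>h. (H (a + h) - H (a - h)) / of_real (2 * h)) \<longlongrightarrow> A) (at_right 0)"
proof -
  have l: "((\<lambda>h. (H (a + h) - H a) /\<^sub>R h) \<longlongrightarrow> A) (at 0)"
  proof (rule Lim_null[THEN iffD2], rule tendsto_norm_zero_cancel)
    have "((\<lambda>h. norm (H (a + h) - H a - h *\<^sub>R A) / norm h) \<longlongrightarrow> 0) (at 0)"
      using assms by (simp add: has_vector_derivative_def has_derivative_at)
    then show "((\<lambda>h. norm ((H (a + h) - H a) /\<^sub>R h - A)) \<longlongrightarrow> 0) (at 0)"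
    proof (rule Lim_transform_eventually)
      have "norm (H (a + h) - H a - h *\<^sub>R A) / norm h = norm ((H (a + h) - H a) /\<^sub>R h - A)"
        if "h \<noteq> 0" for h
      proof -
        have "(H (a + h) - H a) /\<^sub>R h - A = (H (a + h) - H a - h *\<^sub>R A) /\<^sub>R h"
          using that by (simp add: algebra_simps)
        then show ?thesis by (simp add: divide_inverse mult.commute)
      qed
      then show "\<forall>\<^sub>F h in at 0. norm (H (a + h) - H a - h *\<^sub>R A) / norm h
                   = norm ((H (a + h) - H a) /\<^sub>R h - A)"
        by (auto simp: eventually_at_filter)
    qed
  qed
  have 1: "((\<lambda>h. (H (a + h) - H a) /\<^sub>R h) \<longlongrightarrow> A) (at_right 0)"
    by (rule tendsto_mono[OF _ l]) (simp add: at_le)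
  have "filterlim uminus (at 0) (at_right (0::real))"
    by (auto simp: filterlim_at eventually_at_filter intro!: tendsto_eq_intros)
  from filterlim_compose[OF l this]
  have 2: "((\<lambda>h. (H (a - h) - H a) /\<^sub>R (- h)) \<longlongrightarrow> A) (at_right 0)" by simp
  from tendsto_divide[OF tendsto_add[OF 1 2] tendsto_const[of 2]]
  show ?thesis
    by (simp add: scaleR_conv_of_real field_simps add_divide_distrib diff_divide_distrib)
qed

text \<open>Whenever the ordinary \<open>k\<close>-th derivative exists, it is the one given by
  \<^const>\<open>has_kth_deriv\<close>.\<close>

lemma has_kth_deriv_ordinary:
  assumes "\<And>j. Suc j < k \<Longrightarrow> \<forall>\<^sub>F x in nhds a. iterated_deriv j F differentiable (at x)"
    and "k > 0"
    and "(iterated_deriv (k - 1) F has_vector_derivative A) (at a)"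
  shows "has_kth_deriv k F A a"
  using assms symmetric_quotient_tendsto unfolding has_kth_deriv_def by simp

end

theory Submission
  imports Defs "HOL-Real_Asymp.Real_Asymp"
begin

text \<open>
  By Perron's formula for the kernel \<open>1 / (w (w + 1) \<dots> (w + k))\<close>, the double Riesz mean
  \<open>1/k! \<Sum> f(m) \<lambda>\<^sub>m\<^sup>-\<^sup>u g(n) \<mu>\<^sub>n\<^sup>-\<^sup>v (x - \<lambda>\<^sub>m/\<mu>\<^sub>n)\<^sup>k\<close>, over \<open>\<lambda>\<^sub>m/\<mu>\<^sub>n \<le> x\<close>, is an integral of
  \<open>\<phi>(z) \<psi>(u + v - z)\<close> over a line to the right of all poles of the integrand.  The line is moved to
  \<open>Re z = \<delta> - \<gamma>\<close>, which is justified by a Phragmen-Lindelof argument; the residues make up the contour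
  integral over \<open>C\<close>.  On the new line the functional equation turns \<open>\<phi>(z)\<close> into \<open>\<psi>(\<delta> - z)\<close>, and the
  product of the two values of \<open>\<psi>\<close> is the Dirichlet series of the twisted convolution of \<open>g\<close>, whose
  termwise integrals are the Meijer functions.

  At \<open>x = 1\<close> the \<open>k\<close>-th derivative of the Riesz mean is the part of \<open>\<phi>(u) \<psi>(v)\<close> with
  \<open>\<lambda>\<^sub>m < \<mu>\<^sub>n\<close>, the diagonal being counted with weight \<open>1/2\<close>.  The mean with the two series exchanged
  gives the complementary part, so the two derivatives add up to \<open>\<phi>(u) \<psi>(v)\<close>, while the residues at
  \<open>u\<close> and \<open>v\<close> contribute \<open>2 \<phi>(u) \<psi>(v)\<close>.
\<close>

section \<open>Growth of the Gamma function and of functions in a strip\<close>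

text \<open>The left line fixes the size of \<open>k\<close>: on \<open>Re s = \<gamma>\<close> the
  functional equation costs the factor \<open>Gamma s / Gamma (\<delta> - s)\<close>, of order
  \<open>|t|\<close> to the power \<open>2 \<gamma> - \<delta>\<close>, against the power
  \<open>- (k + 1)\<close> from the kernel. Inside the strip only exponential growth of \<phi> is
  known, so the decay on horizontal segments has to be interpolated from the two sides.
  Differentiating the Meijer integrals \<open>k\<close> times would destroy their absolute
  convergence. The derivatives are therefore those of the remaining terms of the formula: the Riesz
  mean is a series of truncated powers, and the residues form an integral over a rectangle, in which
  each differentiation removes one Pochhammer factor until \<open>1 / (z - u)\<close> is left. Pairs
  with \<open>lam m = mu n\<close> can put a corner at \<open>x = 1\<close>, whence the symmetric
  last derivative. The residue at \<open>u\<close> counts only if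
  \<open>\<delta> - \<gamma> < Re u\<close>. This is not assumed; it follows from \<open>g\<close>
  having a nonzero coefficient, by a mean value argument for Dirichlet series. Only one of the two
  means is treated, in a setting stable under \<open>s \<mapsto> \<delta> - s\<close>, and then used
  twice.\<close>

lemma Re_Digamma_le:
  fixes s :: complex
  assumes "Re s \<ge> 1"
  shows "Re (Digamma s) \<le> ln (norm s) + 1"
proof -
  \<comment> \<open>One step of the telescoping comparison: the squared ratio
    \<open>|w + 1|^2 / |w|^2\<close> exceeds 1 by \<open>(2 Re w + 1) / |w|^2\<close>, and the 1 in
    this numerator is the second-order error.\<close>
  have step: "ln (norm (w + 1)) - ln (norm w) \<le> Re (inverse w) + 1 / (2 * (norm w)\<^sup>2)"
    if "Re w \<ge> 1" for w :: complex
  proof -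
    have w0: "norm w > 0" "norm (w + 1) > 0"
      using that by (auto simp: complex_eq_iff)
    have "2 * (ln (norm (w + 1)) - ln (norm w)) = ln ((norm (w + 1))\<^sup>2 / (norm w)\<^sup>2)"
      using w0 by (simp add: ln_div ln_realpow)
    also have "\<dots> \<le> (norm (w + 1))\<^sup>2 / (norm w)\<^sup>2 - 1"
      using w0 by (intro ln_le_minus_one) auto
    also have "\<dots> = (2 * Re w + 1) / (norm w)\<^sup>2"
    proof -
      have "(norm (w + 1))\<^sup>2 = (norm w)\<^sup>2 + (2 * Re w + 1)"
        unfolding cmod_power2 by (simp add: power2_eq_square algebra_simps)
      then show ?thesis using w0 by (simp add: add_divide_distrib)
    qed
    finally have "2 * (ln (norm (w + 1)) - ln (norm w)) \<le> (2 * Re w + 1) / (norm w)\<^sup>2" .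
    moreover have "Re (inverse w) = Re w / (norm w)\<^sup>2" by (simp add: cmod_power2)
    ultimately show ?thesis by (simp add: add_divide_distrib del: inverse_complex.simps)
  qed
  \<comment> \<open>The remainder term makes the induction close. Half of the bound 2 is the
    constant 1 of the lemma.\<close>
  have sq: "(\<Sum>n<Suc m. 1 / (real n + 1)\<^sup>2) \<le> 2 - 1 / (real m + 1)" for m
  proof (induction m)
    case (Suc m)
    have "1 / (real (Suc m) + 1)\<^sup>2 \<le> 1 / (real m + 1) - 1 / (real (Suc m) + 1)"
    proof -
      have "1 / (real (Suc m) + 1)\<^sup>2 \<le> 1 / ((real m + 1) * (real (Suc m) + 1))"
        unfolding power2_eq_square by (intro divide_left_mono mult_right_mono mult_pos_pos) auto
      also have "\<dots> = 1 / (real m + 1) - 1 / (real (Suc m) + 1)"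
        by (simp add: field_simps)
      finally show ?thesis .
    qed
    with Suc show ?case by simp
  qed auto
  \<comment> \<open>These are the approximants in the limit formula for \<open>Digamma\<close>; the
    sum of reciprocals is compared with the telescoping sum of
    \<open>ln (norm (s + of_nat n))\<close>.\<close>
  have bound: "ln (real m) - Re (\<Sum>n<m. inverse (s + of_nat n)) \<le> ln (norm s) + 1" if "m > 0" for m
  proof -
    have "ln (norm (s + of_nat m)) - ln (norm s)
      = (\<Sum>n<m. ln (norm (s + of_nat (Suc n))) - ln (norm (s + of_nat n)))"
      by (subst sum_lessThan_telescope) simp
    also have "\<dots> \<le> (\<Sum>n<m. Re (inverse (s + of_nat n)) + 1 / (2 * (real n + 1)\<^sup>2))"
    proof (rule sum_mono)
      fix n
      have "real n + 1 \<le> norm (s + of_nat n)"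
        using assms complex_Re_le_cmod[of "s + of_nat n"] by simp
      then have "1 / (2 * (norm (s + of_nat n))\<^sup>2) \<le> 1 / (2 * (real n + 1)\<^sup>2)"
        by (intro divide_left_mono mult_left_mono power_mono)
           (auto intro!: mult_pos_pos zero_less_power intro: less_le_trans[of 0 "real n + 1"])
      then show "ln (norm (s + of_nat (Suc n))) - ln (norm (s + of_nat n))
          \<le> Re (inverse (s + of_nat n)) + 1 / (2 * (real n + 1)\<^sup>2)"
        using step[of "s + of_nat n"] assms by (simp add: add_ac)
    qed
    also have "\<dots> = Re (\<Sum>n<m. inverse (s + of_nat n)) + (\<Sum>n<m. 1 / (real n + 1)\<^sup>2) / 2"
      by (simp add: sum.distrib sum_divide_distrib mult.commute)
    also have "(\<Sum>n<m. 1 / (real n + 1)\<^sup>2) \<le> 2"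
    proof -
      have "(\<Sum>n<m. 1 / (real n + 1)\<^sup>2) \<le> (\<Sum>n<Suc m. 1 / (real n + 1)\<^sup>2)" by simp
      also have "\<dots> \<le> 2" using sq[of m] by (smt (verit) divide_nonneg_nonneg of_nat_0_le_iff)
      finally show ?thesis .
    qed
    finally have "ln (norm (s + of_nat m)) - ln (norm s) \<le> Re (\<Sum>n<m. inverse (s + of_nat n)) + 1"
      by simp
    moreover have "ln (real m) \<le> ln (norm (s + of_nat m))"
    proof -
      have "real m \<le> norm (s + of_nat m)"
        using assms complex_Re_le_cmod[of "s + of_nat m"] by simp
      then show ?thesis using that by (subst ln_le_cancel_iff) auto
    qed
    ultimately show ?thesis by linarith
  qed
  have "s \<noteq> 0" using assms by auto
  from tendsto_Re[OF Digamma_LIMSEQ[OF this]]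
  show ?thesis
    by (rule tendsto_upperbound)
       (use bound in \<open>auto intro!: eventually_sequentiallyI[of 1]\<close>)
qed

text \<open>Mean value theorem for \<open>Re (ln_Gamma (s + y))\<close> with
  \<open>0 < y < a\<close>, whose derivative is the real part of \<open>Digamma\<close>. The factor
  \<open>exp 1\<close> is the additive 1 of \<open>Re_Digamma_le\<close>.\<close>

lemma norm_Gamma_add_le:
  fixes s :: complex
  assumes s: "Re s \<ge> 1" and a: "a \<ge> 0"
  shows "norm (Gamma (s + of_real a)) \<le> norm (Gamma s) * (exp 1 * norm (s + of_real a)) powr a"
proof (cases "a = 0")
  case False
  have norm_Gamma: "norm (Gamma z) = exp (Re (ln_Gamma z))" if "Re z \<ge> 1" for z :: complex
  proof -
    have "z \<notin> \<int>\<^sub>\<le>\<^sub>0" using that by (auto elim!: nonpos_Ints_cases)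
    then show ?thesis by (simp add: Gamma_complex_altdef)
  qed
  have "\<exists>y. y > 0 \<and> y < a \<and> Re (ln_Gamma (s + of_real a)) - Re (ln_Gamma (s + of_real 0))
      = (a - 0) * Re (Digamma (s + of_real y))"
  proof (rule MVT2)
    fix y :: real assume y: "0 \<le> y" "y \<le> a"
    have "s + of_real y \<notin> \<real>\<^sub>\<le>\<^sub>0" using s y by (auto simp: complex_nonpos_Reals_iff)
    then have "((\<lambda>w. ln_Gamma (s + w)) has_field_derivative Digamma (s + of_real y)) (at (of_real y))"
      by (auto intro!: derivative_eq_intros)
    from has_vector_derivative_real_field[OF this]
    have "((\<lambda>y. ln_Gamma (s + of_real y)) has_vector_derivative Digamma (s + of_real y)) (at y)"
      by simp
    from has_derivative_Re[OF this[unfolded has_vector_derivative_def]]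
    show "((\<lambda>y. Re (ln_Gamma (s + of_real y))) has_real_derivative Re (Digamma (s + of_real y))) (at y)"
      by (simp add: has_field_derivative_def mult_commute_abs)
  qed (use False a in auto)
  then obtain y where y: "y > 0" "y < a" and
    eq: "Re (ln_Gamma (s + of_real a)) = Re (ln_Gamma s) + a * Re (Digamma (s + of_real y))"
    by auto
  have mono: "norm (s + of_real y) \<le> norm (s + of_real a)"
  proof (rule power2_le_imp_le)
    have "(Re s + y)\<^sup>2 \<le> (Re s + a)\<^sup>2" using s y by (intro power_mono) auto
    then show "(norm (s + of_real y))\<^sup>2 \<le> (norm (s + of_real a))\<^sup>2"
      by (simp add: cmod_power2)
  qed auto
  have pos: "norm (s + of_real y) > 0"
    using s y complex_Re_le_cmod[of "s + of_real y"] by auto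
  have "Re (Digamma (s + of_real y)) \<le> ln (norm (s + of_real y)) + 1"
    using s y by (intro Re_Digamma_le) auto
  also have "\<dots> \<le> ln (exp 1 * norm (s + of_real a))"
    using pos mono by (subst ln_mult) (auto simp del: norm_eq_zero zero_less_norm_iff)
  finally have "exp (Re (ln_Gamma (s + of_real a)))
      \<le> exp (Re (ln_Gamma s)) * exp (a * ln (exp 1 * norm (s + of_real a)))"
    unfolding exp_add[symmetric] eq using a by (simp add: mult_left_mono)
  also have "exp (a * ln (exp 1 * norm (s + of_real a))) = (exp 1 * norm (s + of_real a)) powr a"
    using pos mono by (auto simp: powr_def)
  finally show ?thesis
    using s a by (simp add: norm_Gamma)
qed (use s in auto)

lemma not_nonpos_Int_if_Im: "Im z \<noteq> 0 \<Longrightarrow> z \<notin> \<int>\<^sub>\<le>\<^sub>0"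
  by (auto elim!: nonpos_Ints_cases)

text \<open>Both arguments are shifted by \<open>N\<close> into \<open>Re z \<ge> 1\<close>, where
  \<open>norm_Gamma_add_le\<close> applies. The two Pochhammer symbols that arise are compared
  factor by factor: for \<open>\<bar>t\<bar> \<ge> 1\<close> every factor has modulus at least 1, so
  moving it by \<open>a\<close> costs at most \<open>1 + a\<close>.\<close>

lemma Gamma_vertical_upper:
  fixes \<sigma> a :: real
  assumes a: "a \<ge> 0"
  obtains K where "K > 0" "\<And>t. \<bar>t\<bar> \<ge> 1 \<Longrightarrow>
    norm (Gamma (Complex (\<sigma> + a) t)) \<le> K * \<bar>t\<bar> powr a * norm (Gamma (Complex \<sigma> t))"
proof -
  obtain N :: nat where N: "\<sigma> + real N \<ge> 1"
    using real_arch_simple[of "1 - \<sigma>"] by (auto simp: algebra_simps)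
  define K where "K = (1 + a) ^ N * (exp 1 * (\<bar>\<sigma>\<bar> + real N + a + 1)) powr a"
  have "K > 0" using a by (auto simp: K_def intro!: mult_pos_pos zero_less_power)
  moreover have "norm (Gamma (Complex (\<sigma> + a) t)) \<le> K * \<bar>t\<bar> powr a * norm (Gamma (Complex \<sigma> t))"
    if t: "\<bar>t\<bar> \<ge> 1" for t
  proof -
    define z where "z = Complex \<sigma> t"
    have za: "Complex (\<sigma> + a) t = z + of_real a" by (simp add: z_def complex_eq_iff)
    have Im: "Im (z + of_nat n) = t" "Im (z + of_real a + of_nat n) = t" for n
      by (simp_all add: z_def)
    have nz: "z \<notin> \<int>\<^sub>\<le>\<^sub>0" "z + of_real a \<notin> \<int>\<^sub>\<le>\<^sub>0"
      using t by (auto intro!: not_nonpos_Int_if_Im simp: z_def)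
    have pz: "Gamma (z + of_nat N) = pochhammer z N * Gamma z"
      using nz pochhammer_Gamma[of z N] by (auto simp: Gamma_eq_zero_iff)
    have pza: "Gamma (z + of_real a + of_nat N) = pochhammer (z + of_real a) N * Gamma (z + of_real a)"
      using nz pochhammer_Gamma[of "z + of_real a" N] by (auto simp: Gamma_eq_zero_iff)
    have ge1: "1 \<le> norm (z + of_real a + of_nat n)" for n
      using abs_Im_le_cmod[of "z + of_real a + of_nat n"] t Im(2)[of n] by linarith
    have poch: "norm (pochhammer z N) \<le> (1 + a) ^ N * norm (pochhammer (z + of_real a) N)"
    proof -
      have "norm (pochhammer z N) = (\<Prod>n<N. norm (z + of_nat n))"
        by (simp add: pochhammer_prod prod_norm lessThan_atLeast0)
      also have "\<dots> \<le> (\<Prod>n<N. (1 + a) * norm (z + of_real a + of_nat n))"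
      proof (rule prod_mono, safe)
        fix n
        have "norm (z + of_nat n) \<le> norm (z + of_real a + of_nat n) + a"
          using norm_triangle_ineq4[of "z + of_real a + of_nat n" "of_real a"] a
          by (simp add: algebra_simps)
        also have "\<dots> \<le> (1 + a) * norm (z + of_real a + of_nat n)"
          using mult_left_mono[OF ge1[of n] a] by (simp add: algebra_simps)
        finally show "norm (z + of_nat n) \<le> (1 + a) * norm (z + of_real a + of_nat n)" .
      qed auto
      also have "\<dots> = (1 + a) ^ N * norm (pochhammer (z + of_real a) N)"
        by (simp add: pochhammer_prod prod_norm lessThan_atLeast0 prod.distrib)
      finally show ?thesis .
    qed
    have nzp: "norm (pochhammer (z + of_real a) N) > 0"
      using nz by (auto simp: pochhammer_eq_0_iff)
    have "norm (z + of_nat N + of_real a) \<le> \<bar>\<sigma> + real N + a\<bar> + \<bar>t\<bar>"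
      using cmod_le[of "z + of_nat N + of_real a"] by (simp add: z_def)
    also have "\<dots> \<le> (\<bar>\<sigma>\<bar> + real N + a) * \<bar>t\<bar> + \<bar>t\<bar>"
      using a t mult_left_mono[OF t, of "\<bar>\<sigma>\<bar> + real N + a"] by simp
    finally have lin: "norm (z + of_nat N + of_real a) \<le> (\<bar>\<sigma>\<bar> + real N + a + 1) * \<bar>t\<bar>"
      by (simp add: algebra_simps)
    have "norm (pochhammer (z + of_real a) N) * norm (Gamma (z + of_real a))
        = norm (Gamma (z + of_nat N + of_real a))"
      using pza by (simp add: norm_mult add_ac)
    also have "\<dots> \<le> norm (Gamma (z + of_nat N)) * (exp 1 * norm (z + of_nat N + of_real a)) powr a"
      using N a by (intro norm_Gamma_add_le) (auto simp: z_def)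
    also have "\<dots> \<le> norm (Gamma (z + of_nat N)) * (exp 1 * (\<bar>\<sigma>\<bar> + real N + a + 1) * \<bar>t\<bar>) powr a"
      using lin a by (intro mult_left_mono powr_mono2) auto
    also have "\<dots> = norm (pochhammer z N) * norm (Gamma z) *
        ((exp 1 * (\<bar>\<sigma>\<bar> + real N + a + 1)) powr a * \<bar>t\<bar> powr a)"
      using a by (subst powr_mult [symmetric]) (auto simp: pz norm_mult)
    also have "\<dots> \<le> (1 + a) ^ N * norm (pochhammer (z + of_real a) N) * norm (Gamma z) *
        ((exp 1 * (\<bar>\<sigma>\<bar> + real N + a + 1)) powr a * \<bar>t\<bar> powr a)"
      by (intro mult_right_mono poch) auto
    also have "\<dots> = norm (pochhammer (z + of_real a) N) * (K * \<bar>t\<bar> powr a * norm (Gamma z))"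
      by (simp add: K_def mult_ac)
    finally show ?thesis
      using nzp by (simp add: za z_def)
  qed
  ultimately show ?thesis using that by blast
qed

text \<open>Obtained from the upper bound by a detour over \<open>\<sigma> + N\<close>: from
  \<sigma> to \<open>\<sigma> + N\<close> the quotient is a Pochhammer symbol, of modulus at least
  \<open>|t| ^ N\<close>, and from \<open>\<sigma> + a\<close> to \<open>\<sigma> + N\<close> at
  most the power \<open>N - a\<close> of \<open>|t|\<close> is lost.\<close>

lemma Gamma_vertical_lower:
  fixes \<sigma> a :: real
  assumes a: "a \<ge> 0"
  obtains K where "K > 0" "\<And>t. \<bar>t\<bar> \<ge> 1 \<Longrightarrow>
    \<bar>t\<bar> powr a * norm (Gamma (Complex \<sigma> t)) \<le> K * norm (Gamma (Complex (\<sigma> + a) t))"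
proof -
  obtain N :: nat where N: "a \<le> real N" using real_arch_simple by blast
  obtain K where K: "K > 0" "\<And>t. \<bar>t\<bar> \<ge> 1 \<Longrightarrow>
      norm (Gamma (Complex (\<sigma> + a + (real N - a)) t))
        \<le> K * \<bar>t\<bar> powr (real N - a) * norm (Gamma (Complex (\<sigma> + a) t))"
    using Gamma_vertical_upper[of "real N - a" "\<sigma> + a"] N by auto
  have "\<bar>t\<bar> powr a * norm (Gamma (Complex \<sigma> t)) \<le> K * norm (Gamma (Complex (\<sigma> + a) t))"
    if t: "\<bar>t\<bar> \<ge> 1" for t
  proof -
    define z where "z = Complex \<sigma> t"
    have nz: "z \<notin> \<int>\<^sub>\<le>\<^sub>0"
      using t by (auto intro!: not_nonpos_Int_if_Im simp: z_def)
    have pz: "Gamma (z + of_nat N) = pochhammer z N * Gamma z"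
      using nz pochhammer_Gamma[of z N] by (auto simp: Gamma_eq_zero_iff)
    have "\<bar>t\<bar> ^ N = (\<Prod>n<N. \<bar>t\<bar>)" by simp
    also have "\<dots> \<le> (\<Prod>n<N. norm (z + of_nat n))"
      using abs_Im_le_cmod[of "z + of_nat n" for n] by (intro prod_mono) (auto simp: z_def)
    also have "\<dots> = norm (pochhammer z N)"
      by (simp add: pochhammer_prod prod_norm lessThan_atLeast0)
    finally have p: "\<bar>t\<bar> ^ N \<le> norm (pochhammer z N)" .
    have "\<bar>t\<bar> powr (real N - a) * (\<bar>t\<bar> powr a * norm (Gamma z)) = \<bar>t\<bar> ^ N * norm (Gamma z)"
      using t by (simp add: powr_add [symmetric] powr_realpow flip: mult.assoc)
    also have "\<dots> \<le> norm (Gamma (z + of_nat N))"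
      unfolding pz norm_mult by (intro mult_right_mono p) auto
    also have "z + of_nat N = Complex (\<sigma> + a + (real N - a)) t"
      by (simp add: z_def complex_eq_iff)
    also have "norm (Gamma \<dots>) \<le> \<bar>t\<bar> powr (real N - a) * (K * norm (Gamma (Complex (\<sigma> + a) t)))"
      using K(2)[OF t] by (simp add: mult_ac)
    finally have "\<bar>t\<bar> powr (real N - a) * (\<bar>t\<bar> powr a * norm (Gamma z))
        \<le> \<bar>t\<bar> powr (real N - a) * (K * norm (Gamma (Complex (\<sigma> + a) t)))" .
    moreover have "\<bar>t\<bar> powr (real N - a) > 0" using t by auto
    ultimately show ?thesis
      unfolding z_def by (rule mult_left_le_imp_le)
  qed
  with K(1) show ?thesis using that by blast
qed

text \<open>Already true of the approximants \<open>Gamma_series\<close>: the numerator has the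
  modulus of its value at \<open>Re z\<close>, and each factor \<open>z + i\<close> of the
  denominator has modulus at least \<open>Re z + i\<close>.\<close>

lemma norm_Gamma_le_Gamma_Re:
  fixes z :: complex
  assumes "Re z > 0"
  shows "norm (Gamma z) \<le> Gamma (Re z)"
proof (rule tendsto_le)
  show "(\<lambda>n. norm (Gamma_series z n)) \<longlonglongrightarrow> norm (Gamma z)"
    by (intro tendsto_norm Gamma_series_LIMSEQ)
  show "Gamma_series (Re z) \<longlonglongrightarrow> Gamma (Re z)"
    by (rule Gamma_series_LIMSEQ)
  show "\<forall>\<^sub>F n in sequentially. norm (Gamma_series z n) \<le> Gamma_series (Re z) n"
  proof (intro always_eventually allI)
    fix n
    have "pochhammer (Re z) (n + 1) \<le> norm (pochhammer z (n + 1))"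
      unfolding pochhammer_prod prod_norm[symmetric]
      using assms complex_Re_le_cmod[of "z + of_nat i" for i] by (intro prod_mono) auto
    then show "norm (Gamma_series z n) \<le> Gamma_series (Re z) n"
      unfolding Gamma_series_def norm_divide norm_mult norm_exp_eq_Re norm_fact
      using pochhammer_pos[OF assms, of "n + 1"]
      by (intro frac_le) auto
  qed
qed auto

lemma norm_sin_le_exp: "norm (sin (z::complex)) \<le> exp \<bar>Im z\<bar>"
proof -
  have "norm (sin z) \<le> (norm (exp (\<i> * z)) + norm (exp (- (\<i> * z)))) / 2"
    unfolding sin_exp_eq norm_divide norm_mult
    using norm_triangle_ineq4[of "exp (\<i> * z)" "exp (- (\<i> * z))"] by simp
  also have "\<dots> \<le> exp \<bar>Im z\<bar>"
    by (auto simp: abs_if)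
  finally show ?thesis .
qed

text \<open>A crude bound is enough, since the Phragmen-Lindelof argument tolerates any exponential
  growth. After a shift to the left by \<open>N\<close> the reflection formula leaves a sine and a
  Gamma value with real part in a compact interval.\<close>

lemma rGamma_vertical_growth:
  obtains M where "M > 0" "\<And>s. a \<le> Re s \<Longrightarrow> Re s \<le> b \<Longrightarrow> 1 \<le> \<bar>Im s\<bar> \<Longrightarrow>
    norm (rGamma s) \<le> M * exp (pi * \<bar>Im s\<bar>)"
proof -
  obtain N :: nat where N: "b \<le> real N" using real_arch_simple by blast
  have "compact (Gamma ` {1..max 1 (1 - a + real N)})"
    by (intro compact_continuous_image continuous_intros) (auto elim!: nonpos_Ints_cases)
  then have "bounded (Gamma ` {1..max 1 (1 - a + real N)})"
    by (rule compact_imp_bounded)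
  then obtain M where M: "M > 0" "\<And>x. x \<in> {1..max 1 (1 - a + real N)} \<Longrightarrow> norm (Gamma x) \<le> M"
    unfolding bounded_pos by auto
  have "norm (rGamma s) \<le> M * exp (pi * \<bar>Im s\<bar>)"
    if s: "a \<le> Re s" "Re s \<le> b" "1 \<le> \<bar>Im s\<bar>" for s
  proof -
    define z where "z = s - of_nat N"
    have Re1: "1 \<le> Re (1 - z)" using N s by (simp add: z_def)
    have nz: "z \<notin> \<int>\<^sub>\<le>\<^sub>0" "1 - z \<notin> \<int>\<^sub>\<le>\<^sub>0" using s by (auto intro!: not_nonpos_Int_if_Im simp: z_def)
    have "1 = (\<Prod>n<N. 1::real)" by simp
    also have "\<dots> \<le> (\<Prod>n<N. norm (z + of_nat n))"
      using s abs_Im_le_cmod[of "z + of_nat n" for n]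
      by (intro prod_mono) (auto simp: z_def intro: order_trans)
    also have "\<dots> = norm (pochhammer z N)"
      by (simp add: pochhammer_prod prod_norm lessThan_atLeast0)
    finally have p: "1 \<le> norm (pochhammer z N)" .
    have "norm (rGamma s) \<le> norm (pochhammer z N) * norm (rGamma s)"
      using mult_right_mono[OF p, of "norm (rGamma s)"] by simp
    also have "\<dots> = norm (rGamma z)"
      using pochhammer_rGamma[of z N] by (simp add: z_def norm_mult)
    also have "rGamma z = Gamma (1 - z) * sin (of_real pi * z) / of_real pi"
      using rGamma_reflection_complex[of z] nz(2)
      by (simp add: Gamma_def field_simps rGamma_eq_zero_iff)
    also have "norm \<dots> \<le> norm (Gamma (1 - z)) * norm (sin (of_real pi * z))"
      using pi_ge_two mult_left_mono[of 1 pi "norm (Gamma (1 - z)) * norm (sin (of_real pi * z))"]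
      by (simp add: norm_mult norm_divide divide_simps)
    also have "\<dots> \<le> M * exp (pi * \<bar>Im s\<bar>)"
    proof (rule mult_mono)
      have "norm (Gamma (1 - z)) \<le> Gamma (Re (1 - z))"
        using Re1 by (intro norm_Gamma_le_Gamma_Re) auto
      also have "\<dots> \<le> M"
        using M(2)[of "Re (1 - z)"] Re1 s by (auto simp: z_def)
      finally show "norm (Gamma (1 - z)) \<le> M" .
      show "norm (sin (of_real pi * z)) \<le> exp (pi * \<bar>Im s\<bar>)"
        using norm_sin_le_exp[of "of_real pi * z"] by (simp add: z_def abs_mult)
    qed (use M in auto)
    finally show ?thesis .
  qed
  with M(1) show ?thesis using that by blast
qed

text \<open>The growth factor is compensated by \<open>exp (\<eta> s\<^sup>2)\<close>, of modulus \<open>exp (\<eta> (\<sigma>\<^sup>2 - t\<^sup>2))\<close>, with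
  \<open>\<eta> \<rightarrow> 0\<close> at the end.\<close>

lemma Phragmen_Lindelof_half_strip:
  fixes h :: "complex \<Rightarrow> complex"
  assumes holo: "h holomorphic_on U" and U: "open U" "{s. a \<le> Re s \<and> Re s \<le> b \<and> T \<le> Im s} \<subseteq> U"
    and M: "M > 0"
    and side: "\<And>s. Re s = a \<or> Re s = b \<Longrightarrow> T \<le> Im s \<Longrightarrow> norm (h s) \<le> M"
    and bottom: "\<And>s. a \<le> Re s \<Longrightarrow> Re s \<le> b \<Longrightarrow> Im s = T \<Longrightarrow> norm (h s) \<le> M"
    and growth: "\<And>s. a \<le> Re s \<Longrightarrow> Re s \<le> b \<Longrightarrow> T \<le> Im s \<Longrightarrow> norm (h s) \<le> B * exp (A * Im s)"
    and s: "a \<le> Re s" "Re s \<le> b" "T \<le> Im s"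
  shows "norm (h s) \<le> M"
proof -
  define R where "R = max \<bar>a\<bar> \<bar>b\<bar>"
  have R: "(Re z)\<^sup>2 \<le> R\<^sup>2" if "a \<le> Re z" "Re z \<le> b" for z
  proof -
    have "\<bar>Re z\<bar> \<le> \<bar>R\<bar>" using that by (auto simp: R_def)
    then show ?thesis by (simp add: abs_le_square_iff)
  qed
  have main: "norm (h s) * exp (\<eta> * ((Re s)\<^sup>2 - (Im s)\<^sup>2)) \<le> M * exp (\<eta> * R\<^sup>2)" if \<eta>: "\<eta> > 0" for \<eta>
  proof -
    \<comment> \<open>The Gaussian weight beats the growth bound, so the top edge of the rectangle
      can be placed at a height where the weighted function is below \<open>M\<close>. The factor
      \<open>exp (\<eta> * R\<^sup>2)\<close> pays for the real parts.\<close>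
    have "((\<lambda>Y. \<bar>B\<bar> * exp (A * Y - \<eta> * Y\<^sup>2)) \<longlongrightarrow> 0) at_top"
      using \<eta> by real_asymp
    from order_tendstoD(2)[OF this M] have "\<forall>\<^sub>F Y in at_top. \<bar>B\<bar> * exp (A * Y - \<eta> * Y\<^sup>2) < M \<and> Y > Im s"
      using eventually_gt_at_top by (rule eventually_conj)
    then obtain Y where Y: "\<bar>B\<bar> * exp (A * Y - \<eta> * Y\<^sup>2) < M" "Y > Im s"
      by (auto dest: eventually_happens)
    define H where "H z = h z * exp (of_real \<eta> * z\<^sup>2)" for z
    define Q where "Q = cbox (Complex a T) (Complex b Y)"
    have Q: "z \<in> Q \<longleftrightarrow> a \<le> Re z \<and> Re z \<le> b \<and> T \<le> Im z \<and> Im z \<le> Y" for z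
      by (auto simp: Q_def in_cbox_complex_iff)
    have QU: "Q \<subseteq> U" using U(2) Q by blast
    have holH: "H holomorphic_on U"
      unfolding H_def by (intro holomorphic_intros holo)
    have "norm (H s) \<le> M * exp (\<eta> * R\<^sup>2)"
    proof (rule maximum_modulus_frontier[where S = Q and f = H and \<xi> = s])
      show "H holomorphic_on interior Q"
        using holH QU interior_subset holomorphic_on_subset by blast
      show "continuous_on (closure Q) H"
        using holH QU by (auto simp: Q_def intro: holomorphic_on_imp_continuous_on holomorphic_on_subset)
      show "bounded Q" "s \<in> Q"
        using s Y by (auto simp: Q) (auto simp: Q_def)
      fix z assume "z \<in> frontier Q"
      then have zQ: "z \<in> Q" and zb: "z \<notin> box (Complex a T) (Complex b Y)"
        by (auto simp: Q_def frontier_cbox)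
      have "norm (h z) * exp (- \<eta> * (Im z)\<^sup>2) \<le> M"
      proof (cases "Im z = Y")
        case True
        have "norm (h z) * exp (- \<eta> * (Im z)\<^sup>2) \<le> (\<bar>B\<bar> * exp (A * Im z)) * exp (- \<eta> * (Im z)\<^sup>2)"
          using growth[of z] zQ by (intro mult_right_mono) (auto simp: Q intro: order_trans mult_right_mono)
        also have "\<dots> \<le> M" using Y True by (simp add: exp_diff exp_minus field_simps)
        finally show ?thesis .
      next
        case False
        then have "norm (h z) \<le> M"
          using zQ zb side[of z] bottom[of z] by (auto simp: Q in_box_complex_iff)
        moreover have "exp (- \<eta> * (Im z)\<^sup>2) \<le> 1" using \<eta> by simp
        ultimately show ?thesis using M mult_mono[of "norm (h z)" M "exp (- \<eta> * (Im z)\<^sup>2)" 1] by auto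
      qed
      then have "norm (h z) * exp (- \<eta> * (Im z)\<^sup>2) * exp (\<eta> * (Re z)\<^sup>2) \<le> M * exp (\<eta> * R\<^sup>2)"
        using R[of z] zQ \<eta> M by (intro mult_mono) (auto simp: Q)
      then show "norm (H z) \<le> M * exp (\<eta> * R\<^sup>2)"
        by (simp add: H_def norm_mult Re_power2 mult.assoc exp_add[symmetric] algebra_simps)
    qed
    then show ?thesis by (simp add: H_def norm_mult Re_power2)
  qed
  show ?thesis
  proof (rule tendsto_le)
    show "((\<lambda>\<eta>. norm (h s) * exp (\<eta> * ((Re s)\<^sup>2 - (Im s)\<^sup>2))) \<longlongrightarrow> norm (h s)) (at_right 0)"
      by (auto intro!: tendsto_eq_intros)
    show "((\<lambda>\<eta>. M * exp (\<eta> * R\<^sup>2)) \<longlongrightarrow> M) (at_right 0)"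
      by (auto intro!: tendsto_eq_intros)
    show "\<forall>\<^sub>F \<eta> in at_right 0. norm (h s) * exp (\<eta> * ((Re s)\<^sup>2 - (Im s)\<^sup>2)) \<le> M * exp (\<eta> * R\<^sup>2)"
      using main by (auto simp: eventually_at_filter)
  qed auto
qed

section \<open>Moving lines of integration\<close>

lemma integrable_lborel_decay:
  fixes h :: "real \<Rightarrow> complex"
  assumes cont: "continuous_on UNIV h" and p: "p > 1"
    and bound: "\<And>t. \<bar>t\<bar> \<ge> 1 \<Longrightarrow> norm (h t) \<le> B * \<bar>t\<bar> powr (- p)"
  shows "integrable lborel h"
proof -
  have half: "integrable lborel (\<lambda>t. indicator {1..} t * t powr (- p))"
  proof (rule integrableI_nn_integral_finite)
    have "(\<integral>\<^sup>+t. ennreal (t powr (- p)) * indicator {1..} t \<partial>lborel)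
        = ennreal (0 - (- (1 powr (1 - p) / (p - 1))))"
    proof (rule nn_integral_FTC_atLeast[where F = "\<lambda>t. - (t powr (1 - p) / (p - 1))"])
      fix t :: real assume "1 \<le> t"
      then have "((\<lambda>t. - (t powr (1 - p) / (p - 1))) has_real_derivative
          - ((1 - p) * t powr (1 - p - 1) / (p - 1))) (at t)"
        using p by (auto intro!: derivative_eq_intros)
      also have "- ((1 - p) * t powr (1 - p - 1) / (p - 1)) = t powr (- p)"
        using p by (simp add: divide_simps) (simp add: algebra_simps)
      finally show "((\<lambda>t. - (t powr (1 - p) / (p - 1))) has_real_derivative t powr (- p)) (at t)" .
      show "0 \<le> t powr (- p)" by simp
    next
      show "((\<lambda>t. - (t powr (1 - p) / (p - 1))) \<longlongrightarrow> 0) at_top"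
        using p by real_asymp
    qed auto
    then show "(\<integral>\<^sup>+t. ennreal (indicator {1..} t * t powr (- p)) \<partial>lborel) = ennreal (1 / (p - 1))"
      by (simp add: ennreal_mult' ennreal_indicator mult.commute)
  qed (use p in auto)
  from lborel_integrable_real_affine[OF this, of "-1" 0]
  have half': "integrable lborel (\<lambda>t. indicator {1..} (- t) * (- t) powr (- p))" by simp
  have mid: "integrable lborel (\<lambda>t. indicator {-1..1} t *\<^sub>R h t)"
    using borel_integrable_compact[of "{-1..1}" h] cont
    by (simp add: set_integrable_def continuous_on_subset[of UNIV])
  show ?thesis
  proof (rule Bochner_Integration.integrable_bound)
    show "integrable lborel (\<lambda>t. norm (indicator {-1..1} t *\<^sub>R h t)
        + \<bar>B\<bar> * (indicator {1..} t * t powr (- p)) + \<bar>B\<bar> * (indicator {1..} (- t) * (- t) powr (- p)))"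
      by (intro Bochner_Integration.integrable_add integrable_norm mid integrable_mult_right half half')
    show "h \<in> borel_measurable lborel"
      using cont by (simp add: borel_measurable_continuous_onI)
    have "norm (h t) \<le> \<bar>B\<bar> * \<bar>t\<bar> powr (- p)" if "\<bar>t\<bar> \<ge> 1" for t
      using bound[OF that] by (rule order_trans) (auto intro!: mult_right_mono)
    then show "AE t in lborel. norm (h t) \<le> norm (norm (indicator {-1..1} t *\<^sub>R h t)
        + \<bar>B\<bar> * (indicator {1..} t * t powr (- p)) + \<bar>B\<bar> * (indicator {1..} (- t) * (- t) powr (- p)))"
    proof (intro AE_I2)
      fix t :: real
      let ?X = "norm (indicator {-1..1} t *\<^sub>R h t)" and ?Y = "\<bar>B\<bar> * (indicator {1..} t * t powr (- p))"
        and ?Z = "\<bar>B\<bar> * (indicator {1..} (- t) * (- t) powr (- p))"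
      have nonneg: "?X \<ge> 0" "?Y \<ge> 0" "?Z \<ge> 0" by auto
      consider "\<bar>t\<bar> \<le> 1" | "t \<ge> 1" | "t \<le> -1" by linarith
      then have "norm (h t) \<le> ?X \<or> norm (h t) \<le> ?Y \<or> norm (h t) \<le> ?Z"
      proof cases
        case 1
        then show ?thesis by (auto simp: indicator_def abs_le_iff)
      next
        case 2
        with \<open>\<And>t. \<bar>t\<bar> \<ge> 1 \<Longrightarrow> norm (h t) \<le> \<bar>B\<bar> * \<bar>t\<bar> powr (- p)\<close>[of t] show ?thesis by simp
      next
        case 3
        with \<open>\<And>t. \<bar>t\<bar> \<ge> 1 \<Longrightarrow> norm (h t) \<le> \<bar>B\<bar> * \<bar>t\<bar> powr (- p)\<close>[of t] show ?thesis by simp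
      qed
      then show "norm (h t) \<le> norm (?X + ?Y + ?Z)"
        unfolding real_norm_def using nonneg by linarith
    qed
  qed
qed

lemma contour_integral_rectpath:
  assumes cont: "continuous_on (path_image (rectpath (Complex a (- H)) (Complex b H))) f"
    and "a < b" "H > 0"
  shows "contour_integral (rectpath (Complex a (- H)) (Complex b H)) f =
      contour_integral (linepath (Complex a (- H)) (Complex b (- H))) f
      + \<i> * integral {- H..H} (\<lambda>t. f (Complex b t))
      - contour_integral (linepath (Complex a H) (Complex b H)) f
      - \<i> * integral {- H..H} (\<lambda>t. f (Complex a t))"
proof -
  let ?a1 = "Complex a (- H)" and ?a2 = "Complex b (- H)" and ?a3 = "Complex b H" and ?a4 = "Complex a H"
  have ci: "f contour_integrable_on linepath ?a1 ?a2" "f contour_integrable_on linepath ?a2 ?a3"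
       "f contour_integrable_on linepath ?a3 ?a4" "f contour_integrable_on linepath ?a4 ?a1"
    by (auto intro!: contour_integrable_continuous_linepath continuous_on_subset[OF cont]
        simp: rectpath_def Let_def path_image_join)
  have "contour_integral (rectpath ?a1 ?a3) f
      = contour_integral (linepath ?a1 ?a2) f + contour_integral (linepath ?a2 ?a3) f
      + contour_integral (linepath ?a3 ?a4) f + contour_integral (linepath ?a4 ?a1) f"
    by (simp add: rectpath_def Let_def ci valid_path_join)
  also have "contour_integral (linepath ?a2 ?a3) f = \<i> * integral {- H..H} (\<lambda>t. f (Complex b t))"
    using assms by (intro contour_integral_linepath_same_Re) auto
  also have "contour_integral (linepath ?a4 ?a1) f = - contour_integral (linepath ?a1 ?a4) f"
    using contour_integral_reversepath[of "linepath ?a1 ?a4" f] by simp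
  also have "contour_integral (linepath ?a1 ?a4) f = \<i> * integral {- H..H} (\<lambda>t. f (Complex a t))"
    using assms by (intro contour_integral_linepath_same_Re) auto
  also have "contour_integral (linepath ?a3 ?a4) f = - contour_integral (linepath ?a4 ?a3) f"
    using contour_integral_reversepath[of "linepath ?a4 ?a3" f] by simp
  finally show ?thesis by simp
qed

lemma integral_symmetric_tendsto:
  fixes h :: "real \<Rightarrow> complex"
  assumes "integrable lborel h"
  shows "(\<lambda>n. integral {- real n..real n} h) \<longlonglongrightarrow> (LINT t|lborel. h t)"
proof -
  have [measurable]: "h \<in> borel_measurable borel" using assms by auto
  have "(\<lambda>n. LINT t|lborel. indicator {- real n..real n} t *\<^sub>R h t) \<longlonglongrightarrow> (LINT t|lborel. h t)"
  proof (rule integral_dominated_convergence)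
    show "integrable lborel (\<lambda>t. norm (h t))" using assms by simp
    show "AE t in lborel. (\<lambda>n. indicator {- real n..real n} t *\<^sub>R h t) \<longlonglongrightarrow> h t"
    proof (rule AE_I2, rule tendsto_eventually)
      fix t :: real
      obtain N :: nat where "\<bar>t\<bar> \<le> real N" using real_arch_simple by blast
      then show "\<forall>\<^sub>F n in sequentially. indicator {- real n..real n} t *\<^sub>R h t = h t"
        by (intro eventually_sequentiallyI[of N]) (auto simp: indicator_def)
    qed
  qed (auto split: split_indicator)
  also have "(\<lambda>n. LINT t|lborel. indicator {- real n..real n} t *\<^sub>R h t)
      = (\<lambda>n. integral {- real n..real n} h)"
  proof
    fix n
    have "set_integrable lborel {- real n..real n} h"
      unfolding set_integrable_def using assms by (intro integrable_mult_indicator) auto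
    from set_borel_integral_eq_integral(2)[OF this]
    show "(LINT t|lborel. indicator {- real n..real n} t *\<^sub>R h t) = integral {- real n..real n} h"
      by (simp add: set_lebesgue_integral_def)
  qed
  finally show ?thesis .
qed

text \<open>Only the winding numbers matter: 1 about the points inside the strip and 0 about the
  others. This covers both the rectangles and the given curve \<open>C\<close>, and makes their
  integrals comparable.\<close>

lemma contour_integral_eq_residues_in_strip:
  assumes U: "open U" "convex U" and pts: "finite pts" and holo: "f holomorphic_on U - pts"
    and C: "valid_path C" "pathfinish C = pathstart C" "path_image C \<subseteq> U - pts"
    and wn: "\<And>p. p \<in> pts \<Longrightarrow> winding_number C p = (if a < Re p \<and> Re p < b then 1 else 0)"
  shows "contour_integral C f = 2 * of_real pi * \<i> * (\<Sum>p | p \<in> pts \<and> a < Re p \<and> Re p < b. residue f p)"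
proof -
  have "contour_integral C f = of_real (2 * pi) * \<i> * (\<Sum>p\<in>pts. winding_number C p * residue f p)"
  proof (rule Residue_theorem[OF _ _ pts holo])
    have "path_image C \<subseteq> U" using C by blast
    then show "\<forall>z. z \<notin> U \<longrightarrow> winding_number C z = 0"
      using winding_number_zero_outside[of C U] C U valid_path_imp_path by blast
  qed (use U C in \<open>auto simp: convex_connected\<close>)
  also have "(\<Sum>p\<in>pts. winding_number C p * residue f p)
      = (\<Sum>p\<in>pts. if a < Re p \<and> Re p < b then residue f p else 0)"
    by (intro sum.cong) (auto simp: wn)
  also have "\<dots> = (\<Sum>p | p \<in> pts \<and> a < Re p \<and> Re p < b. residue f p)"
    using pts by (simp add: sum.inter_filter)
  finally show ?thesis by simp
qed

lemma winding_number_zero_outside_strip: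
  assumes "valid_path C" "pathfinish C = pathstart C" "path_image C \<subseteq> {s. a < Re s \<and> Re s < b}"
    and "\<not> (a < Re z \<and> Re z < b)"
  shows "winding_number C z = 0"
  using assms
  by (intro winding_number_zero_outside[of C "{s. a < Re s \<and> Re s < b}"] valid_path_imp_path)
     (auto simp: convex_halfspace_Re_gt convex_halfspace_Re_lt Collect_conj_eq intro!: convex_Int)

lemma winding_number_rectpath_strip:
  assumes "a < b" "\<bar>Im p\<bar> < H" "Re p \<noteq> a" "Re p \<noteq> b"
  shows "winding_number (rectpath (Complex a (- H)) (Complex b H)) p = (if a < Re p \<and> Re p < b then 1 else 0)"
proof (cases "a < Re p \<and> Re p < b")
  case True
  with assms show ?thesis by (auto intro!: winding_number_rectpath simp: in_box_complex_iff)
next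
  case False
  with assms show ?thesis
    by (auto intro!: winding_number_rectpath_outside simp: in_cbox_complex_iff)
qed

lemma contour_integral_rectpath_residues:
  assumes U: "open U" "convex U" "{z. a \<le> Re z \<and> Re z \<le> b} \<subseteq> U"
    and pts: "finite pts" and holo: "f holomorphic_on U - pts" and "a < b"
    and edge: "\<And>p. p \<in> pts \<Longrightarrow> Re p \<noteq> a \<and> Re p \<noteq> b \<and> \<bar>Im p\<bar> < H" and H: "H > 0"
  shows "contour_integral (rectpath (Complex a (- H)) (Complex b H)) f
      = 2 * of_real pi * \<i> * (\<Sum>p | p \<in> pts \<and> a < Re p \<and> Re p < b. residue f p)"
    and "path_image (rectpath (Complex a (- H)) (Complex b H)) \<subseteq> U - pts"
proof -
  show sub: "path_image (rectpath (Complex a (- H)) (Complex b H)) \<subseteq> U - pts"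
    using \<open>a < b\<close> H edge U(3) by (fastforce simp: path_image_rectpath)
  show "contour_integral (rectpath (Complex a (- H)) (Complex b H)) f
      = 2 * of_real pi * \<i> * (\<Sum>p | p \<in> pts \<and> a < Re p \<and> Re p < b. residue f p)"
    using edge \<open>a < b\<close>
    by (intro contour_integral_eq_residues_in_strip[OF U(1,2) pts holo _ _ sub]
          winding_number_rectpath_strip) auto
qed

text \<open>\<open>U\<close> need not be the plane: the Perron kernel allows
  \<open>U = UNIV\<close>, but the main integrand is controlled only in a half-plane that excludes
  the poles of \<open>\<psi> (v + u - z)\<close>.\<close>

lemma vertical_line_shift:
  assumes U: "open U" "convex U" "{z. a \<le> Re z \<and> Re z \<le> b} \<subseteq> U"
    and pts: "finite pts" and holo: "f holomorphic_on U - pts" and ab: "a < b"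
    and edge: "\<And>p. p \<in> pts \<Longrightarrow> Re p \<noteq> a \<and> Re p \<noteq> b"
    and int: "integrable lborel (\<lambda>t. f (Complex a t))" "integrable lborel (\<lambda>t. f (Complex b t))"
    and decay: "\<And>e. e > 0 \<Longrightarrow> \<exists>T. \<forall>s. a \<le> Re s \<longrightarrow> Re s \<le> b \<longrightarrow> T \<le> \<bar>Im s\<bar> \<longrightarrow> norm (f s) \<le> e"
  shows "(LINT t|lborel. f (Complex b t)) - (LINT t|lborel. f (Complex a t))
      = 2 * of_real pi * (\<Sum>p | p \<in> pts \<and> a < Re p \<and> Re p < b. residue f p)"
proof -
  define Q where "Q n = rectpath (Complex a (- real n)) (Complex b (real n))" for n
  define K where "K = 2 * of_real pi * \<i> * (\<Sum>p | p \<in> pts \<and> a < Re p \<and> Re p < b. residue f p)"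
  define top where "top n = contour_integral (linepath (Complex a (real n)) (Complex b (real n))) f" for n
  define bot where "bot n = contour_integral (linepath (Complex a (- real n)) (Complex b (- real n))) f" for n
  have "bdd_above ((\<lambda>p. \<bar>Im p\<bar>) ` pts)" using pts by simp
  then obtain B where B: "\<And>p. p \<in> pts \<Longrightarrow> \<bar>Im p\<bar> \<le> B" by (auto simp: bdd_above_def)
  obtain N0 :: nat where N0: "max B 0 < real N0" using reals_Archimedean2 by blast
  have edge': "Re p \<noteq> a \<and> Re p \<noteq> b \<and> \<bar>Im p\<bar> < real n" if "p \<in> pts" "n \<ge> N0" for p n
    using edge[OF that(1)] B[OF that(1)] N0 that(2) by auto
  have n0: "real n > 0" if "n \<ge> N0" for n using N0 that by auto
  have K: "contour_integral (Q n) f = K" and sub: "path_image (Q n) \<subseteq> U - pts" if "n \<ge> N0" for n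
    unfolding Q_def K_def
    using contour_integral_rectpath_residues[OF U pts holo ab, of "real n"] edge' n0 that by auto
  have split: "K = bot n + \<i> * integral {- real n..real n} (\<lambda>t. f (Complex b t)) - top n
      - \<i> * integral {- real n..real n} (\<lambda>t. f (Complex a t))" if "n \<ge> N0" for n
  proof -
    have "continuous_on (path_image (Q n)) f"
      by (rule holomorphic_on_imp_continuous_on[OF holomorphic_on_subset[OF holo sub[OF that]]])
    from contour_integral_rectpath[OF this[unfolded Q_def] ab n0[OF that]] K[OF that]
    show ?thesis by (simp only: Q_def top_def bot_def)
  qed
  \<comment> \<open>The horizontal edges have the fixed length \<open>b - a\<close>, so uniform
    smallness of \<open>f\<close> at great height suffices. The sign \<open>d\<close> treats the top
    and bottom edges together.\<close>
  have seg: "(\<lambda>n. contour_integral (linepath (Complex a (d * real n)) (Complex b (d * real n))) f) \<longlonglongrightarrow> 0"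
    if d: "\<bar>d\<bar> = 1" for d :: real
  proof (rule tendstoI)
    fix e :: real assume e: "e > 0"
    define e' where "e' = e / 2 / (b - a)"
    have e': "e' > 0" using e ab by (simp add: e'_def)
    obtain T where T: "\<And>s. a \<le> Re s \<Longrightarrow> Re s \<le> b \<Longrightarrow> T \<le> \<bar>Im s\<bar> \<Longrightarrow> norm (f s) \<le> e'"
      using decay[OF e'] by blast
    obtain N1 :: nat where N1: "max T 0 \<le> real N1" using real_arch_simple by blast
    show "\<forall>\<^sub>F n in sequentially. dist (contour_integral (linepath (Complex a (d * real n)) (Complex b (d * real n))) f) 0 < e"
    proof (rule eventually_sequentiallyI[of "max N0 N1"])
      fix n assume n: "max N0 N1 \<le> n"
      let ?l = "linepath (Complex a (d * real n)) (Complex b (d * real n))"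
      have img: "a \<le> Re z \<and> Re z \<le> b \<and> \<bar>Im z\<bar> = real n" if z: "z \<in> path_image ?l" for z
      proof -
        from z obtain u where u: "0 \<le> u" "u \<le> 1" "z = (1 - u) *\<^sub>R Complex a (d * real n) + u *\<^sub>R Complex b (d * real n)"
          by (auto simp: closed_segment_def)
        have Im: "Im z = d * real n" unfolding u(3) by (simp add: algebra_simps)
        have Re: "Re z = a + u * (b - a)" unfolding u(3) by (simp add: algebra_simps)
        have "u * (b - a) \<le> b - a" "0 \<le> u * (b - a)" using u ab by (auto simp: mult_left_le_one_le)
        then show ?thesis using Re Im d by (simp add: abs_mult)
      qed
      have "continuous_on (path_image ?l) f"
      proof (rule holomorphic_on_imp_continuous_on, rule holomorphic_on_subset[OF holo], rule subsetI)
        fix z assume "z \<in> path_image ?l"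
        from img[OF this] show "z \<in> U - pts"
          using U(3) edge'[of z n] n by auto
      qed
      then have "f contour_integrable_on ?l"
        by (intro contour_integrable_continuous_linepath) simp
      from has_contour_integral_integral[OF this]
      have "norm (contour_integral ?l f) \<le> e' * norm (Complex b (d * real n) - Complex a (d * real n))"
        using T img N1 n e' by (intro has_contour_integral_bound_linepath[of f _ _ _ e']) auto
      also have "norm (Complex b (d * real n) - Complex a (d * real n)) = b - a"
        using ab by (simp add: complex_diff cmod_def)
      also have "e' * (b - a) < e"
      proof -
        obtain L where "b - a = L" "L > 0" using ab by simp
        then show ?thesis using e by (simp add: e'_def)
      qed
      finally show "dist (contour_integral ?l f) 0 < e" by simp
    qed
  qed
  have "(\<lambda>n. bot n + \<i> * integral {- real n..real n} (\<lambda>t. f (Complex b t)) - top n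
      - \<i> * integral {- real n..real n} (\<lambda>t. f (Complex a t)))
      \<longlonglongrightarrow> 0 + \<i> * (LINT t|lborel. f (Complex b t)) - 0 - \<i> * (LINT t|lborel. f (Complex a t))"
    unfolding top_def bot_def using seg[of 1] seg[of "-1"]
    by (intro tendsto_intros integral_symmetric_tendsto int) auto
  moreover have "(\<lambda>n. bot n + \<i> * integral {- real n..real n} (\<lambda>t. f (Complex b t)) - top n
      - \<i> * integral {- real n..real n} (\<lambda>t. f (Complex a t))) \<longlonglongrightarrow> K"
    using split by (intro tendsto_eventually eventually_sequentiallyI[of N0]) auto
  ultimately have "K = \<i> * ((LINT t|lborel. f (Complex b t)) - (LINT t|lborel. f (Complex a t)))"
    using LIMSEQ_unique by (fastforce simp: algebra_simps)
  then have "\<i> * ((LINT t|lborel. f (Complex b t)) - (LINT t|lborel. f (Complex a t)))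
      = \<i> * (2 * of_real pi * (\<Sum>p | p \<in> pts \<and> a < Re p \<and> Re p < b. residue f p))"
    unfolding K_def by (simp add: algebra_simps)
  then show ?thesis using mult_left_cancel[of \<i>] complex_i_not_zero by blast
qed

section \<open>Perron's formula for Riesz means\<close>

text \<open>The reciprocal Pochhammer symbol is \<open>Gamma w / Gamma (w + k + 1)\<close>, written
  so that its only poles \<open>0, -1, ..., -k\<close> are visible and no value of
  \<open>Gamma\<close> at a pole enters.\<close>

abbreviation Riesz_kernel :: "nat \<Rightarrow> real \<Rightarrow> complex \<Rightarrow> complex" where
  "Riesz_kernel k y w \<equiv> of_real y powr w / pochhammer w (Suc k)"

lemma powr_le_max:
  fixes y :: real
  assumes y: "y > 0" and r: "a \<le> r" "r \<le> b"
  shows "y powr r \<le> max (y powr a) (y powr b)"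
proof (cases "y \<ge> 1")
  case True
  then show ?thesis using powr_mono[OF r(2)] by (simp add: le_max_iff_disj)
next
  case False
  then show ?thesis using y powr_mono'[OF r(1)] by (simp add: le_max_iff_disj)
qed

lemma norm_pochhammer_ge_Im: "\<bar>Im w\<bar> ^ n \<le> norm (pochhammer w n)"
proof -
  have "\<bar>Im w\<bar> ^ n = (\<Prod>i<n. \<bar>Im w\<bar>)" by simp
  also have "\<dots> \<le> (\<Prod>i<n. norm (w + of_nat i))"
    using abs_Im_le_cmod[of "w + of_nat i" for i] by (intro prod_mono) auto
  also have "\<dots> = norm (pochhammer w n)"
    by (simp add: pochhammer_prod prod_norm lessThan_atLeast0)
  finally show ?thesis .
qed

lemma pochhammer_nonzero_off_poles:
  "w \<notin> (\<lambda>j. - of_nat j) ` {..k} \<Longrightarrow> pochhammer w (Suc k) \<noteq> (0::complex)"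
  unfolding pochhammer_eq_0_iff less_Suc_eq_le by auto

lemma holomorphic_pochhammer [holomorphic_intros]:
  "f holomorphic_on A \<Longrightarrow> (\<lambda>w. pochhammer (f w) n) holomorphic_on A"
  unfolding pochhammer_prod by (auto intro!: holomorphic_on_prod holomorphic_on_add)

text \<open>The vanishing factor \<open>w + j\<close> is split off. At \<open>w = -j\<close> the
  factors before it multiply to \<open>(-1) ^ j * fact j\<close>, those after it to
  \<open>fact (k - j)\<close>.\<close>

lemma pochhammer_residue:
  fixes g :: "complex \<Rightarrow> complex"
  assumes g: "g holomorphic_on UNIV" and j: "j \<le> k"
  shows "residue (\<lambda>w. g w / pochhammer w (Suc k)) (- of_nat j)
       = g (- of_nat j) * (-1) ^ j / (fact j * fact (k - j))"
proof -
  let ?z = "- of_nat j :: complex"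
  have split: "pochhammer w (Suc k) = pochhammer w j * (w + of_nat j) * pochhammer (w + of_nat j + 1) (k - j)"
    for w :: complex
    using j pochhammer_product[of "Suc j" "Suc k" w] by (simp add: pochhammer_Suc add_ac)
  define h where "h w = g w / (pochhammer w j * pochhammer (w + of_nat j + 1) (k - j))" for w
  define s where "s = - (((\<lambda>i. - of_nat i) ` {..k}) - {?z})"
  have nz: "pochhammer w j * pochhammer (w + of_nat j + 1) (k - j) \<noteq> 0" if "w \<in> s" for w
  proof (cases "w = ?z")
    case True
    then show ?thesis by (simp add: pochhammer_same pochhammer_fact[symmetric])
  next
    case False
    then have "pochhammer w (Suc k) \<noteq> 0"
      using that by (intro pochhammer_nonzero_off_poles) (auto simp: s_def)
    then show ?thesis by (simp add: split)
  qed
  have "residue (\<lambda>w. h w / (w - ?z)) ?z = h ?z"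
  proof (rule residue_simple)
    show "open s" unfolding s_def by (intro open_Compl finite_imp_closed) auto
    show "?z \<in> s" by (simp add: s_def)
    show "h holomorphic_on s"
      unfolding h_def using nz by (intro holomorphic_intros holomorphic_on_subset[OF g]) auto
  qed
  also have "(\<lambda>w. h w / (w - ?z)) = (\<lambda>w. g w / pochhammer w (Suc k))"
    by (simp add: h_def split mult_ac fun_eq_iff)
  also have "h ?z = g ?z * (-1) ^ j / (fact j * fact (k - j))"
    by (simp add: h_def pochhammer_same pochhammer_fact[symmetric] divide_simps power_mult_distrib[symmetric])
  finally show ?thesis .
qed

text \<open>Each of the \<open>k + 1\<close> factors has modulus at least \<open>|t|\<close>; the
  resulting exponent exceeds 1 because \<open>k \<ge> 1\<close>.\<close>

lemma integrable_inverse_pochhammer: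
  assumes k: "k \<ge> 1" and c: "\<And>j. j \<le> k \<Longrightarrow> c \<noteq> - real j" and y: "y > 0"
  shows "integrable lborel (\<lambda>t. Riesz_kernel k y (Complex c t))"
proof (rule integrable_lborel_decay)
  have "pochhammer (Complex c t) (Suc k) \<noteq> 0" for t
    using c by (intro pochhammer_nonzero_off_poles) (auto simp: complex_eq_iff)
  then show "continuous_on UNIV (\<lambda>t. Riesz_kernel k y (Complex c t))"
    unfolding pochhammer_prod Complex_eq using y by (intro continuous_intros) auto
  show "1 < real (Suc k)" using k by simp
  fix t :: real assume t: "\<bar>t\<bar> \<ge> 1"
  have "norm (Riesz_kernel k y (Complex c t))
      \<le> y powr c / \<bar>t\<bar> ^ Suc k"
    using norm_pochhammer_ge_Im[of "Complex c t" "Suc k"] t y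
    unfolding norm_divide by (intro frac_le) (auto simp: norm_powr_real_powr)
  also have "\<dots> = y powr c * \<bar>t\<bar> powr - real (Suc k)"
    using t by (simp add: powr_minus powr_realpow divide_inverse del: power_Suc of_nat_Suc)
  finally show "norm (Riesz_kernel k y (Complex c t))
      \<le> y powr c * \<bar>t\<bar> powr - real (Suc k)" .
qed

lemma Perron_shift:
  assumes k: "k \<ge> 1" and y: "y > 0" and ab: "a < b"
    and a: "\<And>j. j \<le> k \<Longrightarrow> a \<noteq> - real j" and b: "\<And>j. j \<le> k \<Longrightarrow> b \<noteq> - real j"
  shows "(LINT t|lborel. Riesz_kernel k y (Complex b t))
      - (LINT t|lborel. Riesz_kernel k y (Complex a t))
      = 2 * of_real pi * (\<Sum>j | j \<le> k \<and> a < - real j \<and> - real j < b.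
          of_real y powr (- of_nat j) * (-1) ^ j / (fact j * fact (k - j)))"
proof -
  define pts where "pts = (\<lambda>j. - of_nat j :: complex) ` {..k}"
  define f :: "complex \<Rightarrow> complex" where "f w = of_real y powr w / pochhammer w (Suc k)" for w
  have "(LINT t|lborel. f (Complex b t)) - (LINT t|lborel. f (Complex a t))
      = 2 * of_real pi * (\<Sum>p | p \<in> pts \<and> a < Re p \<and> Re p < b. residue f p)"
  proof (rule vertical_line_shift[where U = UNIV])
    show "f holomorphic_on UNIV - pts"
      unfolding f_def using pochhammer_nonzero_off_poles y
      by (intro holomorphic_intros) (auto simp: pts_def)
    show "integrable lborel (\<lambda>t. f (Complex a t))" "integrable lborel (\<lambda>t. f (Complex b t))"
      unfolding f_def using integrable_inverse_pochhammer k a b y by auto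
    fix e :: real assume e: "e > 0"
    define M where "M = max (y powr a) (y powr b)"
    have M: "y powr r \<le> M" if "a \<le> r" "r \<le> b" for r
      unfolding M_def by (rule powr_le_max[OF y that])
    have M0: "0 < M" using y by (simp add: M_def less_max_iff_disj)
    show "\<exists>T. \<forall>s. a \<le> Re s \<longrightarrow> Re s \<le> b \<longrightarrow> T \<le> \<bar>Im s\<bar> \<longrightarrow> norm (f s) \<le> e"
    proof (intro exI[of _ "max 1 (M / e)"] allI impI)
      fix s assume s: "a \<le> Re s" "Re s \<le> b" "max 1 (M / e) \<le> \<bar>Im s\<bar>"
      have "norm (f s) \<le> M / \<bar>Im s\<bar> ^ Suc k"
        unfolding f_def norm_divide using M M0 s y norm_pochhammer_ge_Im[of s "Suc k"]
        by (intro frac_le) (auto simp: norm_powr_real_powr)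
      also have "\<dots> \<le> M / \<bar>Im s\<bar> ^ 1"
        using s M0 by (intro divide_left_mono power_increasing mult_pos_pos zero_less_power) auto
      also have "\<dots> \<le> e"
      proof -
        have "M \<le> e * \<bar>Im s\<bar>" using s e by (simp add: field_simps)
        moreover have "\<bar>Im s\<bar> > 0" using s by linarith
        ultimately show ?thesis by (simp only: power_one_right pos_divide_le_eq)
      qed
      finally show "norm (f s) \<le> e" .
    qed
  next
    fix p assume "p \<in> pts"
    then obtain j where "j \<le> k" "p = - of_nat j" by (auto simp: pts_def)
    then show "Re p \<noteq> a \<and> Re p \<noteq> b" using a[of j] b[of j] by auto
  qed (use ab in \<open>auto simp: pts_def\<close>)
  also have "(\<Sum>p | p \<in> pts \<and> a < Re p \<and> Re p < b. residue f p)
      = (\<Sum>j | j \<le> k \<and> a < - real j \<and> - real j < b. residue f (- of_nat j))"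
  proof -
    have "{p. p \<in> pts \<and> a < Re p \<and> Re p < b} = (\<lambda>j. - of_nat j) ` {j. j \<le> k \<and> a < - real j \<and> - real j < b}"
      by (auto simp: pts_def)
    then show ?thesis by (simp add: sum.reindex inj_on_def)
  qed
  also have "\<dots> = (\<Sum>j | j \<le> k \<and> a < - real j \<and> - real j < b.
          of_real y powr (- of_nat j) * (-1) ^ j / (fact j * fact (k - j)))"
  proof (rule sum.cong[OF refl])
    fix j assume "j \<in> {j. j \<le> k \<and> a < - real j \<and> - real j < b}"
    moreover have "(\<lambda>w. of_real y powr w) holomorphic_on UNIV" using y by (intro holomorphic_intros) auto
    ultimately show "residue f (- of_nat j)
        = of_real y powr (- of_nat j) * (-1) ^ j / (fact j * fact (k - j))"
      unfolding f_def by (intro pochhammer_residue) auto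
  qed
  finally show ?thesis unfolding f_def .
qed

lemma integrable_inverse_1_plus_square_lborel: "integrable lborel (\<lambda>t::real. 1 / (1 + t\<^sup>2))"
proof -
  have "integrable lborel (\<lambda>t::real. 1 / (1 + (of_real t)\<^sup>2) :: complex)"
  proof (rule integrable_lborel_decay[of _ 2 1])
    have "1 + (complex_of_real t)\<^sup>2 \<noteq> 0" for t
      by (metis add_pos_nonneg less_numeral_extra(1) less_numeral_extra(3) of_real_1 of_real_add
          of_real_eq_0_iff of_real_power zero_le_power2)
    then show "continuous_on UNIV (\<lambda>t. 1 / (1 + (complex_of_real t)\<^sup>2))"
      by (intro continuous_intros) auto
    fix t :: real assume t: "\<bar>t\<bar> \<ge> 1"
    have "norm (1 / (1 + (complex_of_real t)\<^sup>2)) = norm (complex_of_real (1 / (1 + t\<^sup>2)))" by simp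
    also have "\<dots> = 1 / (1 + t\<^sup>2)" by (subst norm_of_real) simp
    also have "\<dots> \<le> 1 / t\<^sup>2" using t by (intro divide_left_mono) (auto intro!: mult_pos_pos add_pos_nonneg)
    also have "\<dots> = 1 * \<bar>t\<bar> powr - 2"
      using t powr_realpow[of "\<bar>t\<bar>" 2] by (simp add: powr_minus divide_inverse)
    finally show "norm (1 / (1 + (complex_of_real t)\<^sup>2)) \<le> 1 * \<bar>t\<bar> powr - 2" .
  qed auto
  moreover have "1 / (1 + (complex_of_real t)\<^sup>2) = of_real (1 / (1 + t\<^sup>2))" for t
    by simp
  ultimately show ?thesis
    using integrable_Re[of lborel "\<lambda>t::real. 1 / (1 + (of_real t)\<^sup>2)"] by (simp only: Re_complex_of_real)
qed

text \<open>Dominated convergence while the line runs off to infinity. As \<open>k \<ge> 1\<close>,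
  the Pochhammer symbol has at least two factors; by \<open>far\<close> these two yield the majorant
  \<open>1 / (1 + t\<^sup>2)\<close>, and the others have modulus at least 1.\<close>

lemma Perron_limit:
  fixes c :: "nat \<Rightarrow> real"
  assumes k: "k \<ge> 1" and y: "y > 0"
    and yc: "\<And>n. y powr c n \<le> 1" and c: "filterlim (\<lambda>n. \<bar>c n\<bar>) at_top sequentially"
    and far: "\<And>n j. j \<le> k \<Longrightarrow> 1 \<le> \<bar>c n + real j\<bar>"
  shows "(\<lambda>n. LINT t|lborel. Riesz_kernel k y (Complex (c n) t)) \<longlonglongrightarrow> 0"
proof -
  have ge: "sqrt (1 + t\<^sup>2) \<le> norm (Complex (c n) t + of_nat j)" if "j \<le> k" for n t j
  proof -
    have "1\<^sup>2 \<le> \<bar>c n + real j\<bar>\<^sup>2" using far[OF that, of n] by (intro power_mono) auto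
    then show ?thesis by (auto simp: cmod_def)
  qed
  have ge1: "1 \<le> norm (Complex (c n) t + of_nat j)" if "j \<le> k" for n t j
    using ge[OF that, of t n] by (rule order_trans[rotated]) simp
  have poch: "pochhammer z (Suc k) = z * (z + of_nat 1) * pochhammer (z + of_nat 2) (k - 1)" for z :: complex
    using k pochhammer_product[of 2 "Suc k" z] by (simp add: numeral_2_eq_2 pochhammer_Suc)
  have prod1: "1 \<le> norm (pochhammer (Complex (c n) t + of_nat 2) (k - 1))" for n t
  proof -
    have "1 = (\<Prod>i<k-1. 1::real)" by simp
    also have "\<dots> \<le> (\<Prod>i<k-1. norm (Complex (c n) t + of_nat 2 + of_nat i))"
      using ge1[of "2 + i" n t for i] by (intro prod_mono) (auto simp: add_ac)
    also have "\<dots> = norm (pochhammer (Complex (c n) t + of_nat 2) (k - 1))"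
      by (simp add: pochhammer_prod prod_norm lessThan_atLeast0)
    finally show ?thesis .
  qed
  have bound: "norm (Riesz_kernel k y (Complex (c n) t))
      \<le> 1 / (norm (Complex (c n) t) * norm (Complex (c n) t + of_nat 1))" for n t
  proof -
    let ?A = "norm (Complex (c n) t) * norm (Complex (c n) t + of_nat 1)"
      and ?D = "norm (pochhammer (Complex (c n) t + of_nat 2) (k - 1))"
    have "1 * 1 \<le> ?A" using ge1[of 0 n t] ge1[of 1 n t] k by (intro mult_mono) auto
    then have A: "0 < ?A" by linarith
    have "?A * 1 \<le> ?A * ?D" using A prod1[of n t] by (intro mult_left_mono) auto
    then have AD: "?A \<le> ?A * ?D" by simp
    have "norm (of_real y powr Complex (c n) t) = y powr c n"
      using y by (simp add: norm_powr_real_powr)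
    then have "norm (Riesz_kernel k y (Complex (c n) t))
        = y powr c n / (?A * ?D)"
      unfolding poch norm_divide norm_mult by (simp only:)
    also have "\<dots> \<le> 1 / ?A"
      using A AD yc[of n] by (intro frac_le) auto
    finally show ?thesis .
  qed
  have "(\<lambda>n. LINT t|lborel. Riesz_kernel k y (Complex (c n) t))
      \<longlonglongrightarrow> (LINT t::real|lborel. (0::complex))"
  proof (rule integral_dominated_convergence[OF _ _ integrable_inverse_1_plus_square_lborel])
    fix n
    have "c n \<noteq> - real j" if "j \<le> k" for j using far[OF that, of n] by auto
    then have "integrable lborel (\<lambda>t. Riesz_kernel k y (Complex (c n) t))"
      using k y by (intro integrable_inverse_pochhammer) auto
    then show "(\<lambda>t. Riesz_kernel k y (Complex (c n) t)) \<in> borel_measurable lborel"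
      by auto
    show "AE t in lborel. norm (Riesz_kernel k y (Complex (c n) t)) \<le> 1 / (1 + t\<^sup>2)"
    proof (rule AE_I2)
      fix t :: real
      have "sqrt (1 + t\<^sup>2) * sqrt (1 + t\<^sup>2) \<le> norm (Complex (c n) t) * norm (Complex (c n) t + of_nat 1)"
        using ge[of 0 t n] ge[of 1 t n] k by (intro mult_mono) auto
      then have "1 + t\<^sup>2 \<le> norm (Complex (c n) t) * norm (Complex (c n) t + of_nat 1)"
        by (simp add: real_sqrt_mult_self)
      then have "1 / (norm (Complex (c n) t) * norm (Complex (c n) t + of_nat 1)) \<le> 1 / (1 + t\<^sup>2)"
        by (intro frac_le) (auto intro: add_pos_nonneg)
      with bound[of n t]
      show "norm (Riesz_kernel k y (Complex (c n) t)) \<le> 1 / (1 + t\<^sup>2)"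
        by linarith
    qed
  next
    show "AE t in lborel. (\<lambda>n. Riesz_kernel k y (Complex (c n) t)) \<longlonglongrightarrow> 0"
    proof (rule AE_I2, rule tendsto_norm_zero_cancel)
      fix t :: real
      show "(\<lambda>n. norm (Riesz_kernel k y (Complex (c n) t))) \<longlonglongrightarrow> 0"
      proof (rule tendsto_sandwich[of "\<lambda>_. 0" _ _ "\<lambda>n. inverse \<bar>c n\<bar>"])
        show "\<forall>\<^sub>F n in sequentially. norm (Riesz_kernel k y (Complex (c n) t))
            \<le> inverse \<bar>c n\<bar>"
        proof (rule always_eventually, rule allI)
          fix n
          have "\<bar>c n\<bar> * 1 \<le> norm (Complex (c n) t) * norm (Complex (c n) t + of_nat 1)"
            using abs_Re_le_cmod[of "Complex (c n) t"] ge1[of 1 n t] k by (intro mult_mono) auto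
          moreover have "\<bar>c n\<bar> > 0" using far[of 0 n] by auto
          ultimately have "1 / (norm (Complex (c n) t) * norm (Complex (c n) t + of_nat 1)) \<le> 1 / (\<bar>c n\<bar> * 1)"
            by (intro frac_le) auto
          with bound[of n t]
          show "norm (Riesz_kernel k y (Complex (c n) t)) \<le> inverse \<bar>c n\<bar>"
            by (simp add: divide_inverse)
        qed
        show "(\<lambda>n. inverse \<bar>c n\<bar>) \<longlonglongrightarrow> 0"
          by (rule filterlim_compose[OF tendsto_inverse_0_at_top[OF filterlim_ident] c])
      qed (rule always_eventually, rule allI, rule norm_ge_zero, rule tendsto_const)
    qed
  qed auto
  then show ?thesis by simp
qed

text \<open>The two cases differ in the direction in which the line is moved: to the right for
  \<open>y \<le> 1\<close>, where nothing is met, and to the left past all poles for \<open>y \<ge> 1\<close>.\<close>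

theorem Perron_Riesz_kernel:
  assumes k: "k \<ge> 1" and y: "y > 0" and c: "c > 0"
  shows "(LINT t|lborel. Riesz_kernel k y (Complex c t))
      = 2 * of_real pi * of_real (if y \<ge> 1 then (1 - 1 / y) ^ k / fact k else 0)"
proof -
  define I where "I c = (LINT t|lborel. Riesz_kernel k y (Complex c t))" for c
  show ?thesis
  proof (cases "y \<ge> 1")
    case True
    \<comment> \<open>To the left of all poles and at distance at least 1 from each, so the sum runs
      over every \<open>j \<le> k\<close>.\<close>
    define b where "b n = - (real k + 1 + real n)" for n
    have "I c - I (b n) = 2 * of_real pi * of_real ((1 - 1 / y) ^ k / fact k)" for n
    proof -
      have "I c - I (b n) = 2 * of_real pi * (\<Sum>j | j \<le> k \<and> b n < - real j \<and> - real j < c.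
          of_real y powr (- of_nat j) * (-1) ^ j / (fact j * fact (k - j)))"
        unfolding I_def using c by (intro Perron_shift k y) (auto simp: b_def)
      also have "{j. j \<le> k \<and> b n < - real j \<and> - real j < c} = {..k}"
        using c by (auto simp: b_def)
      \<comment> \<open>The residues are the terms of the binomial expansion of
        \<open>(1 - 1 / y) ^ k\<close>, divided by \<open>fact k\<close>.\<close>
      also have "(\<Sum>j\<le>k. of_real y powr (- of_nat j) * (-1) ^ j / (fact j * fact (k - j)) :: complex)
          = (\<Sum>j\<le>k. of_nat (k choose j) * (- (1 / of_real y)) ^ j * 1 ^ (k - j)) / fact k"
        unfolding sum_divide_distrib
      proof (intro sum.cong refl)
        fix j assume j: "j \<in> {..k}"
        define P Q :: complex where "P = (1 / of_real y) ^ j" and "Q = (-1) ^ j"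
        have 1: "complex_of_real y powr (- of_nat j) = P"
          using y by (simp add: P_def powr_minus powr_nat power_one_over inverse_eq_divide)
        have 2: "of_nat (k choose j) = fact k / (fact j * fact (k - j) :: complex)"
          using j by (intro binomial_fact) auto
        have 3: "(- (1 / complex_of_real y)) ^ j = P * Q"
          unfolding P_def Q_def by (subst power_mult_distrib[symmetric]) simp
        show "of_real y powr (- of_nat j) * (-1) ^ j / (fact j * fact (k - j))
            = of_nat (k choose j) * (- (1 / complex_of_real y)) ^ j * 1 ^ (k - j) / fact k"
          unfolding 1 2 3 Q_def[symmetric] by simp
      qed
      also have "(\<Sum>j\<le>k. of_nat (k choose j) * (- (1 / complex_of_real y)) ^ j * 1 ^ (k - j))
          = (- (1 / of_real y) + 1) ^ k"
        by (rule binomial_ring[symmetric])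
      finally show ?thesis by simp
    qed
    then have "I (b n) = I c - 2 * of_real pi * of_real ((1 - 1 / y) ^ k / fact k)" for n
      by (metis diff_diff_eq2 diff_add_cancel add_diff_cancel_left')
    moreover have "(\<lambda>n. I (b n)) \<longlonglongrightarrow> 0"
      unfolding I_def
    proof (rule Perron_limit[OF k y])
      show "y powr b n \<le> 1" for n
        using True powr_mono[of "b n" 0 y] by (simp add: b_def)
      show "filterlim (\<lambda>n. \<bar>b n\<bar>) at_top sequentially"
        unfolding b_def by real_asymp
    qed (auto simp: b_def)
    ultimately have "I c - 2 * of_real pi * of_real ((1 - 1 / y) ^ k / fact k) = 0"
      by (simp add: LIMSEQ_const_iff)
    with True show ?thesis by (simp add: I_def)
  next
    case False
    define b where "b n = c + 1 + real n" for n
    have "I (b n) - I c = 2 * of_real pi * (\<Sum>j | j \<le> k \<and> c < - real j \<and> - real j < b n.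
          of_real y powr (- of_nat j) * (-1) ^ j / (fact j * fact (k - j)))" for n
      unfolding I_def using c by (intro Perron_shift k y) (auto simp: b_def)
    moreover have "{j. j \<le> k \<and> c < - real j \<and> - real j < b n} = {}" for n using c by auto
    ultimately have "I (b n) = I c" for n by simp
    moreover have "(\<lambda>n. I (b n)) \<longlonglongrightarrow> 0"
      unfolding I_def
    proof (rule Perron_limit[OF k y])
      show "y powr b n \<le> 1" for n
        using False y c by (intro powr_le1) (auto simp: b_def)
      show "filterlim (\<lambda>n. \<bar>b n\<bar>) at_top sequentially"
        unfolding b_def by real_asymp
    qed (use c in \<open>auto simp: b_def\<close>)
    ultimately have "I c = 0" by (simp add: LIMSEQ_const_iff)
    with False show ?thesis by (simp add: I_def)
  qed
qed

section \<open>General Dirichlet series\<close>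

lemma
  fixes a w :: "nat \<Rightarrow> complex"
  assumes a: "summable (\<lambda>n. norm (a n))" and w: "\<And>n. norm (w n) \<le> K"
  shows summable_norm_mult_bounded: "summable (\<lambda>n. norm (a n * w n))"
    and norm_suminf_mult_bounded: "norm (\<Sum>n. a n * w n) \<le> (\<Sum>n. norm (a n) * K)"
proof -
  have le: "norm (a n * w n) \<le> norm (a n) * K" for n
    unfolding norm_mult by (rule mult_left_mono[OF w norm_ge_zero])
  show sm: "summable (\<lambda>n. norm (a n * w n))"
    by (rule summable_comparison_test'[OF summable_mult2[OF a, of K]]) (use le in simp)
  have "norm (\<Sum>n. a n * w n) \<le> (\<Sum>n. norm (a n * w n))" by (rule summable_norm[OF sm])
  also have "\<dots> \<le> (\<Sum>n. norm (a n) * K)" by (rule suminf_le[OF le sm summable_mult2[OF a]])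
  finally show "norm (\<Sum>n. a n * w n) \<le> (\<Sum>n. norm (a n) * K)" .
qed

lemma abs_summable_on_times:
  fixes a b :: "nat \<Rightarrow> complex"
  assumes "(\<lambda>x. norm (a x)) summable_on A" "(\<lambda>x. norm (b x)) summable_on B"
  shows "(\<lambda>x. norm (case x of (m, n) \<Rightarrow> a m * b n)) summable_on A \<times> B"
  unfolding Infinite_Sum.abs_summable_on_Sigma_iff
proof (intro conjI ballI)
  show "(\<lambda>y. norm (case (x, y) of (m, n) \<Rightarrow> a m * b n)) summable_on B" for x
    using assms(2) by (auto simp: norm_mult intro: summable_on_cmult_right)
  have "(\<lambda>x. norm (a x) * infsum (\<lambda>y. norm (b y)) B) summable_on A"
    using assms(1) by (rule summable_on_cmult_left)
  then show "(\<lambda>x. norm (\<Sum>\<^sub>\<infinity>y\<in>B. norm (case (x, y) of (m, n) \<Rightarrow> a m * b n))) summable_on A"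
    using assms(2) by (simp add: norm_mult infsum_cmult_right infsum_nonneg abs_mult)
qed

lemma norm_summable_has_sum_suminf:
  fixes f :: "nat \<Rightarrow> complex"
  assumes "summable (\<lambda>n. norm (f n))"
  shows "(f has_sum (\<Sum>n. f n)) UNIV"
  by (rule norm_summable_imp_has_sum[OF assms summable_sums[OF summable_norm_cancel[OF assms]]])

lemma suminf_Suc_has_sum:
  fixes a :: "nat \<Rightarrow> complex"
  assumes "summable (\<lambda>n. norm (a (Suc n)))"
  shows "(\<lambda>x. norm (a x)) summable_on {1..}" and "(a has_sum (\<Sum>n. a (Suc n))) {1..}"
proof -
  have bij: "bij_betw Suc UNIV {1..}"
    by (rule bij_betwI[of _ _ _ "\<lambda>n. n - 1"]) auto
  have "(\<lambda>n. norm (a (Suc n))) summable_on UNIV"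
    using assms by (intro norm_summable_imp_summable_on) simp
  then show "(\<lambda>x. norm (a x)) summable_on {1..}"
    using summable_on_reindex_bij_betw[OF bij, of "\<lambda>n. norm (a n)"] by simp
  have "((\<lambda>n. a (Suc n)) has_sum (\<Sum>n. a (Suc n))) UNIV"
    by (rule norm_summable_has_sum_suminf[OF assms])
  then show "(a has_sum (\<Sum>n. a (Suc n))) {1..}"
    by (rule has_sum_reindex_bij_betw[OF bij, of a, THEN iffD1])
qed

text \<open>The absolutely convergent double series over \<open>(d, e)\<close> is regrouped
  according to \<open>n = d * e\<close>; the pairs \<open>(n, d)\<close> with \<open>d dvd n\<close>
  correspond to the pairs \<open>(d, n div d)\<close>.\<close>

lemma Dirichlet_convolution_sums:
  fixes a b :: "nat \<Rightarrow> complex"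
  assumes a: "summable (\<lambda>n. norm (a (Suc n)))" and b: "summable (\<lambda>n. norm (b (Suc n)))"
  defines "c \<equiv> \<lambda>n. \<Sum>d | d dvd n. a d * b (n div d)"
  shows "summable (\<lambda>n. norm (c (Suc n)))"
    and "(\<Sum>n. c (Suc n)) = (\<Sum>n. a (Suc n)) * (\<Sum>n. b (Suc n))"
proof -
  let ?X = "{1::nat..}"
  let ?F = "\<lambda>(m, n). a m * b n"
  let ?h = "\<lambda>(n, d). (d, n div d)"
  have bij: "bij_betw ?h (Sigma ?X (\<lambda>n. {d. d dvd n})) (?X \<times> ?X)"
  proof (rule bij_betwI[of _ _ _ "\<lambda>(d, e). (d * e, d)"])
    show "?h \<in> Sigma ?X (\<lambda>n. {d. d dvd n}) \<rightarrow> ?X \<times> ?X"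
      by (auto simp: Suc_le_eq div_greater_zero_iff dvd_imp_le intro: dvd_pos_nat)
  qed (auto simp: Suc_le_eq)
  note aX = suminf_Suc_has_sum[OF a] and bX = suminf_Suc_has_sum[OF b]
  have abs: "(\<lambda>x. norm (?F x)) summable_on ?X \<times> ?X"
    by (rule abs_summable_on_times[OF aX(1) bX(1)])
  have FS: "(?F has_sum (\<Sum>n. a (Suc n)) * (\<Sum>n. b (Suc n))) (?X \<times> ?X)"
  proof (rule has_sum_SigmaI)
    show "((\<lambda>n. ?F (m, n)) has_sum a m * (\<Sum>n. b (Suc n))) ?X" for m
      using has_sum_cmult_right[OF bX(2)] by simp
    show "((\<lambda>m. a m * (\<Sum>n. b (Suc n))) has_sum (\<Sum>n. a (Suc n)) * (\<Sum>n. b (Suc n))) ?X"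
      by (rule has_sum_cmult_left[OF aX(2)])
    show "?F summable_on ?X \<times> ?X" by (rule abs_summable_summable[OF abs])
  qed
  have fin: "finite {d. d dvd n}" if "n \<in> ?X" for n using that by auto
  have abs': "(\<lambda>x. norm (?F (?h x))) summable_on Sigma ?X (\<lambda>n. {d. d dvd n})"
    by (rule summable_on_reindex_bij_betw[OF bij, of "\<lambda>x. norm (?F x)", THEN iffD2, OF abs])
  have FS': "((\<lambda>x. ?F (?h x)) has_sum (\<Sum>n. a (Suc n)) * (\<Sum>n. b (Suc n))) (Sigma ?X (\<lambda>n. {d. d dvd n}))"
    by (rule has_sum_reindex_bij_betw[OF bij, of ?F, THEN iffD2, OF FS])
  have cS: "(c has_sum (\<Sum>n. a (Suc n)) * (\<Sum>n. b (Suc n))) ?X"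
    by (rule has_sum_SigmaD[OF FS']) (auto simp: c_def intro!: has_sum_finiteI)
  have "(\<lambda>n. \<Sum>\<^sub>\<infinity>d\<in>{d. d dvd n}. norm (a d * b (n div d))) summable_on ?X"
    by (rule summable_on_Sigma_banach) (use abs' in \<open>simp add: case_prod_unfold\<close>)
  then have "(\<lambda>n. norm (c n)) summable_on ?X"
  proof (rule summable_on_comparison_test)
    fix n assume n: "n \<in> ?X"
    have "norm (c n) \<le> (\<Sum>d | d dvd n. norm (a d * b (n div d)))"
      unfolding c_def by (rule norm_sum)
    also have "\<dots> = (\<Sum>\<^sub>\<infinity>d\<in>{d. d dvd n}. norm (a d * b (n div d)))"
      using fin[OF n] by simp
    finally show "norm (c n) \<le> (\<Sum>\<^sub>\<infinity>d\<in>{d. d dvd n}. norm (a d * b (n div d)))" .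
  qed auto
  moreover have bij': "bij_betw Suc UNIV ?X"
    by (rule bij_betwI[of _ _ _ "\<lambda>n. n - 1"]) auto
  ultimately have "(\<lambda>n. norm (c (Suc n))) summable_on UNIV"
    using summable_on_reindex_bij_betw[OF bij', of "\<lambda>n. norm (c n)"] by simp
  then show sc: "summable (\<lambda>n. norm (c (Suc n)))"
    by (rule summable_on_imp_summable)
  have "(c has_sum (\<Sum>n. c (Suc n))) ?X" by (rule suminf_Suc_has_sum[OF sc])
  with cS show "(\<Sum>n. c (Suc n)) = (\<Sum>n. a (Suc n)) * (\<Sum>n. b (Suc n))"
    using has_sum_unique by blast
qed

text \<open>The enumeration by \<open>prod_decode\<close> turns the double series into a simple one,
  to which termwise limits and derivatives apply. The bounded weight \<open>q\<close> will be a
  truncated power or the jump function of the pair.\<close>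

lemma double_series:
  fixes a b :: "nat \<Rightarrow> complex" and q :: "nat \<Rightarrow> nat \<Rightarrow> complex"
  assumes a: "summable (\<lambda>n. norm (a n))" and b: "summable (\<lambda>n. norm (b n))"
    and q: "\<And>m n. norm (q m n) \<le> K"
  defines "t \<equiv> \<lambda>(m, n). a m * b n * q m n"
  shows "summable (\<lambda>i. norm (t (prod_decode i)))"
    and "(\<Sum>i. t (prod_decode i)) = (\<Sum>n. b n * (\<Sum>m. a m * q m n))"
    and "(\<Sum>i. t (prod_decode i)) = (\<Sum>m. a m * (\<Sum>n. b n * q m n))"
proof -
  have aX: "(\<lambda>x. norm (a x)) summable_on UNIV" and bX: "(\<lambda>x. norm (b x)) summable_on UNIV"
    using a b by (auto intro!: norm_summable_imp_summable_on)
  have "(\<lambda>x. norm (case x of (m, n) \<Rightarrow> a m * b n)) summable_on UNIV \<times> UNIV"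
    by (rule abs_summable_on_times[OF aX bX])
  then have "(\<lambda>x. norm (case x of (m, n) \<Rightarrow> a m * b n) * K) summable_on UNIV"
    by (simp add: summable_on_cmult_left)
  then have abs: "(\<lambda>x. norm (t x)) summable_on UNIV"
    by (rule summable_on_comparison_test)
       (auto simp: t_def norm_mult intro!: mult_left_mono q)
  have "(\<lambda>i. norm (t (prod_decode i))) summable_on UNIV"
    by (rule summable_on_reindex_bij_betw[OF bij_prod_decode, of "\<lambda>x. norm (t x)", THEN iffD2, OF abs])
  then show s: "summable (\<lambda>i. norm (t (prod_decode i)))"
    by (rule summable_on_imp_summable)
  have "((\<lambda>i. t (prod_decode i)) has_sum (\<Sum>i. t (prod_decode i))) UNIV"
    by (rule norm_summable_has_sum_suminf[OF s])
  then have tS: "(t has_sum (\<Sum>i. t (prod_decode i))) (UNIV \<times> UNIV)"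
    using has_sum_reindex_bij_betw[OF bij_prod_decode, of t, THEN iffD1] by simp
  have s1: "summable (\<lambda>m. norm (a m * q m n))" for n
    by (rule summable_norm_mult_bounded[OF a q])
  have s2: "summable (\<lambda>n. norm (b n * q m n))" for m
    by (rule summable_norm_mult_bounded[OF b q])
  have "((\<lambda>m. a m * (\<Sum>n. b n * q m n)) has_sum (\<Sum>i. t (prod_decode i))) UNIV"
  proof (rule has_sum_SigmaD[OF tS])
    fix m
    have "((\<lambda>n. b n * q m n) has_sum (\<Sum>n. b n * q m n)) UNIV"
      by (rule norm_summable_has_sum_suminf[OF s2])
    from has_sum_cmult_right[OF this, of "a m"]
    show "((\<lambda>n. t (m, n)) has_sum a m * (\<Sum>n. b n * q m n)) UNIV"
      by (simp add: t_def mult_ac)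
  qed
  then show "(\<Sum>i. t (prod_decode i)) = (\<Sum>m. a m * (\<Sum>n. b n * q m n))"
    by (intro sums_unique has_sum_imp_sums)
  have tS': "((\<lambda>(n, m). t (m, n)) has_sum (\<Sum>i. t (prod_decode i))) (UNIV \<times> UNIV)"
    by (rule has_sum_swap[THEN iffD1, OF tS])
  have "((\<lambda>n. b n * (\<Sum>m. a m * q m n)) has_sum (\<Sum>i. t (prod_decode i))) UNIV"
  proof (rule has_sum_SigmaD[OF tS'])
    fix n
    have "((\<lambda>m. a m * q m n) has_sum (\<Sum>m. a m * q m n)) UNIV"
      by (rule norm_summable_has_sum_suminf[OF s1])
    from has_sum_cmult_right[OF this, of "b n"]
    show "((\<lambda>m. case (n, m) of (n, m) \<Rightarrow> t (m, n)) has_sum b n * (\<Sum>m. a m * q m n)) UNIV"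
      by (simp add: t_def mult_ac)
  qed
  then show "(\<Sum>i. t (prod_decode i)) = (\<Sum>n. b n * (\<Sum>m. a m * q m n))"
    by (intro sums_unique has_sum_imp_sums)
qed

text \<open>The abscissa is only an infimum. Summability at one real point is what the estimates
  use, and it also makes sense for twisted convolutions, whose abscissa is never computed.\<close>

definition abs_conv_at :: "(nat \<Rightarrow> complex) \<Rightarrow> (nat \<Rightarrow> real) \<Rightarrow> real \<Rightarrow> bool" where
  "abs_conv_at f l \<sigma> \<longleftrightarrow> summable (\<lambda>n. norm (f (Suc n)) * l (Suc n) powr (- \<sigma>))"

text \<open>The relation \<open>1 * 1 = 1\<close> forces \<open>l 1 = 1\<close>, hence all
  frequencies are at least 1. Therefore \<open>l n powr (- \<sigma>)\<close> decreases in \<sigma>,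
  on which all comparisons of absolute convergence rest.\<close>

lemma mult_freq:
  assumes "multiplicative_frequencies l"
  shows mult_freq_1: "l (Suc 0) = 1"
    and mult_freq_ge1: "\<And>n. n \<ge> 1 \<Longrightarrow> 1 \<le> l n"
    and mult_freq_pos: "\<And>n. n \<ge> 1 \<Longrightarrow> 0 < l n"
    and mult_freq_mult: "\<And>m n. m \<ge> 1 \<Longrightarrow> n \<ge> 1 \<Longrightarrow> l (m * n) = l m * l n"
    and mult_freq_less: "\<And>m n. 1 \<le> m \<Longrightarrow> m < n \<Longrightarrow> l m < l n"
    and mult_freq_finite: "\<And>y. finite {m. 1 \<le> m \<and> l m \<le> y}"
proof -
  note d = assms[unfolded multiplicative_frequencies_def]
  show less: "\<And>m n. 1 \<le> m \<Longrightarrow> m < n \<Longrightarrow> l m < l n" using d by blast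
  have pos1: "0 < l 1" using d by blast
  have "l 1 * l 1 = l 1" using d by (metis le_refl mult_1)
  with pos1 show one: "l (Suc 0) = 1" by simp
  show ge: "1 \<le> l n" if "n \<ge> 1" for n
    using that one less[of 1 n] by (cases "n = 1") auto
  then show "\<And>n. n \<ge> 1 \<Longrightarrow> 0 < l n" by fastforce
  show "\<And>m n. m \<ge> 1 \<Longrightarrow> n \<ge> 1 \<Longrightarrow> l (m * n) = l m * l n"
    using d by (metis One_nat_def Suc_le_eq nat_0_less_mult_iff)
  fix y
  have "filterlim l at_top sequentially" using d by blast
  then have "eventually (\<lambda>m. y < l m) sequentially" by (simp add: filterlim_at_top_dense)
  then obtain N where N: "\<And>m. m \<ge> N \<Longrightarrow> y < l m" by (auto simp: eventually_sequentially)
  have "{m. 1 \<le> m \<and> l m \<le> y} \<subseteq> {..<N}"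
  proof safe
    fix m assume "l m \<le> y"
    with N[of m] show "m < N" by (cases "m < N") auto
  qed
  then show "finite {m. 1 \<le> m \<and> l m \<le> y}" by (rule finite_subset) simp
qed

lemma abs_conv_at_mono:
  assumes l: "multiplicative_frequencies l" and "abs_conv_at f l \<sigma>" "\<sigma> \<le> \<tau>"
  shows "abs_conv_at f l \<tau>"
  unfolding abs_conv_at_def
proof (rule summable_comparison_test')
  show "summable (\<lambda>n. norm (f (Suc n)) * l (Suc n) powr (- \<sigma>))"
    using assms by (simp add: abs_conv_at_def)
  fix n
  have "l (Suc n) powr - \<tau> \<le> l (Suc n) powr - \<sigma>"
    using assms mult_freq_ge1[OF l, of "Suc n"] by (intro powr_mono) auto
  then show "norm (norm (f (Suc n)) * l (Suc n) powr - \<tau>) \<le> norm (f (Suc n)) * l (Suc n) powr - \<sigma>"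
    by (simp add: abs_mult mult_left_mono)
qed

lemma meromorphic_dirichlet_abs_conv_at:
  assumes l: "multiplicative_frequencies l" and \<phi>: "meromorphic_dirichlet \<phi> f l \<sigma>a" and "\<sigma> > \<sigma>a"
  shows "abs_conv_at f l \<sigma>"
proof -
  have "Inf {ereal \<tau> |\<tau>. summable (\<lambda>n. norm (f (Suc n)) * l (Suc n) powr (- \<tau>))} < ereal \<sigma>"
    using \<phi> \<open>\<sigma> > \<sigma>a\<close> by (simp add: meromorphic_dirichlet_def abs_conv_abscissa_def)
  then obtain \<tau> where "abs_conv_at f l \<tau>" "\<tau> < \<sigma>"
    by (auto simp: Inf_less_iff abs_conv_at_def)
  then show ?thesis using abs_conv_at_mono[OF l] by auto
qed

lemma norm_dirichlet_term:
  assumes l: "multiplicative_frequencies l"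
  shows "norm (f (Suc n) * of_real (l (Suc n)) powr (- s)) = norm (f (Suc n)) * l (Suc n) powr (- Re s)"
  using mult_freq_pos[OF l, of "Suc n"] by (simp add: norm_mult norm_powr_real_powr)

lemma abs_conv_at_summable:
  assumes l: "multiplicative_frequencies l" and "abs_conv_at f l \<sigma>" "\<sigma> \<le> Re s"
  shows "summable (\<lambda>n. norm (f (Suc n) * of_real (l (Suc n)) powr (- s)))"
  unfolding norm_dirichlet_term[OF l] using abs_conv_at_mono[OF assms] by (simp add: abs_conv_at_def)

lemma norm_dirichlet_series_le:
  assumes l: "multiplicative_frequencies l" and f: "abs_conv_at f l \<sigma>" and "\<sigma> \<le> Re s"
  shows "norm (dirichlet_series f l s) \<le> (\<Sum>n. norm (f (Suc n)) * l (Suc n) powr (- \<sigma>))"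
proof -
  have "norm (dirichlet_series f l s) \<le> (\<Sum>n. norm (f (Suc n) * of_real (l (Suc n)) powr (- s)))"
    unfolding dirichlet_series_def by (rule summable_norm[OF abs_conv_at_summable[OF assms]])
  also have "\<dots> \<le> (\<Sum>n. norm (f (Suc n)) * l (Suc n) powr (- \<sigma>))"
  proof (rule suminf_le)
    fix n
    have "l (Suc n) powr - Re s \<le> l (Suc n) powr - \<sigma>"
      using assms mult_freq_ge1[OF l, of "Suc n"] by (intro powr_mono) auto
    then show "norm (f (Suc n) * of_real (l (Suc n)) powr (- s)) \<le> norm (f (Suc n)) * l (Suc n) powr (- \<sigma>)"
      unfolding norm_dirichlet_term[OF l] by (simp add: mult_left_mono)
  qed (use f abs_conv_at_summable[OF assms] in \<open>auto simp: abs_conv_at_def\<close>)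
  finally show ?thesis .
qed

text \<open>On a path of constant real part the moduli of the terms do not depend on
  \<open>t\<close>, so absolute convergence at one point justifies the interchange. A general path
  \<open>s\<close> also covers the reflected argument \<open>v + u - z\<close> and a rescaled
  parameter.\<close>

lemma dirichlet_series_integral:
  assumes l: "multiplicative_frequencies l" and f: "abs_conv_at f l \<sigma>"
    and h: "integrable lborel h" and s: "continuous_on UNIV s" and Re: "\<And>t. Re (s t) = \<sigma>"
  shows "integrable lborel (\<lambda>t. h t * dirichlet_series f l (s t))"
    and "(\<lambda>n. f (Suc n) * (LINT t|lborel. h t * of_real (l (Suc n)) powr (- s t)))
        sums (LINT t|lborel. h t * dirichlet_series f l (s t))"
proof -
  define F where "F n t = h t * (f (Suc n) * of_real (l (Suc n)) powr (- s t))" for n t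
  have pos: "l (Suc n) > 0" for n using mult_freq_pos[OF l] by simp
  have [measurable]: "h \<in> borel_measurable borel" using h by auto
  have cont: "continuous_on UNIV (\<lambda>t. f (Suc n) * of_real (l (Suc n)) powr (- s t))" for n
    using pos[of n] s by (intro continuous_intros) auto
  note [measurable] = borel_measurable_continuous_onI[OF cont]
  have nF: "norm (F n t) = norm (h t) * (norm (f (Suc n)) * l (Suc n) powr (- \<sigma>))" for n t
    unfolding F_def norm_mult[of "h t"] norm_dirichlet_term[OF l] Re ..
  have intF: "integrable lborel (F n)" for n
  proof (rule Bochner_Integration.integrable_bound)
    show "integrable lborel (\<lambda>t. norm (h t) * (norm (f (Suc n)) * l (Suc n) powr (- \<sigma>)))"
      using h by auto
    show "F n \<in> borel_measurable lborel" unfolding F_def by measurable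
  qed (auto simp: nF)
  have sm: "AE t in lborel. summable (\<lambda>n. norm (F n t))"
    unfolding nF using f by (intro AE_I2 summable_mult) (simp add: abs_conv_at_def)
  have si: "summable (\<lambda>n. LINT t|lborel. norm (F n t))"
    unfolding nF using f by (auto simp: abs_conv_at_def intro!: summable_mult)
  have eq: "(\<Sum>n. F n t) = h t * dirichlet_series f l (s t)" for t
    unfolding F_def dirichlet_series_def
    using abs_conv_at_summable[OF l f, of "s t"] by (intro suminf_mult) (simp add: Re summable_norm_cancel)
  show "integrable lborel (\<lambda>t. h t * dirichlet_series f l (s t))"
    using integrable_suminf[OF intF sm si] by (simp add: eq)
  have "(LINT t|lborel. F n t) = f (Suc n) * (LINT t|lborel. h t * of_real (l (Suc n)) powr (- s t))" for n
    unfolding F_def by (subst integral_mult_right_zero[symmetric]) (simp add: mult_ac)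
  then show "(\<lambda>n. f (Suc n) * (LINT t|lborel. h t * of_real (l (Suc n)) powr (- s t)))
        sums (LINT t|lborel. h t * dirichlet_series f l (s t))"
    using sums_integral[OF intF sm si] by (simp add: eq)
qed

text \<open>For \<open>n = d * e\<close> multiplicativity of the frequencies splits
  \<open>l n powr (- s)\<close>, and the twist \<open>l d powr a\<close> joins the factor belonging
  to \<open>d\<close>. So the term is a product of a term at \<open>s - a\<close> and a term at
  \<open>s\<close>.\<close>

lemma dirichlet_series_mult:
  assumes l: "multiplicative_frequencies l" and g: "abs_conv_at g l (Re s)" "abs_conv_at g l (Re (s - a))"
  shows "abs_conv_at (twisted_convolution g l a) l (Re s)"
    and "dirichlet_series (twisted_convolution g l a) l s = dirichlet_series g l (s - a) * dirichlet_series g l s"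
proof -
  define A where "A n = g n * of_real (l n) powr (- (s - a))" for n
  define B where "B n = g n * of_real (l n) powr (- s)" for n
  have A: "summable (\<lambda>n. norm (A (Suc n)))" unfolding A_def by (rule abs_conv_at_summable[OF l g(2)]) simp
  have B: "summable (\<lambda>n. norm (B (Suc n)))" unfolding B_def by (rule abs_conv_at_summable[OF l g(1)]) simp
  have eq: "(\<Sum>d | d dvd n. A d * B (n div d)) = twisted_convolution g l a n * of_real (l n) powr (- s)"
    if n: "n \<ge> 1" for n
    unfolding twisted_convolution_def sum_distrib_right
  proof (rule sum.cong[OF refl])
    fix d assume "d \<in> {d. d dvd n}"
    then obtain e where e: "n = d * e" by auto
    with n have de: "d \<ge> 1" "e \<ge> 1" by (auto simp: Suc_le_eq)
    have pos: "l d > 0" "l e > 0" using de mult_freq_pos[OF l] by auto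
    have "of_real (l n) powr (- s) = of_real (l d) powr (- s) * of_real (l e) powr (- s)"
      unfolding e mult_freq_mult[OF l de] of_real_mult using pos by (intro powr_times_real) auto
    moreover have "of_real (l d) powr (- (s - a)) = of_real (l d) powr (- s) * of_real (l d) powr a"
      by (simp add: powr_add[symmetric] add.commute)
    ultimately show "A d * B (n div d) = of_real (l d) powr a * g d * g (n div d) * of_real (l n) powr (- s)"
      using de by (simp add: A_def B_def e)
  qed
  note conv = Dirichlet_convolution_sums[OF A B]
  show "abs_conv_at (twisted_convolution g l a) l (Re s)"
    using conv(1) unfolding abs_conv_at_def by (simp add: eq norm_dirichlet_term[OF l])
  show "dirichlet_series (twisted_convolution g l a) l s = dirichlet_series g l (s - a) * dirichlet_series g l s"
    using conv(2) unfolding dirichlet_series_def by (simp add: eq) (simp add: A_def B_def)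
qed

section \<open>Double Riesz means\<close>

lemma translated_Perron_integral:
  fixes u :: complex
  shows "integrable lborel (\<lambda>t. Riesz_kernel k r (Complex c t - u))
      \<longleftrightarrow> integrable lborel (\<lambda>t. Riesz_kernel k r (Complex (c - Re u) t))"
    and "(LINT t|lborel. Riesz_kernel k r (Complex c t - u))
      = (LINT t|lborel. Riesz_kernel k r (Complex (c - Re u) t))"
proof -
  let ?F = "\<lambda>t. Riesz_kernel k r (Complex (c - Re u) t)"
  have eq: "Complex c t - u = Complex (c - Re u) (- Im u + 1 * t)" for t
    by (simp add: complex_eq_iff)
  show "integrable lborel (\<lambda>t. Riesz_kernel k r (Complex c t - u))
      \<longleftrightarrow> integrable lborel ?F"
    unfolding eq by (rule lborel_integrable_real_affine_iff) simp
  show "(LINT t|lborel. Riesz_kernel k r (Complex c t - u))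
      = integral\<^sup>L lborel ?F"
    unfolding eq using lborel_integral_real_affine[of 1 ?F "- Im u"] by simp
qed

lemma riesz_sum_sums:
  assumes l: "multiplicative_frequencies l" and k: "k \<ge> 1"
  shows "(\<lambda>n. if l (Suc n) \<le> y then f (Suc n) / of_real (l (Suc n)) powr u * of_real ((y - l (Suc n)) ^ k) else 0)
      sums riesz_sum k f l u y"
proof -
  let ?N = "{n. l (Suc n) \<le> y}" and ?T = "\<lambda>m. f m / of_real (l m) powr u * of_real ((y - l m) ^ k)"
  have img: "{m. 1 \<le> m \<and> l m \<le> y} = Suc ` ?N"
  proof (intro equalityI subsetI)
    fix m assume "m \<in> {m. 1 \<le> m \<and> l m \<le> y}"
    then show "m \<in> Suc ` ?N" by (cases m) auto
  qed auto
  have "finite (Suc ` ?N)" using mult_freq_finite[OF l, of y] by (simp only: img)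
  then have "finite ?N" by (rule finite_imageD) simp
  then have "(\<lambda>n. if l (Suc n) \<le> y then ?T (Suc n) else 0) sums (\<Sum>n\<in>?N. if l (Suc n) \<le> y then ?T (Suc n) else 0)"
    by (rule sums_finite) auto
  also have "(\<Sum>n\<in>?N. if l (Suc n) \<le> y then ?T (Suc n) else 0) = riesz_sum k f l u y"
    unfolding riesz_sum_def img using k by (subst sum.reindex) (auto intro!: sum.cong)
  finally show ?thesis .
qed

text \<open>Perron's formula at \<open>y / l m\<close> for each term; the factor
  \<open>y ^ k\<close> in \<open>h\<close> turns \<open>(1 - l m / y) ^ k\<close> into
  \<open>(y - l m) ^ k\<close>.\<close>

lemma riesz_sum_eq_integral:
  assumes l: "multiplicative_frequencies l" and f: "abs_conv_at f l c" and c: "c > Re u"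
    and k: "k \<ge> 1" and y: "y > 0"
  defines "h \<equiv> \<lambda>t. of_real y powr (Complex c t - u + of_nat k) / pochhammer (Complex c t - u) (Suc k)"
  shows "integrable lborel (\<lambda>t. h t * dirichlet_series f l (Complex c t))"
    and "(LINT t|lborel. h t * dirichlet_series f l (Complex c t)) = 2 * of_real pi / fact k * riesz_sum k f l u y"
proof -
  define K where "K r t = Riesz_kernel k r (Complex c t - u)"
    for r :: real and t :: real
  have intK: "integrable lborel (K r)" if "r > 0" for r
    unfolding K_def translated_Perron_integral using c k that by (intro integrable_inverse_pochhammer) auto
  have K: "integral\<^sup>L lborel (K r) = 2 * of_real pi * of_real (if r \<ge> 1 then (1 - 1 / r) ^ k / fact k else 0)"
    if "r > 0" for r
    unfolding K_def translated_Perron_integral using Perron_Riesz_kernel[OF k that, of "c - Re u"] c by simp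
  have h_eq: "h = (\<lambda>t. of_real (y ^ k) * K y t)"
    using y by (auto simp: h_def K_def fun_eq_iff powr_add powr_nat)
  have inth: "integrable lborel h"
    unfolding h_eq using intK[OF y] by simp
  have cont: "continuous_on UNIV (\<lambda>t. Complex c t)"
    unfolding Complex_eq by (intro continuous_intros)
  note ex = dirichlet_series_integral[OF l f inth cont]
  show "integrable lborel (\<lambda>t. h t * dirichlet_series f l (Complex c t))"
    by (rule ex(1)) simp
  have "(\<lambda>n. f (Suc n) * (LINT t|lborel. h t * of_real (l (Suc n)) powr (- Complex c t)))
      sums (LINT t|lborel. h t * dirichlet_series f l (Complex c t))"
    by (rule ex(2)) simp
  also have "(\<lambda>n. f (Suc n) * (LINT t|lborel. h t * of_real (l (Suc n)) powr (- Complex c t)))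
      = (\<lambda>n. 2 * of_real pi / fact k *
          (if l (Suc n) \<le> y then f (Suc n) / of_real (l (Suc n)) powr u * of_real ((y - l (Suc n)) ^ k) else 0))"
  proof
    fix n
    define L where "L = l (Suc n)"
    have L: "L > 0" using mult_freq_pos[OF l] by (simp add: L_def)
    have "h t * of_real L powr (- Complex c t) = of_real (y ^ k) / of_real L powr u * K (y / L) t" for t
    proof -
      have "of_real (y / L) powr (Complex c t - u)
          = of_real y powr (Complex c t - u) * (of_real L powr u * of_real L powr (- Complex c t))"
      proof -
        have "of_real (y / L) powr (Complex c t - u) = of_real y powr (Complex c t - u) * of_real (inverse L) powr (Complex c t - u)"
          unfolding divide_inverse of_real_mult using y L by (intro powr_times_real) auto
        also have "of_real (inverse L) powr (Complex c t - u) = of_real L powr (u - Complex c t)"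
        proof -
          have "Ln (complex_of_real (inverse L)) = - Ln (of_real L)"
            using L by (simp add: Ln_of_real ln_inverse del: of_real_inverse)
          then show ?thesis using L by (simp add: powr_def algebra_simps del: of_real_inverse)
        qed
        also have "of_real L powr (u - Complex c t) = of_real L powr u * of_real L powr (- Complex c t)"
          unfolding diff_conv_add_uminus by (rule powr_add)
        finally show ?thesis .
      qed
      then show ?thesis
        unfolding h_eq K_def using L by (simp add: mult_ac)
    qed
    then have "(LINT t|lborel. h t * of_real L powr (- Complex c t))
        = of_real (y ^ k) / of_real L powr u * integral\<^sup>L lborel (K (y / L))"
      by simp
    also have "integral\<^sup>L lborel (K (y / L))
        = 2 * of_real pi * of_real (if y / L \<ge> 1 then (1 - 1 / (y / L)) ^ k / fact k else 0)"
      using y L by (intro K) auto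
    also have "of_real (y ^ k) / of_real L powr u * \<dots>
        = 2 * of_real pi / fact k * (if L \<le> y then 1 / of_real L powr u * of_real ((y - L) ^ k) else 0)"
    proof -
      have "(y - L) ^ k = y ^ k * (1 - L / y) ^ k"
        using y by (simp add: power_mult_distrib[symmetric] algebra_simps)
      then show ?thesis using L by (simp add: le_divide_eq mult_ac)
    qed
    finally show "f (Suc n) * (LINT t|lborel. h t * of_real (l (Suc n)) powr (- Complex c t))
        = 2 * of_real pi / fact k *
          (if l (Suc n) \<le> y then f (Suc n) / of_real (l (Suc n)) powr u * of_real ((y - l (Suc n)) ^ k) else 0)"
      by (simp add: L_def)
  qed
  finally show "(LINT t|lborel. h t * dirichlet_series f l (Complex c t)) = 2 * of_real pi / fact k * riesz_sum k f l u y"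
    using sums_mult[OF riesz_sum_sums[OF l k, of y f u], of "2 * of_real pi / fact k"] sums_unique2 by blast
qed

text \<open>Replacing \<open>x\<close> by \<open>mu n * x\<close> multiplies the power of
  \<open>x\<close> by \<open>mu n powr (z - u + k)\<close>. Divided by
  \<open>mu n powr (v + k)\<close>, this is exactly the term
  \<open>mu n powr (- (v + u - z))\<close> of the second series, which thus sums the inner Riesz
  means.\<close>

lemma double_riesz_sum_eq_integral:
  assumes lam: "multiplicative_frequencies lam" and mu: "multiplicative_frequencies mu"
    and f: "abs_conv_at f lam c" and g: "abs_conv_at g mu (Re u + Re v - c)"
    and c: "c > Re u" and k: "k \<ge> 1" and x: "x > 0"
  defines "J \<equiv> \<lambda>z. dirichlet_series f lam z * dirichlet_series g mu (v + u - z)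
      * of_real x powr (z - u + of_nat k) / pochhammer (z - u) (Suc k)"
  shows "integrable lborel (\<lambda>t. J (Complex c t))"
    and "(LINT t|lborel. J (Complex c t)) = 2 * of_real pi / fact k *
      (\<Sum>n. g (Suc n) / of_real (mu (Suc n)) powr (v + of_nat k) * riesz_sum k f lam u (mu (Suc n) * x))"
proof -
  define h where "h y t = of_real y powr (Complex c t - u + of_nat k) / pochhammer (Complex c t - u) (Suc k)
      * dirichlet_series f lam (Complex c t)" for y :: real and t :: real
  have inth: "integrable lborel (h y)"
    and h: "integral\<^sup>L lborel (h y) = 2 * of_real pi / fact k * riesz_sum k f lam u y" if "y > 0" for y
    unfolding h_def using riesz_sum_eq_integral[OF lam f c k that] by auto
  have cont: "continuous_on UNIV (\<lambda>t. v + u - Complex c t)"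
    unfolding Complex_eq by (intro continuous_intros)
  have J: "J (Complex c t) = h x t * dirichlet_series g mu (v + u - Complex c t)" for t
    by (simp add: J_def h_def)
  note ex = dirichlet_series_integral[OF mu g inth[OF x] cont]
  show "integrable lborel (\<lambda>t. J (Complex c t))"
    unfolding J by (rule ex(1)) simp
  have "(\<lambda>n. g (Suc n) * (LINT t|lborel. h x t * of_real (mu (Suc n)) powr (- (v + u - Complex c t))))
      sums (LINT t|lborel. J (Complex c t))"
    unfolding J by (rule ex(2)) simp
  also have "(\<lambda>n. g (Suc n) * (LINT t|lborel. h x t * of_real (mu (Suc n)) powr (- (v + u - Complex c t))))
    = (\<lambda>n. 2 * of_real pi / fact k *
        (g (Suc n) / of_real (mu (Suc n)) powr (v + of_nat k) * riesz_sum k f lam u (mu (Suc n) * x)))"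
  proof
    fix n
    define L where "L = mu (Suc n)"
    have L: "L > 0" using mult_freq_pos[OF mu] by (simp add: L_def)
    have "h x t * of_real L powr (- (v + u - Complex c t)) = h (L * x) t / of_real L powr (v + of_nat k)" for t
    proof -
      have "of_real (L * x) powr (Complex c t - u + of_nat k)
          = of_real L powr (Complex c t - u + of_nat k) * of_real x powr (Complex c t - u + of_nat k)"
        unfolding of_real_mult using x L by (intro powr_times_real) auto
      moreover have "of_real L powr (Complex c t - u + of_nat k) / of_real L powr (v + of_nat k)
          = of_real L powr (- (v + u - Complex c t))"
        by (simp add: powr_diff[symmetric] algebra_simps)
      ultimately show ?thesis unfolding h_def by (simp add: divide_simps)
    qed
    then have "(LINT t|lborel. h x t * of_real L powr (- (v + u - Complex c t)))
        = integral\<^sup>L lborel (h (L * x)) / of_real L powr (v + of_nat k)"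
      by simp
    also have "\<dots> = 2 * of_real pi / fact k * riesz_sum k f lam u (L * x) / of_real L powr (v + of_nat k)"
      using x L by (subst h) auto
    finally show "g (Suc n) * (LINT t|lborel. h x t * of_real (mu (Suc n)) powr (- (v + u - Complex c t)))
      = 2 * of_real pi / fact k *
        (g (Suc n) / of_real (mu (Suc n)) powr (v + of_nat k) * riesz_sum k f lam u (mu (Suc n) * x))"
      by (simp add: L_def)
  qed
  finally have *: "(\<lambda>n. 2 * of_real pi / fact k *
        (g (Suc n) / of_real (mu (Suc n)) powr (v + of_nat k) * riesz_sum k f lam u (mu (Suc n) * x)))
      sums (LINT t|lborel. J (Complex c t))" .
  have nz: "2 * of_real pi / fact k \<noteq> (0::complex)" by simp
  have "summable (\<lambda>n. g (Suc n) / of_real (mu (Suc n)) powr (v + of_nat k) * riesz_sum k f lam u (mu (Suc n) * x))"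
    using sums_summable[OF *] nz by (subst (asm) summable_cmult_iff) auto
  from sums_unique[OF *] suminf_mult[OF this, of "2 * of_real pi / fact k"]
  show "(LINT t|lborel. J (Complex c t)) = 2 * of_real pi / fact k *
      (\<Sum>n. g (Suc n) / of_real (mu (Suc n)) powr (v + of_nat k) * riesz_sum k f lam u (mu (Suc n) * x))"
    by simp
qed

section \<open>Truncated powers and step functions\<close>

definition truncated_power_series :: "(nat \<Rightarrow> complex) \<Rightarrow> (nat \<Rightarrow> real) \<Rightarrow> nat \<Rightarrow> real \<Rightarrow> complex" where
  "truncated_power_series a r j x = (\<Sum>i. a i * of_real ((max 0 (x - r i)) ^ j / fact j))"

text \<open>Order 0 of \<open>truncated_power_series\<close> would not do, since
  \<open>0 ^ 0 = 1\<close> makes every index count there. The truncated power series of order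
  \<open>j \<ge> 1\<close> are the iterated antiderivatives of this step function, and the value 1/2
  is what a symmetric difference quotient sees at a jump.\<close>

definition step_series :: "(nat \<Rightarrow> complex) \<Rightarrow> (nat \<Rightarrow> real) \<Rightarrow> real \<Rightarrow> complex" where
  "step_series a r x = (\<Sum>i. a i * (if r i < x then 1 else if r i = x then 1 / 2 else 0))"

text \<open>The order starts at 2, the first one for which the derivative exists also at the corner
  \<open>x = r\<close>.\<close>

lemma DERIV_truncated_power:
  fixes r x :: real
  shows "((\<lambda>x. (max 0 (x - r)) ^ Suc (Suc j) / fact (Suc (Suc j))) has_real_derivative
      (max 0 (x - r)) ^ Suc j / fact (Suc j)) (at x)"
proof -
  have poly: "((\<lambda>x. (x - r) ^ Suc (Suc j) / fact (Suc (Suc j))) has_real_derivative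
      (x - r) ^ Suc j / fact (Suc j)) (at x)" for x
    by (auto intro!: derivative_eq_intros simp del: power_Suc)
  consider "x < r" | "x > r" | "x = r" by linarith
  then show ?thesis
  proof cases
    case 1
    have "((\<lambda>x. 0) has_real_derivative 0) (at x)" by simp
    then have "((\<lambda>x. (max 0 (x - r)) ^ Suc (Suc j) / fact (Suc (Suc j))) has_real_derivative 0) (at x)"
      by (rule has_field_derivative_transform_within_open[of _ _ _ "{..<r}"]) (use 1 in auto)
    with 1 show ?thesis by simp
  next
    case 2
    have "((\<lambda>x. (max 0 (x - r)) ^ Suc (Suc j) / fact (Suc (Suc j))) has_real_derivative (x - r) ^ Suc j / fact (Suc j)) (at x)"
      by (rule has_field_derivative_transform_within_open[OF poly, of "{r<..}"]) (use 2 in auto)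
    with 2 show ?thesis by simp
  next
    case 3
    have "((\<lambda>h. (max 0 h) ^ Suc (Suc j) / fact (Suc (Suc j)) / h) \<longlongrightarrow> 0) (at (0::real))"
    proof (rule Lim_null_comparison)
      show "\<forall>\<^sub>F h in at 0. norm ((max 0 h) ^ Suc (Suc j) / fact (Suc (Suc j)) / h) \<le> \<bar>h\<bar> ^ Suc j"
      proof (rule eventually_at_filter[THEN iffD2, OF always_eventually], intro allI impI)
        fix h :: real assume "h \<noteq> 0"
        define A where "A = (max 0 h) ^ Suc (Suc j) / fact (Suc (Suc j))"
        have "A \<le> \<bar>h\<bar> ^ Suc (Suc j) / 1" unfolding A_def
          by (intro frac_le power_mono) (auto intro: fact_ge_1 simp del: fact_Suc)
        moreover have "A \<ge> 0" by (simp add: A_def)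
        ultimately have "norm (A / h) \<le> \<bar>h\<bar> ^ Suc (Suc j) / \<bar>h\<bar>"
          by (simp add: divide_right_mono del: power_Suc)
        then show "norm ((max 0 h) ^ Suc (Suc j) / fact (Suc (Suc j)) / h) \<le> \<bar>h\<bar> ^ Suc j"
          using \<open>h \<noteq> 0\<close> by (simp add: A_def del: fact_Suc)
      qed
      have "((\<lambda>h::real. \<bar>h\<bar> ^ Suc j) \<longlongrightarrow> \<bar>0\<bar> ^ Suc j) (at 0)"
        by (intro tendsto_intros)
      then show "((\<lambda>h::real. \<bar>h\<bar> ^ Suc j) \<longlongrightarrow> 0) (at 0)" by simp
    qed
    then show ?thesis using 3 by (simp add: DERIV_def del: power_Suc fact_Suc)
  qed
qed

text \<open>Because all \<open>r i\<close> are positive, the truncated differences stay below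
  \<open>X\<close> on \<open>{..<X}\<close> uniformly in \<open>i\<close>, and the Weierstrass test
  applies to the series of derivatives.\<close>

lemma truncated_power_series_derivative:
  assumes a: "summable (\<lambda>i. norm (a i))" and r: "\<And>i. r i > 0"
  shows "(truncated_power_series a r (Suc (Suc j)) has_vector_derivative truncated_power_series a r (Suc j) x) (at x)"
proof -
  define X where "X = \<bar>x\<bar> + 1"
  define p where "p m i y = (max 0 (y - r i)) ^ m / fact m" for m :: nat and i and y :: real
  have p: "norm (p m i y) \<le> X ^ m" if "y < X" for m i y
  proof -
    have "(max 0 (y - r i)) ^ m / fact m \<le> X ^ m / 1"
      using that r[of i] by (intro frac_le power_mono) (auto simp: X_def intro: fact_ge_1)
    then show ?thesis by (simp add: p_def)
  qed
  have sm: "summable (\<lambda>i. norm (a i) * X ^ m)" for m using a by (rule summable_mult2)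
  have bd: "norm (a i * of_real (p m i y)) \<le> norm (a i) * X ^ m" if "y < X" for m i y
    using p[OF that, of m i] by (simp add: norm_mult mult_left_mono)
  have "\<exists>F. \<forall>y\<in>{..<X}. (\<lambda>i. a i * of_real (p (Suc (Suc j)) i y)) sums F y \<and>
      (F has_derivative (\<lambda>h. h *\<^sub>R (\<Sum>i. a i * of_real (p (Suc j) i y)))) (at y within {..<X})"
  proof (rule has_derivative_series)
    show "convex {..<X}" by simp
    show "((\<lambda>y. a i * of_real (p (Suc (Suc j)) i y)) has_derivative (\<lambda>h. h *\<^sub>R (a i * of_real (p (Suc j) i y)))) (at y within {..<X})" for i y
    proof -
      have "((\<lambda>y. p (Suc (Suc j)) i y) has_real_derivative p (Suc j) i y) (at y within {..<X})"
        unfolding p_def by (rule has_field_derivative_at_within[OF DERIV_truncated_power])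
      from has_vector_derivative_mult_right[OF has_vector_derivative_of_real[OF this], of "a i"]
      show ?thesis by (simp add: has_vector_derivative_def)
    qed
    have "uniform_limit {..<X} (\<lambda>n y. \<Sum>i<n. a i * of_real (p (Suc j) i y)) (\<lambda>y. \<Sum>i. a i * of_real (p (Suc j) i y)) sequentially"
      by (rule Weierstrass_m_test[OF _ sm[of "Suc j"]]) (use bd in \<open>simp del: power_Suc\<close>)
    then show "\<forall>\<^sub>F n in sequentially. \<forall>y\<in>{..<X}. \<forall>h. norm ((\<Sum>i<n. h *\<^sub>R (a i * of_real (p (Suc j) i y)))
        - h *\<^sub>R (\<Sum>i. a i * of_real (p (Suc j) i y))) \<le> e * norm h" if "e > 0" for e
      unfolding uniform_limit_iff
    proof (rule allE[of _ e], elim impE)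
      assume "\<forall>\<^sub>F n in sequentially. \<forall>y\<in>{..<X}. dist (\<Sum>i<n. a i * of_real (p (Suc j) i y)) (\<Sum>i. a i * of_real (p (Suc j) i y)) < e"
      then show ?thesis
      proof eventually_elim
        case (elim n)
        show ?case
        proof (intro ballI allI)
          fix y and h :: real assume "y \<in> {..<X}"
          with elim have "norm ((\<Sum>i<n. a i * of_real (p (Suc j) i y)) - (\<Sum>i. a i * of_real (p (Suc j) i y))) \<le> e"
            by (auto simp: dist_norm less_imp_le)
          from mult_right_mono[OF this, of "norm h"]
          show "norm ((\<Sum>i<n. h *\<^sub>R (a i * of_real (p (Suc j) i y))) - h *\<^sub>R (\<Sum>i. a i * of_real (p (Suc j) i y))) \<le> e * norm h"
            by (simp add: scaleR_sum_right[symmetric] scaleR_diff_right[symmetric] mult.commute)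
        qed
      qed
    qed (use that in auto)
    show "x \<in> {..<X}" by (simp add: X_def)
    show "(\<lambda>i. a i * of_real (p (Suc (Suc j)) i x)) sums (\<Sum>i. a i * of_real (p (Suc (Suc j)) i x))"
      by (rule summable_sums, rule summable_norm_cancel, rule summable_norm_mult_bounded[OF a, where K = "X ^ Suc (Suc j)"])
         (use p[of x "Suc (Suc j)"] in \<open>simp add: X_def del: power_Suc\<close>)
  qed
  then obtain F where F: "\<And>y. y < X \<Longrightarrow> F y = truncated_power_series a r (Suc (Suc j)) y"
      "(F has_derivative (\<lambda>h. h *\<^sub>R (\<Sum>i. a i * of_real (p (Suc j) i x)))) (at x within {..<X})"
    unfolding truncated_power_series_def p_def X_def by (fastforce simp: sums_iff simp del: power_Suc fact_Suc)
  have "(F has_vector_derivative truncated_power_series a r (Suc j) x) (at x)"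
    using F(2) at_within_open[of x "{..<X}"]
    by (simp add: has_vector_derivative_def truncated_power_series_def p_def X_def)
  then show ?thesis
    by (rule has_vector_derivative_transform_within_open[of _ _ _ "{..<X}"]) (auto simp: F(1) X_def)
qed

text \<open>The symmetric quotients of \<open>max 0 (x - r i)\<close> are bounded by 1, as this
  function has Lipschitz constant 1, so the termwise limit is justified by Tannery's theorem
  although the ordinary derivative may fail at \<open>x\<close>.\<close>

lemma truncated_linear_series_symmetric_derivative:
  assumes a: "summable (\<lambda>i. norm (a i))" and r: "\<And>i. r i > 0"
  shows "((\<lambda>h. (truncated_power_series a r 1 (x + h) - truncated_power_series a r 1 (x - h)) / of_real (2 * h))
      \<longlongrightarrow> step_series a r x) (at_right 0)"
proof -
  define q where "q i h = (max 0 (x + h - r i) - max 0 (x - h - r i)) / (2 * h)" for i h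
  have q: "\<bar>q i h\<bar> \<le> 1" if "h > 0" for i h
    using that by (auto simp: q_def abs_le_iff divide_le_eq le_divide_eq max_def)
  have sm: "summable (\<lambda>i. a i * of_real (max 0 (y - r i)))" for y
  proof (rule summable_norm_cancel, rule summable_norm_mult_bounded[OF a])
    show "norm (complex_of_real (max 0 (y - r i))) \<le> \<bar>y\<bar>" for i
      using r[of i] by (auto simp: max_def)
  qed
  have eq: "(truncated_power_series a r 1 (x + h) - truncated_power_series a r 1 (x - h)) / of_real (2 * h)
      = (\<Sum>i. a i * of_real (q i h))" for h
  proof -
    have "(truncated_power_series a r 1 (x + h) - truncated_power_series a r 1 (x - h)) / of_real (2 * h)
       = (\<Sum>i. a i * of_real (max 0 (x + h - r i)) - a i * of_real (max 0 (x - h - r i))) / of_real (2 * h)"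
      unfolding truncated_power_series_def by (simp add: suminf_diff sm)
    also have "\<dots> = (\<Sum>i. (a i * of_real (max 0 (x + h - r i)) - a i * of_real (max 0 (x - h - r i))) / of_real (2 * h))"
      by (intro suminf_divide[symmetric] summable_diff sm)
    also have "\<dots> = (\<Sum>i. a i * of_real (q i h))"
      by (simp add: q_def algebra_simps diff_divide_distrib)
    finally show ?thesis .
  qed
  have "((\<lambda>h. \<Sum>i. a i * of_real (q i h)) \<longlongrightarrow>
      (\<Sum>i. a i * of_real (if r i < x then 1 else if r i = x then 1 / 2 else 0))) (at_right 0)"
  proof (rule tannerys_theorem[THEN conjunct2, THEN conjunct2, OF _ _ a])
    fix i
    have "((\<lambda>h. q i h) \<longlongrightarrow> (if r i < x then 1 else if r i = x then 1 / 2 else 0)) (at_right 0)"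
    proof (rule tendsto_eventually)
      \<comment> \<open>The distance to the corner: for smaller \<open>h\<close> the quotient
        already equals its limit. If the corner is at \<open>x\<close> itself the quotient is 1/2
        for every \<open>h > 0\<close>, and 1 is an arbitrary choice.\<close>
      define e where "e = (if r i = x then 1 else \<bar>x - r i\<bar>)"
      have "e > 0" by (auto simp: e_def)
      show "\<forall>\<^sub>F h in at_right 0. q i h = (if r i < x then 1 else if r i = x then 1 / 2 else 0)"
      proof (rule eventually_at_rightI[OF _ \<open>e > 0\<close>])
        fix h assume "h \<in> {0<..<e}"
        then show "q i h = (if r i < x then 1 else if r i = x then 1 / 2 else 0)"
          by (auto simp: q_def e_def max_def field_simps split: if_splits)
      qed
    qed
    then show "((\<lambda>h. a i * of_real (q i h)) \<longlongrightarrow>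
        a i * of_real (if r i < x then 1 else if r i = x then 1 / 2 else 0)) (at_right 0)"
      by (intro tendsto_intros)
  next
    have "\<forall>\<^sub>F h in at_right (0::real). h > 0" by (simp add: eventually_at_right_less)
    then have "\<forall>\<^sub>F p in at_top \<times>\<^sub>F at_right (0::real). snd p > 0"
      by (rule eventually_compose_filterlim[OF _ filterlim_snd])
    then show "\<forall>\<^sub>F (i, h) in at_top \<times>\<^sub>F at_right 0. norm (a i * of_real (q i h)) \<le> norm (a i)"
      by eventually_elim (auto simp: norm_mult intro!: mult_right_le_one_le q)
  qed simp
  moreover have "(\<Sum>i. a i * of_real (if r i < x then 1 else if r i = x then 1 / 2 else 0)) = step_series a r x"
    unfolding step_series_def by (intro arg_cong[of _ _ suminf] ext) simp
  ultimately show ?thesis unfolding eq by simp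
qed

section \<open>Derivatives in the scaling variable\<close>

lemma iterated_deriv_eq:
  assumes D: "\<And>i x. i < j \<Longrightarrow> x > 0 \<Longrightarrow> (D i has_vector_derivative D (Suc i) x) (at x)"
    and F: "\<And>x. x > 0 \<Longrightarrow> F x = D 0 x" and x: "x > (0::real)"
  shows "iterated_deriv j F x = D j x"
  using x D
proof (induction j arbitrary: x)
  case 0
  then show ?case by (simp add: iterated_deriv_def F)
next
  case (Suc j)
  have "(D j has_vector_derivative D (Suc j) x) (at x)" using Suc.prems by simp
  then have "(iterated_deriv j F has_vector_derivative D (Suc j) x) (at x)"
    by (rule has_vector_derivative_transform_within_open[of _ _ _ "{0<..}"])
       (use Suc in auto)
  then show ?case
    by (simp add: iterated_deriv_def vector_derivative_at)
qed

text \<open>A chain of candidates on the whole half-line is required only up to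
  \<open>D (k - 1)\<close>; the last differentiation is a limit at the single point
  \<open>a\<close>.\<close>

lemma has_kth_derivI:
  assumes k: "k \<ge> 1" and a: "a > 0"
    and D: "\<And>i x. Suc i < k \<Longrightarrow> x > 0 \<Longrightarrow> (D i has_vector_derivative D (Suc i) x) (at x)"
    and F: "\<And>x. x > 0 \<Longrightarrow> F x = D 0 x"
    and lim: "((\<lambda>h. (D (k - 1) (a + h) - D (k - 1) (a - h)) / of_real (2 * h)) \<longlongrightarrow> A) (at_right 0)"
  shows "has_kth_deriv k F A a"
proof -
  have it: "iterated_deriv j F x = D j x" if "j < k" "x > 0" for j x
    using that by (intro iterated_deriv_eq D F) auto
  have "\<forall>\<^sub>F x in nhds a. iterated_deriv j F differentiable (at x)" if j: "Suc j < k" for j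
  proof -
    have "\<forall>\<^sub>F x in nhds a. x \<in> {0<..}" using a by (intro eventually_nhds_in_open) auto
    then show ?thesis
    proof eventually_elim
      case (elim x)
      have "(D j has_vector_derivative D (Suc j) x) (at x)" using D j elim by simp
      then have "(iterated_deriv j F has_vector_derivative D (Suc j) x) (at x)"
        by (rule has_vector_derivative_transform_within_open[of _ _ _ "{0<..}"]) (use it j elim in auto)
      then show ?case by (rule differentiableI_vector)
    qed
  qed
  moreover have "((\<lambda>h. (iterated_deriv (k - 1) F (a + h) - iterated_deriv (k - 1) F (a - h)) / of_real (2 * h)) \<longlongrightarrow> A) (at_right 0)"
  proof (rule Lim_transform_eventually[OF lim], rule eventually_at_rightI[OF _ a])
    fix h assume "h \<in> {0<..<a}"
    then show "(D (k - 1) (a + h) - D (k - 1) (a - h)) / of_real (2 * h)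
        = (iterated_deriv (k - 1) F (a + h) - iterated_deriv (k - 1) F (a - h)) / of_real (2 * h)"
      using k a it[of "k - 1" "a + h"] it[of "k - 1" "a - h"] by simp
  qed
  ultimately show ?thesis using k unfolding has_kth_deriv_def by simp
qed

text \<open>Leibniz rule on the parameter interval. On a segment the velocity is the constant
  \<open>q - p\<close>, so joint continuity of \<open>F'\<close> is all that is needed; this is why
  the residues will be collected on rectangles.\<close>

lemma contour_integral_linepath_has_vector_derivative:
  fixes F :: "real \<Rightarrow> complex \<Rightarrow> complex"
  assumes deriv: "\<And>x z. x > 0 \<Longrightarrow> z \<in> closed_segment p q \<Longrightarrow> ((\<lambda>x. F x z) has_vector_derivative F' x z) (at x)"
    and contF: "\<And>x. x > 0 \<Longrightarrow> continuous_on (closed_segment p q) (F x)"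
    and contF': "continuous_on ({0<..} \<times> closed_segment p q) (\<lambda>(x, z). F' x z)"
    and x: "x > 0"
  shows "((\<lambda>x. contour_integral (linepath p q) (F x)) has_vector_derivative contour_integral (linepath p q) (F' x)) (at x)"
proof -
  have lp: "linepath p q t \<in> closed_segment p q" if "t \<in> cbox 0 1" for t
    using that by (auto simp: linepath_in_path)
  have "((\<lambda>x. integral (cbox 0 1) (\<lambda>t. F x (linepath p q t) * (q - p))) has_vector_derivative
      integral (cbox 0 1) (\<lambda>t. F' x (linepath p q t) * (q - p))) (at x within {0<..})"
  proof (rule leibniz_rule_vector_derivative)
    show "((\<lambda>x. F x (linepath p q t) * (q - p)) has_vector_derivative F' y (linepath p q t) * (q - p)) (at y within {0<..})"
      if "y \<in> {0<..}" "t \<in> cbox 0 1" for y t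
      by (rule has_vector_derivative_mult_left, rule has_vector_derivative_at_within, rule deriv) (use lp that in auto)
    show "(\<lambda>t. F y (linepath p q t) * (q - p)) integrable_on cbox 0 1" if "y \<in> {0<..}" for y
      using that lp
      by (intro integrable_continuous continuous_intros continuous_on_compose2[OF contF continuous_on_linepath]) auto
    have "continuous_on ({0<..} \<times> cbox 0 1) (\<lambda>w. (\<lambda>(x, z). F' x z) (fst w, linepath p q (snd w)))"
      using lp by (intro continuous_on_compose2[OF contF'] continuous_intros
          continuous_on_compose2[OF continuous_on_linepath[of "cbox 0 1"]]) auto
    then show "continuous_on ({0<..} \<times> cbox 0 1) (\<lambda>(x, t). F' x (linepath p q t) * (q - p))"
      by (auto simp: case_prod_unfold intro!: continuous_intros)
  qed (use x in auto)
  then show ?thesis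
    using x by (simp add: contour_integral_integral at_within_open[of x "{0<..}"])
qed

lemma contour_integral_rectpath_sides:
  assumes "continuous_on (path_image (rectpath p q)) f"
  shows "contour_integral (rectpath p q) f =
      contour_integral (linepath p (Complex (Re q) (Im p))) f
      + (contour_integral (linepath (Complex (Re q) (Im p)) q) f
      + (contour_integral (linepath q (Complex (Re p) (Im q))) f
      + contour_integral (linepath (Complex (Re p) (Im q)) p) f))"
proof -
  let ?r = "Complex (Re q) (Im p)" and ?s = "Complex (Re p) (Im q)"
  have "f contour_integrable_on linepath p ?r" "f contour_integrable_on linepath ?r q"
       "f contour_integrable_on linepath q ?s" "f contour_integrable_on linepath ?s p"
    by (auto intro!: contour_integrable_continuous_linepath continuous_on_subset[OF assms]
        simp: rectpath_def Let_def path_image_join)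
  then show ?thesis
    by (simp add: rectpath_def Let_def valid_path_join)
qed

text \<open>Differentiation brings down the exponent \<open>w + m + 1\<close>, which is the last
  factor of the Pochhammer symbol, so the kernel of order \<open>m + 1\<close> becomes that of order
  \<open>m\<close>.\<close>

lemma Riesz_kernel_derivative:
  fixes w :: complex
  assumes x: "x > 0" and w: "w \<noteq> - of_nat (Suc m)"
  shows "((\<lambda>x. of_real x powr (w + of_nat (Suc m)) / pochhammer w (Suc (Suc m))) has_vector_derivative
      of_real x powr (w + of_nat m) / pochhammer w (Suc m)) (at x)"
proof -
  have nz: "w + of_nat (Suc m) \<noteq> 0" using w unfolding eq_neg_iff_add_eq_0 .
  have "((\<lambda>z. z powr (w + of_nat (Suc m)) / pochhammer w (Suc (Suc m))) has_field_derivative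
      (w + of_nat (Suc m)) * of_real x powr (w + of_nat (Suc m) - 1) / pochhammer w (Suc (Suc m))) (at (of_real x))"
    using x by (intro DERIV_cdivide has_field_derivative_powr) auto
  from has_vector_derivative_real_field[OF this]
  have "((\<lambda>x. of_real x powr (w + of_nat (Suc m)) / pochhammer w (Suc (Suc m))) has_vector_derivative
      (w + of_nat (Suc m)) * of_real x powr (w + of_nat (Suc m) - 1) / pochhammer w (Suc (Suc m))) (at x)" .
  also have "w + of_nat (Suc m) - 1 = w + of_nat m" by simp
  also have "(w + of_nat (Suc m)) * of_real x powr (w + of_nat m) / pochhammer w (Suc (Suc m))
      = of_real x powr (w + of_nat m) / pochhammer w (Suc m)"
    using nz unfolding pochhammer_Suc[of w "Suc m"] 
    by (subst mult.commute[of "pochhammer w (Suc m)"], rule mult_divide_mult_cancel_left)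
  finally show ?thesis .
qed

lemma rectpath_Riesz_kernel_derivative:
  fixes u :: complex
  assumes cont: "continuous_on (path_image (rectpath p q)) \<Psi>"
    and avoid: "\<And>z j. z \<in> path_image (rectpath p q) \<Longrightarrow> j \<le> Suc m \<Longrightarrow> z \<noteq> u - of_nat j" and x: "x > 0"
  defines "R \<equiv> \<lambda>m x. contour_integral (rectpath p q)
      (\<lambda>z. \<Psi> z * (of_real x powr (z - u + of_nat m) / pochhammer (z - u) (Suc m)))"
  shows "(R (Suc m) has_vector_derivative R m x) (at x)"
proof -
  define F where "F m x z = \<Psi> z * (of_real x powr (z - u + of_nat m) / pochhammer (z - u) (Suc m))"
    for m and x :: real and z
  let ?P = "path_image (rectpath p q)"
  have nz: "pochhammer (z - u) (Suc n) \<noteq> 0" if "z \<in> ?P" "n \<le> Suc m" for z n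
    using avoid[OF that(1)] that(2) by (auto simp: pochhammer_eq_0_iff algebra_simps)
  have cF: "continuous_on ?P (F n x)" if "x > 0" "n \<le> Suc m" for n x
    unfolding F_def using nz[unfolded pochhammer_prod] that unfolding pochhammer_prod
    by (intro continuous_intros cont) auto
  have cF': "continuous_on ({0<..} \<times> ?P) (\<lambda>(x, z). F m x z)"
  proof -
    have "continuous_on ({0<..} \<times> ?P) (\<lambda>w. \<Psi> (snd w))"
      by (rule continuous_on_compose2[OF cont continuous_on_snd[OF continuous_on_id]]) auto
    then show ?thesis
      unfolding F_def case_prod_unfold using nz[unfolded pochhammer_prod] unfolding pochhammer_prod
      by (intro continuous_intros) auto
  qed
  have side: "((\<lambda>x. contour_integral (linepath c d) (F (Suc m) x)) has_vector_derivative
      contour_integral (linepath c d) (F m x)) (at x)" if sub: "closed_segment c d \<subseteq> ?P" for c d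
  proof (rule contour_integral_linepath_has_vector_derivative)
    fix y z assume y: "(y::real) > 0" and z: "z \<in> closed_segment c d"
    have "z \<noteq> u - of_nat (Suc m)" using z sub avoid by blast
    then have "z - u \<noteq> - of_nat (Suc m)" by (auto simp: algebra_simps)
    from has_vector_derivative_mult_right[OF Riesz_kernel_derivative[OF y this], of "\<Psi> z"]
    show "((\<lambda>x. F (Suc m) x z) has_vector_derivative F m y z) (at y)" by (simp only: F_def)
  next
    show "continuous_on (closed_segment c d) (F (Suc m) y)" if "y > 0" for y
      using cF[OF that] sub continuous_on_subset by blast
    show "continuous_on ({0<..} \<times> closed_segment c d) (\<lambda>(x, z). F m x z)"
      using sub by (intro continuous_on_subset[OF cF']) auto
  qed (rule x)
  let ?r = "Complex (Re q) (Im p)" and ?s = "Complex (Re p) (Im q)"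
  have R: "R n y = contour_integral (linepath p ?r) (F n y) + (contour_integral (linepath ?r q) (F n y)
      + (contour_integral (linepath q ?s) (F n y) + contour_integral (linepath ?s p) (F n y)))"
    if "y > 0" "n \<le> Suc m" for n y
    unfolding R_def F_def[symmetric] by (rule contour_integral_rectpath_sides[OF cF[OF that]])
  have sub: "closed_segment p ?r \<subseteq> ?P" "closed_segment ?r q \<subseteq> ?P" "closed_segment q ?s \<subseteq> ?P" "closed_segment ?s p \<subseteq> ?P"
    by (auto simp: rectpath_def Let_def path_image_join)
  have "((\<lambda>y. contour_integral (linepath p ?r) (F (Suc m) y) + (contour_integral (linepath ?r q) (F (Suc m) y)
      + (contour_integral (linepath q ?s) (F (Suc m) y) + contour_integral (linepath ?s p) (F (Suc m) y))))
      has_vector_derivative R m x) (at x)"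
    unfolding R[OF x, of m, simplified] by (intro has_vector_derivative_add side sub)
  then show ?thesis
    by (rule has_vector_derivative_transform_within_open[of _ _ _ "{0<..}"]) (use x R in auto)
qed

section \<open>Consequences of the functional equation\<close>

lemma integrable_lborel_decay':
  fixes h :: "real \<Rightarrow> complex"
  assumes cont: "continuous_on UNIV h" and p: "p > 1"
    and bound: "\<And>t. \<bar>t\<bar> \<ge> T \<Longrightarrow> norm (h t) \<le> B * \<bar>t\<bar> powr (- p)"
  shows "integrable lborel h"
proof -
  define R where "R = max T 1"
  have "compact (h ` {- R..R})"
    by (intro compact_continuous_image continuous_on_subset[OF cont]) auto
  then obtain M where M: "\<And>t. t \<in> {- R..R} \<Longrightarrow> norm (h t) \<le> M"
    by (blast dest: compact_imp_bounded[THEN bounded_iff[THEN iffD1]])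
  have "norm (h 0) \<le> M" by (rule M) (auto simp: R_def)
  then have M0: "0 \<le> M" by (rule order_trans[OF norm_ge_zero])
  show ?thesis
  proof (rule integrable_lborel_decay[OF cont p, of "max B (M * R powr p)"])
    fix t :: real assume t: "\<bar>t\<bar> \<ge> 1"
    show "norm (h t) \<le> max B (M * R powr p) * \<bar>t\<bar> powr - p"
    proof (cases "\<bar>t\<bar> \<le> R")
      case True
      have "1 \<le> R powr p * \<bar>t\<bar> powr - p"
      proof -
        have "1 = \<bar>t\<bar> powr p * \<bar>t\<bar> powr - p" using t by (simp add: powr_minus)
        also have "\<dots> \<le> R powr p * \<bar>t\<bar> powr - p"
          using True t p by (intro mult_right_mono powr_mono2) auto
        finally show ?thesis .
      qed
      then have "M * 1 \<le> M * (R powr p * \<bar>t\<bar> powr - p)" using M0 by (rule mult_left_mono)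
      moreover have "norm (h t) \<le> M" using True by (intro M) auto
      moreover have "M * R powr p * \<bar>t\<bar> powr - p \<le> max B (M * R powr p) * \<bar>t\<bar> powr - p"
        by (intro mult_right_mono) auto
      ultimately show ?thesis by (simp add: mult.assoc)
    next
      case False
      then have "norm (h t) \<le> B * \<bar>t\<bar> powr - p" by (intro bound) (auto simp: R_def)
      also have "\<dots> \<le> max B (M * R powr p) * \<bar>t\<bar> powr - p" by (intro mult_right_mono) auto
      finally show ?thesis .
    qed
  qed
qed

text \<open>Phragmen-Lindelof for \<open>J s * s\<close>: in the strip \<open>|s|\<close> is
  comparable with \<open>Im s\<close>, so the assumed decay bounds this function on the sides, and
  the bottom edge is compact.\<close>

lemma strip_decay_upper:
  fixes J :: "complex \<Rightarrow> complex"
  assumes holo: "J holomorphic_on U" and U: "open U" "{s. a \<le> Re s \<and> Re s \<le> b \<and> T \<le> Im s} \<subseteq> U"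
    and T: "T \<ge> 1"
    and side: "\<And>s. Re s = a \<or> Re s = b \<Longrightarrow> T \<le> Im s \<Longrightarrow> norm (J s) \<le> B / Im s"
    and growth: "\<And>s. a \<le> Re s \<Longrightarrow> Re s \<le> b \<Longrightarrow> T \<le> Im s \<Longrightarrow> norm (J s) \<le> B' * exp (A * Im s)"
  shows "\<exists>M. \<forall>s. a \<le> Re s \<longrightarrow> Re s \<le> b \<longrightarrow> T \<le> Im s \<longrightarrow> norm (J s) \<le> M / Im s"
proof (cases "a \<le> b")
  case ab: True
  define R where "R = max \<bar>a\<bar> \<bar>b\<bar>"
  have nz: "norm s \<le> (R + 1) * Im s" if "a \<le> Re s" "Re s \<le> b" "T \<le> Im s" for s
  proof -
    have "norm s \<le> R + Im s" using cmod_le[of s] that T by (auto simp: R_def)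
    also have "\<dots> \<le> R * Im s + Im s" using that T mult_left_mono[of 1 "Im s" R] by (simp add: R_def)
    finally show ?thesis by (simp add: algebra_simps)
  qed
  let ?bot = "cbox (Complex a T) (Complex b T)"
  have "?bot \<subseteq> U" using U(2) by (auto simp: in_cbox_complex_iff)
  then have "compact ((\<lambda>s. J s * s) ` ?bot)"
    by (intro compact_continuous_image continuous_on_mult continuous_on_id compact_cbox
          holomorphic_on_imp_continuous_on[OF holomorphic_on_subset[OF holo]])
  then obtain M1 where M1: "\<And>s. s \<in> ?bot \<Longrightarrow> norm (J s * s) \<le> M1"
    by (blast dest: compact_imp_bounded[THEN bounded_iff[THEN iffD1]])
  define M where "M = max 1 (max M1 (\<bar>B\<bar> * (R + 1)))"
  have R0: "R \<ge> 0" by (simp add: R_def)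
  have main: "norm (J s * s) \<le> M" if "a \<le> Re s" "Re s \<le> b" "T \<le> Im s" for s
  proof (rule Phragmen_Lindelof_half_strip[of "\<lambda>s. J s * s" U a b T M "\<bar>B'\<bar> * (R + 1)" "A + 1"])
    show "(\<lambda>s. J s * s) holomorphic_on U" by (intro holomorphic_intros holo)
    show "0 < M" by (simp add: M_def)
    show "norm (J s * s) \<le> M" if "Re s = a \<or> Re s = b" "T \<le> Im s" for s
    proof -
      have "norm (J s) \<le> B / Im s" by (rule side[OF that])
      also have "\<dots> \<le> \<bar>B\<bar> / Im s" using T that by (intro divide_right_mono) auto
      finally have "norm (J s) \<le> \<bar>B\<bar> / Im s" .
      then have "norm (J s * s) \<le> \<bar>B\<bar> / Im s * ((R + 1) * Im s)"
        unfolding norm_mult using that T ab R0 by (intro mult_mono nz) auto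
      also have "\<dots> = \<bar>B\<bar> * (R + 1)" using that T by simp
      finally show ?thesis by (simp add: M_def)
    qed
    show "norm (J s * s) \<le> M" if "a \<le> Re s" "Re s \<le> b" "Im s = T" for s
      using M1[of s] that by (auto simp: M_def in_cbox_complex_iff)
    show "norm (J s * s) \<le> \<bar>B'\<bar> * (R + 1) * exp ((A + 1) * Im s)" if "a \<le> Re s" "Re s \<le> b" "T \<le> Im s" for s
    proof -
      have "norm (J s) \<le> B' * exp (A * Im s)" by (rule growth[OF that])
      also have "\<dots> \<le> \<bar>B'\<bar> * exp (A * Im s)" by (intro mult_right_mono) auto
      finally have "norm (J s) \<le> \<bar>B'\<bar> * exp (A * Im s)" .
      then have "norm (J s * s) \<le> \<bar>B'\<bar> * exp (A * Im s) * ((R + 1) * Im s)"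
        unfolding norm_mult using that by (intro mult_mono nz) auto
      also have "\<dots> \<le> \<bar>B'\<bar> * exp (A * Im s) * ((R + 1) * exp (Im s))"
      proof (intro mult_left_mono)
        show "Im s \<le> exp (Im s)" using exp_ge_add_one_self[of "Im s"] by linarith
      qed (use R0 in auto)
      also have "\<dots> = \<bar>B'\<bar> * (R + 1) * exp ((A + 1) * Im s)"
        by (simp add: algebra_simps exp_add)
      finally show ?thesis .
    qed
  qed (use U that in auto)
  show ?thesis
  proof (intro exI[of _ M] allI impI)
    fix s assume s: "a \<le> Re s" "Re s \<le> b" "T \<le> Im s"
    have "norm (J s) * Im s \<le> norm (J s) * norm s"
      using abs_Im_le_cmod[of s] by (intro mult_left_mono) auto
    also have "\<dots> \<le> M" using main[OF s] by (simp add: norm_mult)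
    finally show "norm (J s) \<le> M / Im s" using s T by (simp add: le_divide_eq)
  qed
qed auto

text \<open>The lower half of the strip is the upper half for \<open>J (- s)\<close>.\<close>

lemma strip_decay:
  fixes J :: "complex \<Rightarrow> complex"
  assumes holo: "J holomorphic_on U" and U: "open U" "{s. a \<le> Re s \<and> Re s \<le> b \<and> T \<le> \<bar>Im s\<bar>} \<subseteq> U"
    and T: "T \<ge> 1"
    and side: "\<And>s. Re s = a \<or> Re s = b \<Longrightarrow> T \<le> \<bar>Im s\<bar> \<Longrightarrow> norm (J s) \<le> B / \<bar>Im s\<bar>"
    and growth: "\<And>s. a \<le> Re s \<Longrightarrow> Re s \<le> b \<Longrightarrow> T \<le> \<bar>Im s\<bar> \<Longrightarrow> norm (J s) \<le> B' * exp (A * \<bar>Im s\<bar>)"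
  shows "\<exists>M. \<forall>s. a \<le> Re s \<longrightarrow> Re s \<le> b \<longrightarrow> T \<le> \<bar>Im s\<bar> \<longrightarrow> norm (J s) \<le> M / \<bar>Im s\<bar>"
proof -
  have "\<exists>M. \<forall>s. a \<le> Re s \<longrightarrow> Re s \<le> b \<longrightarrow> T \<le> Im s \<longrightarrow> norm (J s) \<le> M / Im s"
  proof (rule strip_decay_upper[OF holo U(1) _ T])
    show "{s. a \<le> Re s \<and> Re s \<le> b \<and> T \<le> Im s} \<subseteq> U" using U(2) by fastforce
    show "norm (J s) \<le> B / Im s" if "Re s = a \<or> Re s = b" "T \<le> Im s" for s
      using side[of s] that T by auto
    show "norm (J s) \<le> B' * exp (A * Im s)" if "a \<le> Re s" "Re s \<le> b" "T \<le> Im s" for s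
      using growth[of s] that T by auto
  qed
  then obtain M1 where M1: "\<And>s. a \<le> Re s \<Longrightarrow> Re s \<le> b \<Longrightarrow> T \<le> Im s \<Longrightarrow> norm (J s) \<le> M1 / Im s" by blast
  have "\<exists>M. \<forall>s. - b \<le> Re s \<longrightarrow> Re s \<le> - a \<longrightarrow> T \<le> Im s \<longrightarrow> norm (J (- s)) \<le> M / Im s"
  proof (rule strip_decay_upper[of _ "uminus ` U", OF _ _ _ T])
    show "(\<lambda>s. J (- s)) holomorphic_on uminus ` U"
      using holo by (intro holomorphic_on_compose_gen[of uminus _ J U, unfolded o_def] holomorphic_intros) auto
    show "open (uminus ` U)" using U(1) by (simp add: open_negations)
    show "{s. - b \<le> Re s \<and> Re s \<le> - a \<and> T \<le> Im s} \<subseteq> uminus ` U"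
    proof
      fix s assume "s \<in> {s. - b \<le> Re s \<and> Re s \<le> - a \<and> T \<le> Im s}"
      then have "- s \<in> U" using U(2) T by auto
      then show "s \<in> uminus ` U" by (metis imageI minus_minus)
    qed
    show "norm (J (- s)) \<le> B / Im s" if "Re s = - b \<or> Re s = - a" "T \<le> Im s" for s
      using side[of "- s"] that T by auto
    show "norm (J (- s)) \<le> B' * exp (A * Im s)" if "- b \<le> Re s" "Re s \<le> - a" "T \<le> Im s" for s
      using growth[of "- s"] that T by auto
  qed
  then obtain M2 where M2: "\<And>s. - b \<le> Re s \<Longrightarrow> Re s \<le> - a \<Longrightarrow> T \<le> Im s \<Longrightarrow> norm (J (- s)) \<le> M2 / Im s" by blast
  show ?thesis
  proof (intro exI[of _ "max M1 M2"] allI impI)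
    fix s assume s: "a \<le> Re s" "Re s \<le> b" "T \<le> \<bar>Im s\<bar>"
    show "norm (J s) \<le> max M1 M2 / \<bar>Im s\<bar>"
    proof (cases "Im s \<ge> 0")
      case True
      then have "norm (J s) \<le> M1 / \<bar>Im s\<bar>" using M1[of s] s by simp
      also have "\<dots> \<le> max M1 M2 / \<bar>Im s\<bar>" by (intro divide_right_mono) auto
      finally show ?thesis .
    next
      case False
      then have "norm (J s) \<le> M2 / \<bar>Im s\<bar>" using M2[of "- s"] s by simp
      also have "\<dots> \<le> max M1 M2 / \<bar>Im s\<bar>" by (intro divide_right_mono) auto
      finally show ?thesis .
    qed
  qed
qed

text \<open>Near a point further to the right the function is a Dirichlet series bounded on a
  half-plane, whereas its modulus tends to infinity at a pole.\<close>

lemma meromorphic_dirichlet_pole_le: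
  assumes l: "multiplicative_frequencies l" and \<phi>: "meromorphic_dirichlet \<phi> f l \<sigma>a" and p: "is_pole \<phi> p"
  shows "Re p \<le> \<sigma>a"
proof (rule ccontr)
  assume "\<not> Re p \<le> \<sigma>a"
  define \<tau> where "\<tau> = (\<sigma>a + Re p) / 2"
  have \<tau>: "\<sigma>a < \<tau>" "\<tau> < Re p" using \<open>\<not> Re p \<le> \<sigma>a\<close> by (auto simp: \<tau>_def field_simps)
  define M where "M = (\<Sum>n. norm (f (Suc n)) * l (Suc n) powr (- \<tau>))"
  have "\<forall>\<^sub>F s in at p. s \<in> {s. \<tau> < Re s}"
    using \<tau> by (intro eventually_at_in_open' open_halfspace_Re_gt) auto
  then have "\<forall>\<^sub>F s in at p. norm (\<phi> s) \<le> M"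
  proof eventually_elim
    case (elim s)
    then show ?case
      using \<phi> \<tau> norm_dirichlet_series_le[OF l meromorphic_dirichlet_abs_conv_at[OF l \<phi> \<tau>(1)], of s]
      by (auto simp: meromorphic_dirichlet_def M_def)
  qed
  moreover have "\<forall>r>0. \<forall>\<^sub>F s in at p. r \<le> norm (\<phi> s)"
    using p by (simp add: is_pole_def filterlim_at_infinity[of 0, OF order_refl])
  then have "\<forall>\<^sub>F s in at p. \<bar>M\<bar> + 1 \<le> norm (\<phi> s)"
    by (meson abs_ge_zero add_nonneg_pos zero_less_one)
  ultimately have "\<forall>\<^sub>F s in at p. False" by eventually_elim linarith
  then show False by simp
qed

lemma nicely_meromorphic_holomorphic_off_poles:
  assumes "\<phi> nicely_meromorphic_on UNIV"
  shows "\<phi> holomorphic_on {z. \<not> is_pole \<phi> z}"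
proof (rule analytic_imp_holomorphic)
  show "\<phi> analytic_on {z. \<not> is_pole \<phi> z}"
    using nicely_meromorphic_on_imp_analytic_at[OF assms] by (subst analytic_on_analytic_at) auto
qed

text \<open>With the entire function \<open>rGamma\<close> in place of \<open>Gamma\<close> both
  sides are holomorphic off \<open>S\<close> and the poles of \<phi>. Removing finitely many points
  keeps the complement of \<open>S\<close> connected, so the identity continues from the right
  half-plane.\<close>

lemma completed_identity:
  assumes X: "X holomorphic_on - S" and S: "bounded S" "closed S" "connected (- S)"
    and \<phi>: "\<phi> nicely_meromorphic_on UNIV" "finite {p. is_pole \<phi> p}"
    and eq: "\<And>s. Re s > \<alpha> \<Longrightarrow> s \<notin> S \<Longrightarrow> X s = of_real (2 * pi) powr (- s) * Gamma s * \<phi> s"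
    and z: "z \<notin> S" "\<not> is_pole \<phi> z"
  shows "X z * rGamma z = of_real (2 * pi) powr (- z) * \<phi> z"
proof -
  define D where "D = - S - {p. is_pole \<phi> p}"
  define A where "A = D \<inter> {s. Re s > max \<alpha> 0}"
  have oD: "open D" unfolding D_def by (intro open_Diff open_Compl S(2) finite_imp_closed[OF \<phi>(2)])
  have oA: "open A" unfolding A_def by (intro open_Int oD open_halfspace_Re_gt)
  have cD: "connected D" unfolding D_def
    using S \<phi> by (intro connected_open_delete_finite) (auto simp: open_Compl)
  have "bounded (S \<union> {p. is_pole \<phi> p})" using S \<phi> by (simp add: finite_imp_bounded)
  then obtain B where B: "\<And>s. s \<in> S \<or> is_pole \<phi> s \<Longrightarrow> norm s \<le> B" by (auto simp: bounded_iff)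
  \<comment> \<open>A real point beyond \<open>S\<close>, beyond the poles of \<phi>, and in the
    half-plane where the identity is known and \<open>Gamma\<close> does not vanish.\<close>
  define r where "r = max (max \<alpha> 0) B + 1"
  have "of_real r \<notin> S" "\<not> is_pole \<phi> (of_real r)" using B[of "of_real r"] by (auto simp: r_def)
  then have ne: "A \<noteq> {}" by (auto simp: A_def D_def r_def intro!: exI[of _ "of_real r"])
  show ?thesis
  proof (rule analytic_continuation_open[OF oA oD ne cD, where f = "\<lambda>z. X z * rGamma z"
        and g = "\<lambda>z. of_real (2 * pi) powr (- z) * \<phi> z"])
    show "A \<subseteq> D" by (auto simp: A_def)
    show "(\<lambda>z. X z * rGamma z) holomorphic_on D"
      by (intro holomorphic_intros holomorphic_on_subset[OF X]) (auto simp: D_def)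
    show "(\<lambda>z. of_real (2 * pi) powr (- z) * \<phi> z) holomorphic_on D"
      by (intro holomorphic_intros holomorphic_on_subset[OF nicely_meromorphic_holomorphic_off_poles[OF \<phi>(1)]])
         (auto simp: D_def)
    show "z \<in> D" using z by (simp add: D_def)
    fix s assume "s \<in> A"
    then have s: "Re s > \<alpha>" "Re s > 0" "s \<notin> S" by (auto simp: A_def D_def)
    then have "Gamma s \<noteq> 0" by (auto simp: Gamma_eq_zero_iff elim!: nonpos_Ints_cases)
    then show "X s * rGamma s = of_real (2 * pi) powr (- s) * \<phi> s"
      using eq[OF s(1,3)] by (simp add: rGamma_inverse_Gamma)
  qed
qed

lemma reflect_set:
  fixes d :: complex
  assumes "bounded S" "closed S" "connected (- S)"
  shows "bounded ((\<lambda>s. d - s) ` S)" "closed ((\<lambda>s. d - s) ` S)" "connected (- (\<lambda>s. d - s) ` S)"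
    and "- (\<lambda>s. d - s) ` S = (\<lambda>s. d - s) ` (- S)"
proof -
  have bij: "bij (\<lambda>s. d - s)" by (rule bij_betwI[of _ _ _ "\<lambda>s. d - s"]) auto
  show eq: "- (\<lambda>s. d - s) ` S = (\<lambda>s. d - s) ` (- S)" by (rule bij_image_Compl_eq[OF bij, symmetric])
  show "connected (- (\<lambda>s. d - s) ` S)" unfolding eq
    using assms by (intro connected_continuous_image continuous_intros)
  have "compact ((\<lambda>s. d - s) ` S)"
    using assms by (intro compact_continuous_image continuous_intros) (simp add: compact_eq_bounded_closed)
  then show "bounded ((\<lambda>s. d - s) ` S)" "closed ((\<lambda>s. d - s) ` S)"
    by (auto simp: compact_eq_bounded_closed)
qed

text \<open>The companion equation is witnessed by \<open>X (\<delta> - s)\<close>; the two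
  half-planes change places, with bounds \<open>\<delta> - \<beta>\<close> and
  \<open>\<delta> - \<alpha>\<close>.\<close>

lemma hecke_functional_equation_swap:
  assumes "hecke_functional_equation \<delta> S \<phi> \<psi>"
  shows "hecke_functional_equation \<delta> ((\<lambda>s. of_real \<delta> - s) ` S) \<psi> \<phi>"
proof -
  obtain X \<epsilon> \<alpha> \<beta> where S: "bounded S" "closed S" "connected (- S)" and X: "X holomorphic_on - S"
    and \<epsilon>: "0 < \<epsilon>" "\<epsilon> < pi / 2"
    and gr: "\<And>a b. \<exists>T M. \<forall>s. a \<le> Re s \<longrightarrow> Re s \<le> b \<longrightarrow> \<bar>Im s\<bar> \<ge> T \<longrightarrow> norm (X s) * exp (- \<epsilon> * \<bar>Im s\<bar>) \<le> M"
    and 1: "\<And>s. Re s > \<alpha> \<Longrightarrow> s \<notin> S \<Longrightarrow> X s = of_real (2 * pi) powr (- s) * Gamma s * \<phi> s"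
    and 2: "\<And>s. Re s < \<beta> \<Longrightarrow> s \<notin> S \<Longrightarrow> X s = of_real (2 * pi) powr (s - of_real \<delta>)
                      * Gamma (of_real \<delta> - s) * \<psi> (of_real \<delta> - s)"
    using assms unfolding hecke_functional_equation_def by (elim conjE exE) blast
  let ?r = "\<lambda>s. of_real \<delta> - s :: complex"
  have mem: "?r s \<notin> S" if "s \<notin> ?r ` S" for s
    using that image_eqI[of s ?r "?r s" S] by auto
  note R = reflect_set[OF S, of "of_real \<delta>"]
  have hol: "(\<lambda>s. X (?r s)) holomorphic_on - ?r ` S"
    by (intro holomorphic_on_compose_gen[OF _ X, unfolded o_def] holomorphic_intros) (use mem in auto)
  have gr': "\<exists>T M. \<forall>s. a \<le> Re s \<longrightarrow> Re s \<le> b \<longrightarrow> T \<le> \<bar>Im s\<bar> \<longrightarrow> norm (X (?r s)) * exp (- \<epsilon> * \<bar>Im s\<bar>) \<le> M" for a b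
  proof -
    obtain T M where TM: "\<And>s. \<delta> - b \<le> Re s \<Longrightarrow> Re s \<le> \<delta> - a \<Longrightarrow> \<bar>Im s\<bar> \<ge> T \<Longrightarrow> norm (X s) * exp (- \<epsilon> * \<bar>Im s\<bar>) \<le> M"
      using gr[of "\<delta> - b" "\<delta> - a"] by blast
    show ?thesis
      by (rule exI[of _ T], rule exI[of _ M]) (use TM[of "?r s" for s] in auto)
  qed
  have e1: "\<forall>s. \<delta> - \<beta> < Re s \<longrightarrow> s \<notin> ?r ` S \<longrightarrow> X (?r s) = of_real (2 * pi) powr (- s) * Gamma s * \<psi> s"
    using 2[of "?r s" for s] mem by simp
  have e2: "\<forall>s. Re s < \<delta> - \<alpha> \<longrightarrow> s \<notin> ?r ` S \<longrightarrow> X (?r s) = of_real (2 * pi) powr (s - of_real \<delta>) * Gamma (?r s) * \<phi> (?r s)"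
    using 1[of "?r s" for s] mem by simp
  show ?thesis unfolding hecke_functional_equation_def
    by (intro conjI R exI[of _ "\<lambda>s. X (?r s)"] hol)
       (rule exI[of _ \<epsilon>], intro conjI \<epsilon> allI gr', rule exI[of _ "\<delta> - \<beta>"], rule exI[of _ "\<delta> - \<alpha>"],
        intro conjI e1 e2)
qed

lemma Gamma_nonzero_if_Re_pos: "Re z > 0 \<Longrightarrow> Gamma z \<noteq> 0"
  by (auto simp: Gamma_eq_zero_iff elim!: nonpos_Ints_cases)

lemma two_pi_powr_minus:
  "complex_of_real (2 * pi) powr z * complex_of_real (2 * pi) powr (- z) = 1"
  by (simp add: powr_add[symmetric])

text \<open>\<open>S\<close> and the poles enter only through their position in the strip \<open>\<delta> - \<gamma> < Re s < \<gamma>\<close>.  Unlike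
  the assumption that a curve encircles them, this is invariant under \<open>s \<mapsto> \<delta> - s\<close>.\<close>

locale hecke_pair =
  fixes lam mu :: "nat \<Rightarrow> real" and f g :: "nat \<Rightarrow> complex" and \<phi> \<psi> :: "complex \<Rightarrow> complex"
    and \<delta> \<sigma>\<phi> \<sigma>\<psi> \<gamma> :: real and S :: "complex set"
  assumes lam: "multiplicative_frequencies lam" and mu: "multiplicative_frequencies mu"
    and phi: "meromorphic_dirichlet \<phi> f lam \<sigma>\<phi>" and psi: "meromorphic_dirichlet \<psi> g mu \<sigma>\<psi>"
    and functional_equation: "hecke_functional_equation \<delta> S \<phi> \<psi>"
    and phi_poles: "simple_real_poles \<phi>" and psi_poles: "simple_real_poles \<psi>"
    and delta_pos: "\<delta> > 0" and gamma_phi: "\<gamma> > \<sigma>\<phi>" and gamma_psi: "\<gamma> > \<sigma>\<psi>" and gamma_half: "\<gamma> > \<delta> / 2"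
    and S_strip: "\<And>z. z \<in> S \<Longrightarrow> \<delta> - \<gamma> < Re z \<and> Re z < \<gamma>"
    and phi_strip: "\<And>p. is_pole \<phi> p \<Longrightarrow> \<delta> - \<gamma> < Re p"
    and psi_strip: "\<And>p. is_pole \<psi> p \<Longrightarrow> \<delta> - \<gamma> < Re p"
begin

lemma swap: "hecke_pair mu lam g f \<psi> \<phi> \<delta> \<sigma>\<psi> \<sigma>\<phi> \<gamma> ((\<lambda>s. of_real \<delta> - s) ` S)"
  using lam mu phi psi hecke_functional_equation_swap[OF functional_equation] phi_poles psi_poles
    delta_pos gamma_phi gamma_psi gamma_half phi_strip psi_strip S_strip
  by unfold_locales fastforce+

lemma phi_nicely: "\<phi> nicely_meromorphic_on UNIV" and psi_nicely: "\<psi> nicely_meromorphic_on UNIV"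
  using phi psi by (auto simp: meromorphic_dirichlet_def)

lemma phi_finite: "finite {p. is_pole \<phi> p}" and psi_finite: "finite {p. is_pole \<psi> p}"
  using phi_poles psi_poles by (auto simp: simple_real_poles_def)

lemma phi_eq: "Re s > \<sigma>\<phi> \<Longrightarrow> \<phi> s = dirichlet_series f lam s"
  and psi_eq: "Re s > \<sigma>\<psi> \<Longrightarrow> \<psi> s = dirichlet_series g mu s"
  using phi psi by (auto simp: meromorphic_dirichlet_def)

lemma phi_pole_le: "is_pole \<phi> p \<Longrightarrow> Re p \<le> \<sigma>\<phi>" and psi_pole_le: "is_pole \<psi> p \<Longrightarrow> Re p \<le> \<sigma>\<psi>"
  by (rule meromorphic_dirichlet_pole_le[OF lam phi], assumption,
      rule meromorphic_dirichlet_pole_le[OF mu psi], assumption)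

lemma phi_bounded: "\<tau> > \<sigma>\<phi> \<Longrightarrow> \<exists>M. \<forall>s. Re s \<ge> \<tau> \<longrightarrow> norm (\<phi> s) \<le> M"
  by (rule exI, intro allI impI, subst phi_eq)
     (auto intro: norm_dirichlet_series_le[OF lam meromorphic_dirichlet_abs_conv_at[OF lam phi]])

lemma psi_bounded: "\<tau> > \<sigma>\<psi> \<Longrightarrow> \<exists>M. \<forall>s. Re s \<ge> \<tau> \<longrightarrow> norm (\<psi> s) \<le> M"
  by (rule exI, intro allI impI, subst psi_eq)
     (auto intro: norm_dirichlet_series_le[OF mu meromorphic_dirichlet_abs_conv_at[OF mu psi]])

text \<open>One \<open>X\<close> serves both identities; the second is
  \<open>completed_identity\<close> for \<open>X (\<delta> - s)\<close> and \<psi>.\<close>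

lemma completed_function:
  obtains X \<epsilon> where
    "\<And>z. z \<notin> S \<Longrightarrow> \<not> is_pole \<phi> z \<Longrightarrow> X z * rGamma z = of_real (2 * pi) powr (- z) * \<phi> z"
    "\<And>z. z \<notin> S \<Longrightarrow> \<not> is_pole \<psi> (of_real \<delta> - z) \<Longrightarrow>
       X z * rGamma (of_real \<delta> - z) = of_real (2 * pi) powr (z - of_real \<delta>) * \<psi> (of_real \<delta> - z)"
    "\<And>a b. \<exists>T M. \<forall>s. a \<le> Re s \<longrightarrow> Re s \<le> b \<longrightarrow> \<bar>Im s\<bar> \<ge> T \<longrightarrow> norm (X s) \<le> M * exp (\<epsilon> * \<bar>Im s\<bar>)"
    "bounded S"
proof -
  obtain X \<epsilon> \<alpha> \<beta> where S: "bounded S" "closed S" "connected (- S)" and X: "X holomorphic_on - S"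
    and gr: "\<And>a b. \<exists>T M. \<forall>s. a \<le> Re s \<longrightarrow> Re s \<le> b \<longrightarrow> \<bar>Im s\<bar> \<ge> T \<longrightarrow> norm (X s) * exp (- \<epsilon> * \<bar>Im s\<bar>) \<le> M"
    and 1: "\<And>s. Re s > \<alpha> \<Longrightarrow> s \<notin> S \<Longrightarrow> X s = of_real (2 * pi) powr (- s) * Gamma s * \<phi> s"
    and 2: "\<And>s. Re s < \<beta> \<Longrightarrow> s \<notin> S \<Longrightarrow> X s = of_real (2 * pi) powr (s - of_real \<delta>)
                      * Gamma (of_real \<delta> - s) * \<psi> (of_real \<delta> - s)"
    using functional_equation unfolding hecke_functional_equation_def by (elim conjE exE) blast
  let ?r = "\<lambda>s. of_real \<delta> - s :: complex"
  have mem: "?r s \<notin> S" if "s \<notin> ?r ` S" for s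
    using that image_eqI[of s ?r "?r s" S] by auto
  note R = reflect_set[OF S, of "of_real \<delta>"]
  show ?thesis
  proof (rule that[OF _ _ _ S(1)])
    show "X z * rGamma z = of_real (2 * pi) powr (- z) * \<phi> z" if z: "z \<notin> S" "\<not> is_pole \<phi> z" for z
      by (rule completed_identity[OF X S phi_nicely phi_finite _ z]) (rule 1)
  next
    fix z assume z: "z \<notin> S" "\<not> is_pole \<psi> (?r z)"
    have "X (?r (?r z)) * rGamma (?r z) = of_real (2 * pi) powr (- ?r z) * \<psi> (?r z)"
    proof (rule completed_identity[OF _ R(1-3) psi_nicely psi_finite])
      show "(\<lambda>s. X (?r s)) holomorphic_on - ?r ` S"
        by (intro holomorphic_on_compose_gen[OF _ X, unfolded o_def] holomorphic_intros) (use mem in auto)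
      show "X (?r s) = of_real (2 * pi) powr (- s) * Gamma s * \<psi> s" if "\<delta> - \<beta> < Re s" "s \<notin> ?r ` S" for s
        using 2[of "?r s"] mem that by simp
    qed (use z in auto)
    then show "X z * rGamma (?r z) = of_real (2 * pi) powr (z - of_real \<delta>) * \<psi> (?r z)" by simp
  next
    fix a b
    obtain T M where TM: "\<And>s. a \<le> Re s \<Longrightarrow> Re s \<le> b \<Longrightarrow> \<bar>Im s\<bar> \<ge> T \<Longrightarrow> norm (X s) * exp (- \<epsilon> * \<bar>Im s\<bar>) \<le> M"
      using gr[of a b] by blast
    show "\<exists>T M. \<forall>s. a \<le> Re s \<longrightarrow> Re s \<le> b \<longrightarrow> \<bar>Im s\<bar> \<ge> T \<longrightarrow> norm (X s) \<le> M * exp (\<epsilon> * \<bar>Im s\<bar>)"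
      by (rule exI[of _ T], rule exI[of _ M]) (use TM in \<open>auto simp: exp_minus field_simps\<close>)
  qed
qed

text \<open>This line meets neither \<open>S\<close> nor a pole of \<phi>, and
  \<open>Re (\<delta> - z) = \<gamma>\<close> lies beyond the poles of \<psi>. Moreover
  \<open>\<gamma> > \<delta> / 2 > 0\<close>, so \<open>Gamma (\<delta> - z)\<close> is nonzero and
  \<open>X\<close> can be eliminated.\<close>

lemma functional_equation_on_line:
  assumes z: "Re z = \<delta> - \<gamma>"
  shows "\<phi> z = of_real (2 * pi) powr (2 * z - of_real \<delta>) * rGamma z * Gamma (of_real \<delta> - z) * \<psi> (of_real \<delta> - z)"
proof -
  obtain X \<epsilon> where
    1: "\<And>z. z \<notin> S \<Longrightarrow> \<not> is_pole \<phi> z \<Longrightarrow> X z * rGamma z = of_real (2 * pi) powr (- z) * \<phi> z" and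
    2: "\<And>z. z \<notin> S \<Longrightarrow> \<not> is_pole \<psi> (of_real \<delta> - z) \<Longrightarrow>
       X z * rGamma (of_real \<delta> - z) = of_real (2 * pi) powr (z - of_real \<delta>) * \<psi> (of_real \<delta> - z)"
    using completed_function by metis
  have zS: "z \<notin> S" using S_strip[of z] z by auto
  have zp: "\<not> is_pole \<phi> z" using phi_strip[of z] z by auto
  have zq: "\<not> is_pole \<psi> (of_real \<delta> - z)" using psi_pole_le[of "of_real \<delta> - z"] z gamma_psi by auto
  have "Re (of_real \<delta> - z) > 0" using z gamma_half delta_pos by simp
  then have "Gamma (of_real \<delta> - z) \<noteq> 0" by (rule Gamma_nonzero_if_Re_pos)
  then have X: "X z = of_real (2 * pi) powr (z - of_real \<delta>) * \<psi> (of_real \<delta> - z) * Gamma (of_real \<delta> - z)"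
    using 2[OF zS zq] by (simp add: rGamma_inverse_Gamma field_simps)
  have "\<phi> z = of_real (2 * pi) powr z * (of_real (2 * pi) powr (- z) * \<phi> z)"
    by (simp only: mult.assoc[symmetric] two_pi_powr_minus mult_1)
  also have "\<dots> = of_real (2 * pi) powr z * (X z * rGamma z)" by (simp only: 1[OF zS zp])
  also have "\<dots> = of_real (2 * pi) powr z * of_real (2 * pi) powr (z - of_real \<delta>) * rGamma z *
      Gamma (of_real \<delta> - z) * \<psi> (of_real \<delta> - z)"
    by (simp add: X mult_ac)
  also have "of_real (2 * pi) powr z * of_real (2 * pi) powr (z - of_real \<delta>) = of_real (2 * pi) powr (2 * z - of_real \<delta>)"
    by (simp add: powr_add[symmetric])
  finally show ?thesis .
qed

text \<open>Above \<open>S\<close> and all poles, \<phi> is \<open>X\<close> times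
  \<open>rGamma\<close> up to a power of \<open>2 * pi\<close>, and both are of exponential growth.
  No better bound inside the strip is at hand, nor is one needed for Phragmen-Lindelof.\<close>

lemma phi_growth:
  "\<exists>M A T. \<forall>s. a \<le> Re s \<longrightarrow> Re s \<le> b \<longrightarrow> T \<le> \<bar>Im s\<bar> \<longrightarrow> norm (\<phi> s) \<le> M * exp (A * \<bar>Im s\<bar>)"
proof -
  obtain X \<epsilon> where
    1: "\<And>z. z \<notin> S \<Longrightarrow> \<not> is_pole \<phi> z \<Longrightarrow> X z * rGamma z = of_real (2 * pi) powr (- z) * \<phi> z" and
    gr: "\<And>a b. \<exists>T M. \<forall>s. a \<le> Re s \<longrightarrow> Re s \<le> b \<longrightarrow> \<bar>Im s\<bar> \<ge> T \<longrightarrow> norm (X s) \<le> M * exp (\<epsilon> * \<bar>Im s\<bar>)" and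
    bS: "bounded S"
    using completed_function by metis
  obtain T M where TM: "\<And>s. a \<le> Re s \<Longrightarrow> Re s \<le> b \<Longrightarrow> \<bar>Im s\<bar> \<ge> T \<Longrightarrow> norm (X s) \<le> M * exp (\<epsilon> * \<bar>Im s\<bar>)"
    using gr[of a b] by blast
  obtain M' where M': "M' > 0" "\<And>s. a \<le> Re s \<Longrightarrow> Re s \<le> b \<Longrightarrow> 1 \<le> \<bar>Im s\<bar> \<Longrightarrow> norm (rGamma s) \<le> M' * exp (pi * \<bar>Im s\<bar>)"
    using rGamma_vertical_growth[of a b] by metis
  have "bounded (S \<union> {p. is_pole \<phi> p})" using bS phi_finite by (simp add: finite_imp_bounded)
  then obtain B where B: "\<And>s. s \<in> S \<or> is_pole \<phi> s \<Longrightarrow> norm s \<le> B" by (auto simp: bounded_iff)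
  define P where "P = (2 * pi) powr b"
  show ?thesis
  proof (rule exI[of _ "P * \<bar>M\<bar> * M'"], rule exI[of _ "\<epsilon> + pi"], rule exI[of _ "max (max T 1) (B + 1)"],
      intro allI impI)
    fix s assume s: "a \<le> Re s" "Re s \<le> b" "max (max T 1) (B + 1) \<le> \<bar>Im s\<bar>"
    have "norm s > B" using abs_Im_le_cmod[of s] s by auto
    then have s': "s \<notin> S" "\<not> is_pole \<phi> s" using B[of s] by auto
    have "norm (\<phi> s) = norm (of_real (2 * pi) powr s * (of_real (2 * pi) powr (- s) * \<phi> s))"
      by (simp only: mult.assoc[symmetric] two_pi_powr_minus mult_1)
    also have "\<dots> = norm (of_real (2 * pi) powr s) * (norm (X s) * norm (rGamma s))"
      by (simp only: 1[OF s', symmetric] norm_mult)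
    also have "\<dots> \<le> P * ((\<bar>M\<bar> * exp (\<epsilon> * \<bar>Im s\<bar>)) * (M' * exp (pi * \<bar>Im s\<bar>)))"
    proof (intro mult_mono)
      have "(2 * pi) powr Re s \<le> P" unfolding P_def using s pi_gt3 by (intro powr_mono) auto
      then show "norm (of_real (2 * pi) powr s) \<le> P" by (simp add: norm_powr_real_powr)
      have "norm (X s) \<le> M * exp (\<epsilon> * \<bar>Im s\<bar>)" using s by (intro TM) auto
      also have "\<dots> \<le> \<bar>M\<bar> * exp (\<epsilon> * \<bar>Im s\<bar>)" by (intro mult_right_mono) auto
      finally show "norm (X s) \<le> \<bar>M\<bar> * exp (\<epsilon> * \<bar>Im s\<bar>)" .
      show "norm (rGamma s) \<le> M' * exp (pi * \<bar>Im s\<bar>)" using s by (intro M') auto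
    qed (auto simp: P_def)
    also have "\<dots> = P * \<bar>M\<bar> * M' * exp ((\<epsilon> + pi) * \<bar>Im s\<bar>)"
      by (simp add: distrib_right exp_add)
    finally show "norm (\<phi> s) \<le> P * \<bar>M\<bar> * M' * exp ((\<epsilon> + pi) * \<bar>Im s\<bar>)" .
  qed
qed

end

section \<open>The Riesz mean formula\<close>

text \<open>Meant for the Meijer integrand. \<open>Gamma\<close> takes the value 0 at its poles, so
  at the one point of the line where its argument is real the quotient of two Gamma values can be
  \<open>0 / 0\<close> and differ from the reciprocal Pochhammer symbol.\<close>

lemma lborel_integral_cong_except_point:
  fixes h h' :: "real \<Rightarrow> complex"
  assumes h: "h \<in> borel_measurable borel" and eq: "\<And>t. t \<noteq> t0 \<Longrightarrow> h' t = h t"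
  shows "integral\<^sup>L lborel h' = integral\<^sup>L lborel h"
proof (rule integral_cong_AE)
  have "h' = (\<lambda>t. if t = t0 then h' t0 else h t)" using eq by auto
  also have "\<dots> \<in> borel_measurable borel" using h by measurable
  finally show "h' \<in> borel_measurable lborel" by simp
  show "AE t in lborel. h' t = h t"
    using AE_lborel_singleton[of t0] by eventually_elim (rule eq)
qed (use h in simp)

lemma norm_pochhammer_ge_half_Im:
  assumes "\<bar>Im z\<bar> \<ge> 2 * \<bar>Im u\<bar>"
  shows "(\<bar>Im z\<bar> / 2) ^ n \<le> norm (pochhammer (z - u) n)"
proof -
  have "\<bar>Im z\<bar> / 2 \<le> \<bar>Im (z - u)\<bar>" using assms unfolding minus_complex.sel by linarith
  then have "(\<bar>Im z\<bar> / 2) ^ n \<le> \<bar>Im (z - u)\<bar> ^ n" by (intro power_mono) auto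
  also have "\<dots> \<le> norm (pochhammer (z - u) n)" by (rule norm_pochhammer_ge_Im)
  finally show ?thesis .
qed

lemma of_real_powr_eq_exp: "a > 0 \<Longrightarrow> complex_of_real a powr w = exp (w * of_real (ln a))"
  by (simp add: powr_def Ln_of_real)

text \<open>The condition \<open>u_line\<close> says that no kernel pole \<open>u - j\<close> lies
  on the left line \<open>Re z = \<delta> - \<gamma>\<close>.\<close>

locale hecke_uv = hecke_pair +
  fixes u v :: complex and k :: nat
  assumes k_gt: "real k > 2 * \<gamma> - \<delta>" and u_gt: "Re u > \<sigma>\<phi>" and v_gt: "Re v > \<sigma>\<psi>"
    and uv_phi: "Re u + Re v - \<gamma> > \<sigma>\<phi>" and uv_psi: "Re u + Re v - \<gamma> > \<sigma>\<psi>"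
    and u_line: "\<And>j. j \<le> k \<Longrightarrow> \<delta> - Re u + real j \<noteq> \<gamma>"
begin

lemma k_ge_1: "k \<ge> 1"
  using k_gt gamma_half by (cases k) auto

text \<open>The midpoint of the interval allowed for the right line: beyond \<gamma>, hence beyond
  the poles of \<phi> and inside absolute convergence of \<open>f\<close>; beyond
  \<open>Re u\<close>, for Perron's formula; and so that
  \<open>Re (v + u - z) > \<sigma>\<psi>\<close>. The interval is nonempty by \<open>uv_psi\<close>
  and \<open>v_gt\<close>.\<close>

definition c :: real where "c = (max \<gamma> (Re u) + (Re u + Re v - \<sigma>\<psi>)) / 2"

lemma c: "\<gamma> < c" "Re u < c" "c < Re u + Re v - \<sigma>\<psi>" "\<delta> - \<gamma> < c"
  using uv_psi v_gt gamma_half by (auto simp: c_def)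

definition Phi :: "complex \<Rightarrow> complex" where "Phi z = \<phi> z * \<psi> (v + u - z)"

definition J :: "real \<Rightarrow> complex \<Rightarrow> complex" where
  "J x z = Phi z * (of_real x powr (z - u + of_nat k) / pochhammer (z - u) (Suc k))"

definition pts :: "complex set" where "pts = {p. is_pole \<phi> p} \<union> (\<lambda>j. u - of_nat j) ` {..k}"

text \<open>In this half-plane \<open>Re (v + u - z) > \<sigma>\<psi>\<close>, so the factor \<psi>
  of \<open>Phi\<close> has no poles and only the finite set \<open>pts\<close> remains.\<close>

definition H :: "complex set" where "H = {z. Re z < Re u + Re v - \<sigma>\<psi>}"

definition D :: "real \<Rightarrow> complex" where
  "D x = (\<Sum>n. g (Suc n) / of_real (mu (Suc n)) powr (v + of_nat k) * riesz_sum k f lam u (mu (Suc n) * x))"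

text \<open>The integrand of the left line in the variable \<open>s = \<delta> - z\<close>, stripped
  of its Dirichlet series: the factor from the functional equation times the kernel.\<close>

definition h :: "real \<Rightarrow> real \<Rightarrow> complex" where
  "h x t = (let s = Complex \<gamma> t in of_real (2 * pi) powr (of_real \<delta> - 2 * s) * rGamma (of_real \<delta> - s) * Gamma s
     * of_real x powr (of_real \<delta> - s - u + of_nat k) / pochhammer (of_real \<delta> - s - u) (Suc k))"

abbreviation tw :: "nat \<Rightarrow> complex" where "tw \<equiv> twisted_convolution g mu (of_real \<delta> - u - v)"

lemma finite_pts: "finite pts" using phi_finite by (simp add: pts_def)

lemma open_H: "open H" and convex_H: "convex H"
  unfolding H_def by (rule open_halfspace_Re_lt, rule convex_halfspace_Re_lt)

lemma pts_Re: "p \<in> pts \<Longrightarrow> Re p \<noteq> \<delta> - \<gamma> \<and> Re p < c"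
proof -
  assume "p \<in> pts"
  then consider "is_pole \<phi> p" | j where "j \<le> k" "p = u - of_nat j" by (auto simp: pts_def)
  then show ?thesis
  proof cases
    case 1
    then show ?thesis using phi_strip[of p] phi_pole_le[of p] gamma_phi c by auto
  next
    case 2
    then show ?thesis using u_line[of j] c by auto
  qed
qed

lemma Phi_holomorphic: "Phi holomorphic_on H - {p. is_pole \<phi> p}"
  unfolding Phi_def
proof (intro holomorphic_on_mult)
  show "\<phi> holomorphic_on H - {p. is_pole \<phi> p}"
    by (rule holomorphic_on_subset[OF nicely_meromorphic_holomorphic_off_poles[OF phi_nicely]]) auto
  have "\<not> is_pole \<psi> (v + u - z)" if "z \<in> H" for z
    using psi_pole_le[of "v + u - z"] that by (auto simp: H_def)
  then show "(\<lambda>z. \<psi> (v + u - z)) holomorphic_on H - {p. is_pole \<phi> p}"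
    by (intro holomorphic_on_compose_gen[OF _ nicely_meromorphic_holomorphic_off_poles[OF psi_nicely], unfolded o_def]
          holomorphic_intros) auto
qed

lemma poch_nz: "z \<notin> pts \<Longrightarrow> j \<le> k \<Longrightarrow> pochhammer (z - u) (Suc j) \<noteq> 0"
  unfolding pochhammer_eq_0_iff by (auto simp: pts_def algebra_simps image_iff less_Suc_eq_le)

lemma J_holomorphic: "x > 0 \<Longrightarrow> J x holomorphic_on H - pts"
  unfolding J_def using poch_nz[of _ k]
  by (intro holomorphic_intros holomorphic_on_subset[OF Phi_holomorphic]) (auto simp: pts_def)

lemma abs_conv_phi: "\<tau> > \<sigma>\<phi> \<Longrightarrow> abs_conv_at f lam \<tau>"
  by (rule meromorphic_dirichlet_abs_conv_at[OF lam phi])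

lemma abs_conv_psi: "\<tau> > \<sigma>\<psi> \<Longrightarrow> abs_conv_at g mu \<tau>"
  by (rule meromorphic_dirichlet_abs_conv_at[OF mu psi])

lemma right_line:
  assumes x: "x > 0"
  shows "integrable lborel (\<lambda>t. J x (Complex c t))"
    and "(LINT t|lborel. J x (Complex c t)) = 2 * of_real pi / fact k * D x"
proof -
  have eq: "J x (Complex c t) = dirichlet_series f lam (Complex c t) * dirichlet_series g mu (v + u - Complex c t)
      * of_real x powr (Complex c t - u + of_nat k) / pochhammer (Complex c t - u) (Suc k)" for t
    using phi_eq[of "Complex c t"] psi_eq[of "v + u - Complex c t"] c gamma_phi by (simp add: J_def Phi_def)
  have "abs_conv_at f lam c" "abs_conv_at g mu (Re u + Re v - c)"
    using c gamma_phi by (auto intro!: abs_conv_phi abs_conv_psi)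
  note * = double_riesz_sum_eq_integral[OF lam mu this c(2) k_ge_1 x]
  show "integrable lborel (\<lambda>t. J x (Complex c t))"
    unfolding eq by (rule *(1))
  show "(LINT t|lborel. J x (Complex c t)) = 2 * of_real pi / fact k * D x"
    unfolding eq D_def by (rule *(2))
qed

text \<open>The quotient \<open>Gamma s / Gamma (\<delta> - s)\<close> is a shift by
  \<open>a = 2 \<gamma> - \<delta>\<close> up to conjugation and contributes the power
  \<open>a\<close> of \<open>|t|\<close>; the kernel contributes the power \<open>- (k + 1)\<close>.
  The total is integrable because \<open>k > 2 \<gamma> - \<delta>\<close>.\<close>

lemma h_bound:
  assumes x: "x > 0"
  obtains B where "B \<ge> 0" "\<And>t. \<bar>t\<bar> \<ge> max 1 (2 * \<bar>Im u\<bar>) \<Longrightarrow> norm (h x t) \<le> B * \<bar>t\<bar> powr - (real (Suc k) - (2 * \<gamma> - \<delta>))"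
proof -
  define a where "a = 2 * \<gamma> - \<delta>"
  have a0: "a \<ge> 0" using gamma_half by (simp add: a_def)
  obtain K where K: "K > 0" "\<And>t. \<bar>t\<bar> \<ge> 1 \<Longrightarrow>
      norm (Gamma (Complex (\<delta> - \<gamma> + a) t)) \<le> K * \<bar>t\<bar> powr a * norm (Gamma (Complex (\<delta> - \<gamma>) t))"
    using Gamma_vertical_upper[OF a0] by metis
  define P where "P = (2 * pi) powr (\<delta> - 2 * \<gamma>)"
  define Q where "Q = x powr (\<delta> - \<gamma> - Re u + real k)"
  have "norm (h x t) \<le> P * K * Q * 2 ^ Suc k * \<bar>t\<bar> powr - (real (Suc k) - a)"
    if t: "\<bar>t\<bar> \<ge> max 1 (2 * \<bar>Im u\<bar>)" for t
  proof -
    define s where "s = Complex \<gamma> t"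
    \<comment> \<open>The two Gamma arguments lie at opposite heights; conjugation brings them to
      the same height without changing the modulus.\<close>
    have "of_real \<delta> - s = cnj (Complex (\<delta> - \<gamma>) t)" by (simp add: s_def complex_eq_iff)
    then have "norm (rGamma (of_real \<delta> - s)) = inverse (norm (Gamma (Complex (\<delta> - \<gamma>) t)))"
      by (simp add: rGamma_inverse_Gamma cnj_Gamma[symmetric] norm_inverse)
    moreover have "norm (Gamma s) \<le> K * \<bar>t\<bar> powr a * norm (Gamma (Complex (\<delta> - \<gamma>) t))"
      using K(2)[of t] t by (simp add: s_def a_def)
    ultimately have "norm (rGamma (of_real \<delta> - s)) * norm (Gamma s)
        \<le> inverse (norm (Gamma (Complex (\<delta> - \<gamma>) t))) * (K * \<bar>t\<bar> powr a * norm (Gamma (Complex (\<delta> - \<gamma>) t)))"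
      by (simp add: mult_left_mono)
    also have "\<dots> \<le> K * \<bar>t\<bar> powr a"
    proof -
      have "inverse n * (B * n) \<le> B" if "n \<ge> 0" "B \<ge> 0" for n B :: real
        using that by (cases "n = 0") (auto simp: field_simps)
      then show ?thesis using K(1) by simp
    qed
    finally have G: "norm (rGamma (of_real \<delta> - s)) * norm (Gamma s) \<le> K * \<bar>t\<bar> powr a" .
    have nP: "norm (of_real (2 * pi) powr (of_real \<delta> - 2 * s)) = P"
      unfolding P_def by (subst norm_powr_real_powr) (auto simp: s_def)
    have nQ: "norm (of_real x powr (of_real \<delta> - s - u + of_nat k)) = Q"
      unfolding Q_def using x by (subst norm_powr_real_powr) (auto simp: s_def)
    have poch: "(\<bar>t\<bar> / 2) ^ Suc k \<le> norm (pochhammer (of_real \<delta> - s - u) (Suc k))"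
      using norm_pochhammer_ge_half_Im[of u "of_real \<delta> - s" "Suc k"] t by (simp add: s_def)
    have t2: "(\<bar>t\<bar> / 2) ^ Suc k > 0" using t by (intro zero_less_power) auto
    have "norm (h x t) = P * (norm (rGamma (of_real \<delta> - s)) * norm (Gamma s)) * Q
        / norm (pochhammer (of_real \<delta> - s - u) (Suc k))"
      unfolding h_def Let_def s_def[symmetric] norm_divide norm_mult nP nQ by (simp only: mult.assoc)
    also have "\<dots> \<le> P * (K * \<bar>t\<bar> powr a) * Q / (\<bar>t\<bar> / 2) ^ Suc k"
    proof (rule frac_le[OF _ _ t2 poch])
      show "P * (norm (rGamma (of_real \<delta> - s)) * norm (Gamma s)) * Q \<le> P * (K * \<bar>t\<bar> powr a) * Q"
        by (intro mult_right_mono mult_left_mono G) (auto simp: P_def Q_def)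
      show "0 \<le> P * (K * \<bar>t\<bar> powr a) * Q"
        using K(1) by (simp add: P_def Q_def)
    qed
    also have "\<dots> = P * K * Q * 2 ^ Suc k * (\<bar>t\<bar> powr a / \<bar>t\<bar> ^ Suc k)"
      by (simp add: power_divide del: power_Suc)
    also have "\<bar>t\<bar> powr a / \<bar>t\<bar> ^ Suc k = \<bar>t\<bar> powr - (real (Suc k) - a)"
      using t by (subst powr_realpow[symmetric]) (auto simp: powr_diff[symmetric])
    finally show ?thesis .
  qed
  moreover have "P * K * Q * 2 ^ Suc k \<ge> 0" using K(1) by (simp add: P_def Q_def)
  ultimately show ?thesis using that unfolding a_def by blast
qed

lemma exponent_gt_1: "real (Suc k) - (2 * \<gamma> - \<delta>) > 1"
  using k_gt by simp

lemma h_integrable: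
  assumes x: "x > 0"
  shows "integrable lborel (h x)"
proof -
  obtain B where B: "\<And>t. \<bar>t\<bar> \<ge> max 1 (2 * \<bar>Im u\<bar>) \<Longrightarrow> norm (h x t) \<le> B * \<bar>t\<bar> powr - (real (Suc k) - (2 * \<gamma> - \<delta>))"
    using h_bound[OF x] by metis
  have cC: "continuous_on UNIV (\<lambda>t. Complex \<gamma> t)" unfolding Complex_eq by (intro continuous_intros)
  have nz: "pochhammer (of_real \<delta> - Complex \<gamma> t - u) (Suc k) \<noteq> 0" for t
  proof (rule poch_nz)
    show "of_real \<delta> - Complex \<gamma> t \<notin> pts" using pts_Re[of "of_real \<delta> - Complex \<gamma> t"] by auto
  qed simp
  have G: "continuous_on UNIV (\<lambda>t. Gamma (Complex \<gamma> t))"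
  proof (rule continuous_on_compose2[OF continuous_on_Gamma cC])
    show "{s. Re s > 0} \<inter> \<int>\<^sub>\<le>\<^sub>0 = {}" by (auto elim!: nonpos_Ints_cases)
    show "range (Complex \<gamma>) \<subseteq> {s. Re s > 0}" using gamma_half delta_pos by auto
  qed
  have R: "continuous_on UNIV (\<lambda>t. rGamma (of_real \<delta> - Complex \<gamma> t))"
    by (rule continuous_on_compose2[OF continuous_on_rGamma[of UNIV]]) (intro continuous_intros cC, simp)
  have "continuous_on UNIV (h x)"
    unfolding h_def Let_def using nz x unfolding pochhammer_prod
    by (intro continuous_intros G R cC) auto
  then show ?thesis
    by (rule integrable_lborel_decay'[OF _ exponent_gt_1 B])
qed

text \<open>The twist comes from \<open>v + u - z = s - (\<delta> - u - v)\<close> for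
  \<open>z = \<delta> - s\<close>. On \<open>Re s = \<gamma>\<close> this argument has real part
  \<open>(Re u + Re v - \<gamma>) + (2 \<gamma> - \<delta>)\<close>, which exceeds
  \<sigma>\<psi>.\<close>

lemma tw_abs_conv: "abs_conv_at tw mu \<gamma>"
  and tw_series: "Re s = \<gamma> \<Longrightarrow> dirichlet_series tw mu s = \<psi> s * \<psi> (s - (of_real \<delta> - u - v))"
proof -
  have conv: "abs_conv_at g mu (Re s)" "abs_conv_at g mu (Re (s - (of_real \<delta> - u - v)))"
    and gt: "\<sigma>\<psi> < Re s" "\<sigma>\<psi> < Re (s - (of_real \<delta> - u - v))" if "Re s = \<gamma>" for s
    using that gamma_psi uv_psi gamma_half by (auto intro!: abs_conv_psi)
  show "abs_conv_at tw mu \<gamma>"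
    using dirichlet_series_mult(1)[OF mu conv, of "of_real \<gamma>"] by simp
  show "dirichlet_series tw mu s = \<psi> s * \<psi> (s - (of_real \<delta> - u - v))" if "Re s = \<gamma>"
    using dirichlet_series_mult(2)[OF mu conv[OF that]] psi_eq[OF gt(1)[OF that]] psi_eq[OF gt(2)[OF that]]
    by simp
qed

text \<open>The sign of \<open>t\<close> changes because \<open>s = \<delta> - z\<close> reverses
  the direction of the line.\<close>

lemma J_left: "J x (Complex (\<delta> - \<gamma>) (- t)) = h x t * dirichlet_series tw mu (Complex \<gamma> t)"
proof -
  define s where "s = Complex \<gamma> t"
  have z: "Complex (\<delta> - \<gamma>) (- t) = of_real \<delta> - s" by (simp add: s_def complex_eq_iff)
  have Re: "Re s = \<gamma>" by (simp add: s_def)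
  have "\<phi> (of_real \<delta> - s) = of_real (2 * pi) powr (of_real \<delta> - 2 * s) * rGamma (of_real \<delta> - s) * Gamma s * \<psi> s"
    using functional_equation_on_line[of "of_real \<delta> - s"] Re by (simp add: algebra_simps)
  moreover have e: "v + u - (of_real \<delta> - s) = s - (of_real \<delta> - u - v)" by simp
  ultimately show ?thesis
    unfolding z s_def[symmetric] J_def Phi_def h_def Let_def tw_series[OF Re] e by (simp add: mult_ac)
qed

text \<open>The power of the Meijer argument splits into \<open>(2 * pi) powr (- 2 * s)\<close>, the
  power needed to complete that of \<open>x\<close>, and \<open>L powr (- s)\<close>. The factor
  \<open>1 / (2 * pi * \<i>)\<close> loses its \<open>\<i>\<close> against
  \<open>ds = \<i> dt\<close>.\<close>

lemma meijer_integral: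
  assumes x: "x > 0" and L: "L > 0"
  shows "of_real ((2 * pi) powr \<delta>) * of_real x powr (of_real \<delta> - u + of_nat k)
      * meijer_G \<gamma> (of_real \<delta> - u + of_nat k + 1) (of_real \<delta>) (of_real \<delta> - u) (of_real (1 / (4 * pi\<^sup>2 * L * x)))
    = 1 / (2 * of_real pi) * (LINT t|lborel. h x t * of_real L powr (- Complex \<gamma> t))"
proof -
  define M where "M t = (let s = Complex \<gamma> t in Gamma (of_real \<delta> - u - s) * Gamma s /
      (Gamma (of_real \<delta> - u + of_nat k + 1 - s) * Gamma (of_real \<delta> - s)) * of_real (1 / (4 * pi\<^sup>2 * L * x)) powr s)" for t
  define A where "A = of_real ((2 * pi) powr \<delta>) * of_real x powr (of_real \<delta> - u + of_nat k)"
  have meas: "(\<lambda>t. h x t * of_real L powr (- Complex \<gamma> t)) \<in> borel_measurable borel"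
  proof -
    have "continuous_on UNIV (\<lambda>t. of_real L powr (- Complex \<gamma> t))"
      unfolding Complex_eq using L by (intro continuous_intros) auto
    then have "(\<lambda>t. of_real L powr (- Complex \<gamma> t)) \<in> borel_measurable borel"
      by (rule borel_measurable_continuous_onI)
    moreover have "h x \<in> borel_measurable borel" using h_integrable[OF x] by auto
    ultimately show ?thesis by (rule borel_measurable_times[rotated])
  qed
  have eq: "A * M t = h x t * of_real L powr (- Complex \<gamma> t)" if t: "t \<noteq> - Im u" for t
  proof -
    define s where "s = Complex \<gamma> t"
    define w where "w = of_real \<delta> - s - u"
    have "Im w \<noteq> 0" using t by (auto simp: w_def s_def)
    then have w: "w \<notin> \<int>\<^sub>\<le>\<^sub>0" by (rule not_nonpos_Int_if_Im)
    have "Gamma w / Gamma (w + of_nat (Suc k)) = 1 / pochhammer w (Suc k)"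
      using pochhammer_Gamma[OF w, of "Suc k"] by simp
    then have G: "Gamma (of_real \<delta> - u - s) / Gamma (of_real \<delta> - u + of_nat k + 1 - s) = 1 / pochhammer w (Suc k)"
      by (simp add: w_def algebra_simps)
    have pos: "4 * pi\<^sup>2 * L * x > 0" using x L by simp
    have ln: "ln (1 / (4 * pi\<^sup>2 * L * x)) = - (2 * ln (2 * pi) + ln L + ln x)"
    proof -
      have "4 * pi\<^sup>2 * L * x = (2 * pi)\<^sup>2 * (L * x)" by (simp add: power_mult_distrib)
      then have "ln (4 * pi\<^sup>2 * L * x) = ln ((2 * pi)\<^sup>2) + (ln L + ln x)"
        using x L by (simp add: ln_mult_pos)
      moreover have "ln ((2 * pi)\<^sup>2) = 2 * ln (2 * pi)" by (subst ln_realpow) auto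
      moreover have "ln (1 / q) = - ln q" if "q > 0" for q :: real using that by (simp add: ln_div)
      ultimately show ?thesis using pos by simp
    qed
    have E: "A * of_real (1 / (4 * pi\<^sup>2 * L * x)) powr s
        = of_real (2 * pi) powr (of_real \<delta> - 2 * s) * of_real x powr (w + of_nat k) * of_real L powr (- s)"
    proof -
      have "complex_of_real ((2 * pi) powr \<delta>) = exp (of_real \<delta> * of_real (ln (2 * pi)))"
        by (simp add: powr_def exp_of_real[symmetric])
      moreover have "complex_of_real x powr q = exp (q * of_real (ln x))" for q
        using x by (rule of_real_powr_eq_exp)
      moreover have "complex_of_real L powr q = exp (q * of_real (ln L))" for q
        using L by (rule of_real_powr_eq_exp)
      moreover have "complex_of_real (2 * pi) powr q = exp (q * of_real (ln (2 * pi)))" for q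
        by (rule of_real_powr_eq_exp) simp
      moreover have "complex_of_real (1 / (4 * pi\<^sup>2 * L * x)) powr s = exp (s * of_real (ln (1 / (4 * pi\<^sup>2 * L * x))))"
        using pos by (intro of_real_powr_eq_exp) simp
      ultimately show ?thesis
        unfolding A_def ln by (simp only: exp_add[symmetric] w_def) (simp add: algebra_simps)
    qed
    have "A * M t = A * of_real (1 / (4 * pi\<^sup>2 * L * x)) powr s
        * (Gamma (of_real \<delta> - u - s) / Gamma (of_real \<delta> - u + of_nat k + 1 - s)) * (Gamma s * rGamma (of_real \<delta> - s))"
    proof -
      have "A * (a * b / (d * e) * z) = A * z * (a / d) * (b * inverse e)" for a b d e z :: complex
        by (simp add: divide_inverse mult_ac)
      then show ?thesis unfolding M_def Let_def s_def[symmetric] rGamma_inverse_Gamma .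
    qed
    also have "\<dots> = h x t * of_real L powr (- s)"
    proof -
      have "p * y * l * (1 / q) * (a * b) = p * b * a * y / q * l" for a b p q y l :: complex
        by (simp add: divide_inverse mult_ac)
      then show ?thesis unfolding G E h_def Let_def s_def[symmetric] w_def[symmetric] .
    qed
    finally show ?thesis unfolding s_def .
  qed
  have "A * meijer_G \<gamma> (of_real \<delta> - u + of_nat k + 1) (of_real \<delta>) (of_real \<delta> - u) (of_real (1 / (4 * pi\<^sup>2 * L * x)))
      = A * (1 / (2 * of_real pi * \<i>) * (LINT t|lborel. M t * \<i>))"
    unfolding meijer_G_def M_def Let_def ..
  also have "\<dots> = 1 / (2 * of_real pi) * (LINT t|lborel. A * M t)"
    by simp
  also have "(LINT t|lborel. A * M t) = (LINT t|lborel. h x t * of_real L powr (- Complex \<gamma> t))"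
    using lborel_integral_cong_except_point[OF meas eq] .
  finally show ?thesis by (simp add: A_def)
qed

lemma left_line:
  assumes x: "x > 0"
  shows "integrable lborel (\<lambda>t. J x (Complex (\<delta> - \<gamma>) t))"
    and "(LINT t|lborel. J x (Complex (\<delta> - \<gamma>) t)) = 2 * of_real pi * G_series \<gamma> \<delta> k g mu u v x"
proof -
  let ?F = "\<lambda>t. J x (Complex (\<delta> - \<gamma>) t)"
  have cC: "continuous_on UNIV (\<lambda>t. Complex \<gamma> t)" unfolding Complex_eq by (intro continuous_intros)
  note ex = dirichlet_series_integral[OF mu tw_abs_conv h_integrable[OF x] cC complex.sel(1)]
  have "integrable lborel (\<lambda>t. ?F (0 + (-1) * t))"
    using ex(1) by (simp add: J_left)
  then show "integrable lborel ?F"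
    by (rule lborel_integrable_real_affine_iff[THEN iffD1, rotated]) simp
  have "integral\<^sup>L lborel ?F = (LINT t|lborel. ?F (0 + (-1) * t))"
    using lborel_integral_real_affine[of "-1" ?F 0] by simp
  also have "\<dots> = (LINT t|lborel. h x t * dirichlet_series tw mu (Complex \<gamma> t))"
    by (simp add: J_left)
  finally have I: "integral\<^sup>L lborel ?F = \<dots>" .
  define T where "T n = tw (Suc n) * of_real x powr (of_real \<delta> - u + of_nat k)
      * meijer_G \<gamma> (of_real \<delta> - u + of_nat k + 1) (of_real \<delta>) (of_real \<delta> - u) (of_real (1 / (4 * pi\<^sup>2 * mu (Suc n) * x)))" for n
  have T: "2 * of_real pi * of_real ((2 * pi) powr \<delta>) * T n
      = tw (Suc n) * (LINT t|lborel. h x t * of_real (mu (Suc n)) powr (- Complex \<gamma> t))" for n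
  proof -
    have "mu (Suc n) > 0" using mult_freq_pos[OF mu] by simp
    from meijer_integral[OF x this] show ?thesis
      unfolding T_def by (simp add: field_simps)
  qed
  have *: "(\<lambda>n. 2 * of_real pi * of_real ((2 * pi) powr \<delta>) * T n) sums integral\<^sup>L lborel ?F"
    unfolding T I by (rule ex(2))
  have nz: "2 * of_real pi * of_real ((2 * pi) powr \<delta>) \<noteq> (0::complex)" by simp
  have "summable T"
    using sums_summable[OF *] nz by (subst (asm) summable_cmult_iff) auto
  then have "integral\<^sup>L lborel ?F = 2 * of_real pi * of_real ((2 * pi) powr \<delta>) * (\<Sum>n. T n)"
    using sums_unique[OF *] by (simp add: suminf_mult)
  then show "integral\<^sup>L lborel ?F = 2 * of_real pi * G_series \<gamma> \<delta> k g mu u v x"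
    unfolding G_series_def T_def by (simp add: mult.assoc)
qed

text \<open>On the left side \<open>J\<close> is \<open>h\<close> times a bounded series, on the
  right side both factors of \<open>Phi\<close> are bounded and the kernel decays. Between them only
  exponential growth is known, and \<open>strip_decay\<close> interpolates.\<close>

lemma J_decay:
  assumes x: "x > 0" and e: "e > 0"
  shows "\<exists>T. \<forall>s. \<delta> - \<gamma> \<le> Re s \<longrightarrow> Re s \<le> c \<longrightarrow> T \<le> \<bar>Im s\<bar> \<longrightarrow> norm (J x s) \<le> e"
proof -
  obtain M1 A T1 where phi_gr: "\<And>s. \<delta> - \<gamma> \<le> Re s \<Longrightarrow> Re s \<le> c \<Longrightarrow> T1 \<le> \<bar>Im s\<bar> \<Longrightarrow> norm (\<phi> s) \<le> M1 * exp (A * \<bar>Im s\<bar>)"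
    using phi_growth[of "\<delta> - \<gamma>" c] by blast
  obtain M2 where psi_b: "\<And>s. Re s \<ge> Re u + Re v - c \<Longrightarrow> norm (\<psi> s) \<le> M2"
    using psi_bounded[of "Re u + Re v - c"] c by auto
  obtain M3 where phi_b: "\<And>s. Re s \<ge> c \<Longrightarrow> norm (\<phi> s) \<le> M3"
    using phi_bounded[of c] c gamma_phi by auto
  obtain B where B: "B \<ge> 0" "\<And>t. \<bar>t\<bar> \<ge> max 1 (2 * \<bar>Im u\<bar>) \<Longrightarrow> norm (h x t) \<le> B * \<bar>t\<bar> powr - (real (Suc k) - (2 * \<gamma> - \<delta>))"
    using h_bound[OF x] by metis
  define M4 where "M4 = (\<Sum>n. norm (tw (Suc n)) * mu (Suc n) powr (- \<gamma>))"
  have tw_b: "norm (dirichlet_series tw mu (Complex \<gamma> t)) \<le> M4" for t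
    unfolding M4_def by (rule norm_dirichlet_series_le[OF mu tw_abs_conv]) simp
  have M20: "0 \<le> M2" by (rule order_trans[OF norm_ge_zero psi_b[of "of_real (Re u + Re v - c)"]]) simp
  have M30: "0 \<le> M3" by (rule order_trans[OF norm_ge_zero phi_b[of "of_real c"]]) simp
  define P where "P = max (x powr (\<delta> - \<gamma> - Re u + real k)) (x powr (c - Re u + real k))"
  have P: "norm (of_real x powr (s - u + of_nat k)) \<le> P" if "\<delta> - \<gamma> \<le> Re s" "Re s \<le> c" for s
  proof -
    have "norm (of_real x powr (s - u + of_nat k)) = x powr (Re s - Re u + real k)"
      using x by (simp add: norm_powr_real_powr)
    also have "\<dots> \<le> P" unfolding P_def using that by (intro powr_le_max x) auto
    finally show ?thesis .
  qed
  have P0: "0 \<le> P" by (simp add: P_def le_max_iff_disj)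
  obtain B5 where B5: "\<And>p. p \<in> pts \<Longrightarrow> norm p \<le> B5"
    using finite_imp_bounded[OF finite_pts] by (auto simp: bounded_iff)
  \<comment> \<open>Height 2 makes \<open>|Im s| / 2\<close> at least 1, so that its powers
    increase; \<open>2 * |Im u|\<close> absorbs the shift by \<open>u\<close> in the Pochhammer
    symbol; \<open>B5\<close> clears all poles.\<close>
  define T where "T = max (max (max 2 T1) (2 * \<bar>Im u\<bar>)) (B5 + 1)"
  have T: "T \<ge> 2" "T \<ge> T1" "T \<ge> 2 * \<bar>Im u\<bar>" "T > B5" by (auto simp: T_def)
  have poch1: "(\<bar>Im s\<bar> / 2) ^ Suc k \<le> norm (pochhammer (s - u) (Suc k))" if "T \<le> \<bar>Im s\<bar>" for s
    using that T by (intro norm_pochhammer_ge_half_Im) auto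
  have poch2: "\<bar>Im s\<bar> / 2 \<le> norm (pochhammer (s - u) (Suc k))" if "T \<le> \<bar>Im s\<bar>" for s
  proof -
    have "(\<bar>Im s\<bar> / 2) ^ 1 \<le> (\<bar>Im s\<bar> / 2) ^ Suc k" using that T by (intro power_increasing) auto
    then show ?thesis using poch1[OF that] by simp
  qed
  have "\<exists>M. \<forall>s. \<delta> - \<gamma> \<le> Re s \<longrightarrow> Re s \<le> c \<longrightarrow> T \<le> \<bar>Im s\<bar> \<longrightarrow> norm (J x s) \<le> M / \<bar>Im s\<bar>"
  proof (rule strip_decay[OF J_holomorphic[OF x]])
    show "open (H - pts)" using open_H finite_pts by (intro open_Diff finite_imp_closed)
    show "{s. \<delta> - \<gamma> \<le> Re s \<and> Re s \<le> c \<and> T \<le> \<bar>Im s\<bar>} \<subseteq> H - pts"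
    proof safe
      fix s assume s: "\<delta> - \<gamma> \<le> Re s" "Re s \<le> c" "T \<le> \<bar>Im s\<bar>"
      show "s \<in> H" using s c by (simp add: H_def)
      assume "s \<in> pts"
      then show False using B5[of s] abs_Im_le_cmod[of s] s T by linarith
    qed
    show "1 \<le> T" using T by simp
    show "norm (J x s) \<le> max (B * M4) (2 * (M3 * M2 * P)) / \<bar>Im s\<bar>"
      if s: "Re s = \<delta> - \<gamma> \<or> Re s = c" "T \<le> \<bar>Im s\<bar>" for s
      using s(1)
    proof
      assume Re: "Re s = \<delta> - \<gamma>"
      define t where "t = - Im s"
      have st: "s = Complex (\<delta> - \<gamma>) (- t)" using Re by (simp add: t_def complex_eq_iff)
      have t: "\<bar>t\<bar> \<ge> max 1 (2 * \<bar>Im u\<bar>)" "\<bar>t\<bar> = \<bar>Im s\<bar>" using s(2) T by (auto simp: t_def)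
      have "\<bar>t\<bar> powr - (real (Suc k) - (2 * \<gamma> - \<delta>)) \<le> \<bar>t\<bar> powr - 1"
        using t exponent_gt_1 by (intro powr_mono) auto
      also have "\<dots> = 1 / \<bar>t\<bar>" using t by (simp add: powr_minus divide_inverse)
      finally have "B * \<bar>t\<bar> powr - (real (Suc k) - (2 * \<gamma> - \<delta>)) \<le> B * (1 / \<bar>t\<bar>)"
        using B(1) by (rule mult_left_mono)
      with B(2)[OF t(1)] have "norm (h x t) \<le> B * (1 / \<bar>t\<bar>)" by linarith
      then have "norm (J x s) \<le> B * (1 / \<bar>t\<bar>) * M4"
        unfolding st J_left norm_mult using tw_b B(1) by (intro mult_mono) auto
      also have "\<dots> = (B * M4) / \<bar>Im s\<bar>" using t by simp
      also have "\<dots> \<le> max (B * M4) (2 * (M3 * M2 * P)) / \<bar>Im s\<bar>" by (intro divide_right_mono) auto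
      finally show ?thesis .
    next
      assume Re: "Re s = c"
      have "norm (J x s) = norm (\<phi> s) * norm (\<psi> (v + u - s)) * norm (of_real x powr (s - u + of_nat k))
          / norm (pochhammer (s - u) (Suc k))"
        by (simp add: J_def Phi_def norm_mult norm_divide)
      also have "\<dots> \<le> M3 * M2 * P / (\<bar>Im s\<bar> / 2)"
        using Re c s T poch2[OF s(2)] M20 M30 P0
        by (intro frac_le mult_mono mult_nonneg_nonneg phi_b psi_b P) auto
      also have "\<dots> = 2 * (M3 * M2 * P) / \<bar>Im s\<bar>" by simp
      also have "\<dots> \<le> max (B * M4) (2 * (M3 * M2 * P)) / \<bar>Im s\<bar>" by (intro divide_right_mono) auto
      finally show ?thesis .
    qed
    show "norm (J x s) \<le> (\<bar>M1\<bar> * M2 * P) * exp (A * \<bar>Im s\<bar>)"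
      if s: "\<delta> - \<gamma> \<le> Re s" "Re s \<le> c" "T \<le> \<bar>Im s\<bar>" for s
    proof -
      have 1: "norm (\<phi> s) \<le> \<bar>M1\<bar> * exp (A * \<bar>Im s\<bar>)"
      proof -
        have "norm (\<phi> s) \<le> M1 * exp (A * \<bar>Im s\<bar>)" using s T by (intro phi_gr) auto
        also have "\<dots> \<le> \<bar>M1\<bar> * exp (A * \<bar>Im s\<bar>)" by (intro mult_right_mono) auto
        finally show ?thesis .
      qed
      have 2: "1 \<le> norm (pochhammer (s - u) (Suc k))" using poch2[OF s(3)] s(3) T by linarith
      have "norm (J x s) = norm (\<phi> s) * norm (\<psi> (v + u - s)) * norm (of_real x powr (s - u + of_nat k))
          / norm (pochhammer (s - u) (Suc k))"
        by (simp add: J_def Phi_def norm_mult norm_divide)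
      also have "\<dots> \<le> \<bar>M1\<bar> * exp (A * \<bar>Im s\<bar>) * M2 * P / 1"
        using s c 1 2 M20 P0
        by (intro frac_le mult_mono mult_nonneg_nonneg psi_b P) auto
      finally show ?thesis by (simp add: mult_ac)
    qed
  qed
  then obtain M where M: "\<And>s. \<delta> - \<gamma> \<le> Re s \<Longrightarrow> Re s \<le> c \<Longrightarrow> T \<le> \<bar>Im s\<bar> \<Longrightarrow> norm (J x s) \<le> M / \<bar>Im s\<bar>" by blast
  show ?thesis
  proof (intro exI[of _ "max T (M / e)"] allI impI)
    fix s assume s: "\<delta> - \<gamma> \<le> Re s" "Re s \<le> c" "max T (M / e) \<le> \<bar>Im s\<bar>"
    have pos: "\<bar>Im s\<bar> > 0" using s T by auto
    have "M \<le> e * \<bar>Im s\<bar>" using s e by (simp add: field_simps)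
    then have "M / \<bar>Im s\<bar> \<le> e" using pos by (simp only: pos_divide_le_eq)
    with M[of s] s show "norm (J x s) \<le> e" by auto
  qed
qed

text \<open>The crossed poles are kept as a sum of residues, since it is needed in two forms: as an
  integral over \<open>C\<close>, and as one over a rectangle that can be differentiated in
  \<open>x\<close>.\<close>

theorem Riesz_mean_formula:
  assumes x: "x > 0"
  shows "1 / fact k * D x = (\<Sum>p | p \<in> pts \<and> \<delta> - \<gamma> < Re p \<and> Re p < c. residue (J x) p)
    + G_series \<gamma> \<delta> k g mu u v x"
proof -
  have "2 * of_real pi / fact k * D x - 2 * of_real pi * G_series \<gamma> \<delta> k g mu u v x
      = 2 * of_real pi * (\<Sum>p | p \<in> pts \<and> \<delta> - \<gamma> < Re p \<and> Re p < c. residue (J x) p)"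
    unfolding right_line(2)[OF x, symmetric] left_line(2)[OF x, symmetric]
  proof (rule vertical_line_shift[OF open_H convex_H _ finite_pts J_holomorphic[OF x] c(4) _ left_line(1)[OF x] right_line(1)[OF x]])
    show "{z. \<delta> - \<gamma> \<le> Re z \<and> Re z \<le> c} \<subseteq> H" using c by (auto simp: H_def)
    show "Re p \<noteq> \<delta> - \<gamma> \<and> Re p \<noteq> c" if "p \<in> pts" for p using pts_Re[OF that] by auto
  qed (rule J_decay[OF x])
  then have "2 * of_real pi * (1 / fact k * D x - G_series \<gamma> \<delta> k g mu u v x)
      = 2 * of_real pi * (\<Sum>p | p \<in> pts \<and> \<delta> - \<gamma> < Re p \<and> Re p < c. residue (J x) p)"
    by (simp add: right_diff_distrib)
  then have "1 / fact k * D x - G_series \<gamma> \<delta> k g mu u v x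
      = (\<Sum>p | p \<in> pts \<and> \<delta> - \<gamma> < Re p \<and> Re p < c. residue (J x) p)"
    by simp
  then show ?thesis by (simp add: algebra_simps)
qed

end

section \<open>Differentiating the Riesz mean formula\<close>

lemma norm_exp_unit_interval_integral_le:
  fixes b :: real
  assumes b: "b \<noteq> 0"
  shows "norm (LINT x|lborel. indicator {0..1} x *\<^sub>R exp (\<i> * of_real (b * x))) \<le> 2 / \<bar>b\<bar>"
proof -
  have "((\<lambda>x. exp (\<i> * of_real (b * x))) has_integral
      exp (\<i> * of_real (b * 1)) / (\<i> * of_real b) - exp (\<i> * of_real (b * 0)) / (\<i> * of_real b)) {0..1}"
  proof (rule fundamental_theorem_of_calculus)
    fix x :: real
    have "((\<lambda>z. exp (w * z) / w) has_field_derivative exp (w * of_real x)) (at (of_real x))" if "w \<noteq> 0" for w :: complex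
      using that by (auto intro!: derivative_eq_intros)
    from has_vector_derivative_real_field[OF this[of "\<i> * of_real b"]] b
    show "((\<lambda>x. exp (\<i> * of_real (b * x)) / (\<i> * of_real b)) has_vector_derivative exp (\<i> * of_real (b * x))) (at x within {0..1})"
      by (simp add: has_vector_derivative_at_within mult.assoc)
  qed simp
  moreover have "set_integrable lborel {0..1} (\<lambda>x. exp (\<i> * of_real (b * x)))"
    by (intro borel_integrable_atLeastAtMost' continuous_intros)
  ultimately have "(LINT x|lborel. indicator {0..1} x *\<^sub>R exp (\<i> * of_real (b * x)))
      = (exp (\<i> * of_real b) - 1) / (\<i> * of_real b)"
    using set_borel_integral_eq_integral(2)[of "{0..1}" "\<lambda>x. exp (\<i> * of_real (b * x))"]
    by (simp add: set_lebesgue_integral_def integral_unique diff_divide_distrib)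
  also have "norm \<dots> = norm (exp (\<i> * of_real b) - 1) / \<bar>b\<bar>" by (simp add: norm_divide norm_mult)
  also have "\<dots> \<le> 2 / \<bar>b\<bar>"
    using norm_triangle_ineq4[of "exp (\<i> * of_real b)" 1] by (intro divide_right_mono) auto
  finally show ?thesis .
qed

text \<open>The coefficient with index \<open>Suc m\<close> is recovered from the mean of the series
  against \<open>l (Suc m) powr (\<i> * t)\<close> over \<open>0 \<le> t \<le> T\<close>, which
  tends to 0 if the series does. The substitution \<open>t = T * x\<close> moves the mean to the
  unit interval.\<close>

lemma dirichlet_series_vanishing:
  assumes l: "multiplicative_frequencies l" and f: "abs_conv_at f l \<sigma>"
    and lim: "((\<lambda>t. dirichlet_series f l (Complex \<sigma> t)) \<longlongrightarrow> 0) at_top"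
  shows "f (Suc m) = 0"
proof -
  define h where "h T x = indicator {0..1} x *\<^sub>R (of_real (l (Suc m)) powr (\<i> * of_real (T * x)))" for T x :: real
  define b where "b n = ln (l (Suc m)) - ln (l (Suc n))" for n
  have pos: "l (Suc n) > 0" for n using mult_freq_pos[OF l] by simp
  have cont: "continuous_on UNIV (\<lambda>x. of_real (l (Suc m)) powr (\<i> * of_real (T * x)))" for T
    using pos[of m] by (intro continuous_intros) auto
  have h_int: "integrable lborel (h T)" for T
    using borel_integrable_atLeastAtMost'[OF continuous_on_subset[OF cont]] by (simp add: h_def[abs_def] set_integrable_def)
  have nh: "norm (h T x) = indicator {0..1} x" for T x
    using pos[of m] by (simp add: h_def norm_powr_real_powr indicator_def)
  define I where "I T = (LINT x|lborel. h T x * dirichlet_series f l (Complex \<sigma> (T * x)))" for T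
  have cC: "continuous_on UNIV (\<lambda>x. Complex \<sigma> (T * x))" for T
    unfolding Complex_eq by (intro continuous_intros)
  have ind_int: "integrable lborel (indicator {0..1} :: real \<Rightarrow> real)" by simp
  \<comment> \<open>First evaluation, from the hypothesis: the series is bounded on the line and
    \<open>real j * x\<close> tends to infinity for each \<open>x > 0\<close>.\<close>
  have "(\<lambda>j. I (real j)) \<longlonglongrightarrow> (LINT x::real|lborel. (0::complex))"
    unfolding I_def
  proof (rule integral_dominated_convergence)
    let ?M = "\<Sum>n. norm (f (Suc n)) * l (Suc n) powr (- \<sigma>)"
    show "integrable lborel (\<lambda>x::real. indicator {0..1} x * ?M)" using ind_int by (intro integrable_mult_left) auto
    show "(\<lambda>x. h (real j) x * dirichlet_series f l (Complex \<sigma> (real j * x))) \<in> borel_measurable lborel" for j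
      using dirichlet_series_integral(1)[OF l f h_int cC complex.sel(1)] by auto
    show "AE x in lborel. norm (h (real j) x * dirichlet_series f l (Complex \<sigma> (real j * x))) \<le> indicator {0..1} x * ?M" for j
      unfolding norm_mult nh by (intro AE_I2 mult_left_mono norm_dirichlet_series_le[OF l f]) auto
    show "AE x in lborel. (\<lambda>j. h (real j) x * dirichlet_series f l (Complex \<sigma> (real j * x))) \<longlonglongrightarrow> 0"
      using AE_lborel_singleton[of 0]
    proof eventually_elim
      case (elim x)
      show ?case
      proof (cases "x > 0")
        case True
        have "filterlim (\<lambda>j. real j * x) at_top sequentially"
          using True by real_asymp
        from filterlim_compose[OF lim this]
        have "(\<lambda>j. norm (dirichlet_series f l (Complex \<sigma> (real j * x)))) \<longlonglongrightarrow> 0"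
          by (rule tendsto_norm_zero)
        then show ?thesis
        proof (rule Lim_null_comparison[rotated])
          show "\<forall>\<^sub>F j in sequentially. norm (h (real j) x * dirichlet_series f l (Complex \<sigma> (real j * x)))
              \<le> norm (dirichlet_series f l (Complex \<sigma> (real j * x)))"
            unfolding norm_mult nh by (intro always_eventually allI mult_left_le_one_le) (auto simp: indicator_def)
        qed
      next
        case False
        with elim have "h (real j) x = 0" for j by (simp add: h_def indicator_def)
        then show ?thesis by simp
      qed
    qed
  qed auto
  then have I0: "(\<lambda>j. I (real j)) \<longlonglongrightarrow> 0" by simp
  define cc where "cc T n = (LINT x|lborel. indicator {0..1} x *\<^sub>R exp (\<i> * of_real ((T * b n) * x)))" for T n
  have I_eq: "I T = (\<Sum>n. f (Suc n) * of_real (l (Suc n)) powr (- of_real \<sigma>) * cc T n)" for T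
  proof -
    have "h T x * of_real (l (Suc n)) powr (- Complex \<sigma> (T * x))
        = of_real (l (Suc n)) powr (- of_real \<sigma>) * (indicator {0..1} x *\<^sub>R exp (\<i> * of_real ((T * b n) * x)))" for x n
    proof -
      have "of_real (l (Suc m)) powr (\<i> * of_real (T * x)) * of_real (l (Suc n)) powr (- Complex \<sigma> (T * x))
          = of_real (l (Suc n)) powr (- of_real \<sigma>) * exp (\<i> * of_real ((T * b n) * x))"
        unfolding of_real_powr_eq_exp[OF pos] exp_add[symmetric] b_def
        by (rule arg_cong[of _ _ exp]) (simp add: complex_eq_iff algebra_simps)
      then show ?thesis by (simp add: h_def indicator_def)
    qed
    then have *: "f (Suc n) * (LINT x|lborel. h T x * of_real (l (Suc n)) powr (- Complex \<sigma> (T * x)))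
        = f (Suc n) * of_real (l (Suc n)) powr (- of_real \<sigma>) * cc T n" for n
      unfolding cc_def by (simp only: integral_mult_right_zero mult.assoc)
    show ?thesis
      using sums_unique[OF dirichlet_series_integral(2)[OF l f h_int cC complex.sel(1), of T T]]
      unfolding * I_def by simp
  qed
  have cc1: "norm (cc T n) \<le> 1" for T n
  proof -
    have "norm (cc T n) \<le> (LINT x|lborel. norm (indicator {0..1} x *\<^sub>R exp (\<i> * of_real ((T * b n) * x))))"
      unfolding cc_def by (rule integral_norm_bound)
    also have "\<dots> = (LINT x|lborel. indicator {0..1} (x::real))"
      by (intro Bochner_Integration.integral_cong) (auto simp: indicator_def)
    also have "\<dots> = 1" by simp
    finally show ?thesis .
  qed
  have cc_lim: "(\<lambda>j. cc (real j) n) \<longlonglongrightarrow> (if n = m then 1 else 0)" for n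
  proof (cases "n = m")
    case True
    then have "cc T n = 1" for T by (simp add: cc_def b_def)
    with True show ?thesis by simp
  next
    case False
    then have "l (Suc m) \<noteq> l (Suc n)"
      using mult_freq_less[OF l, of "Suc m" "Suc n"] mult_freq_less[OF l, of "Suc n" "Suc m"] by (cases m n rule: linorder_cases) auto
    then have b0: "b n \<noteq> 0" using pos by (simp add: b_def)
    have "(\<lambda>j. cc (real j) n) \<longlonglongrightarrow> 0"
    proof (rule Lim_null_comparison)
      show "\<forall>\<^sub>F j in sequentially. norm (cc (real j) n) \<le> 2 / \<bar>b n\<bar> * inverse (real j)"
      proof (rule eventually_sequentiallyI[of 1])
        fix j :: nat assume "1 \<le> j"
        then show "norm (cc (real j) n) \<le> 2 / \<bar>b n\<bar> * inverse (real j)"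
          using norm_exp_unit_interval_integral_le[of "real j * b n"] b0
          by (simp add: cc_def abs_mult divide_inverse mult_ac)
      qed
      show "(\<lambda>j. 2 / \<bar>b n\<bar> * inverse (real j)) \<longlonglongrightarrow> 0"
        by (intro tendsto_mult_right_zero lim_inverse_n)
    qed
    with False show ?thesis by simp
  qed
  \<comment> \<open>Second evaluation, term by term: the frequency \<open>b n\<close> vanishes only
    for \<open>n = m\<close>, and the other oscillating integrals are at most
    \<open>2 / (j * |b n|)\<close>.\<close>
  have "(\<lambda>j. I (real j)) \<longlonglongrightarrow> (\<Sum>n. f (Suc n) * of_real (l (Suc n)) powr (- of_real \<sigma>) * (if n = m then 1 else 0))"
    unfolding I_eq
  proof (rule tannerys_theorem[THEN conjunct2, THEN conjunct2])
    show "summable (\<lambda>n. norm (f (Suc n)) * l (Suc n) powr (- \<sigma>))" using f by (simp add: abs_conv_at_def)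
    show "((\<lambda>j. f (Suc n) * of_real (l (Suc n)) powr (- of_real \<sigma>) * cc (real j) n) \<longlonglongrightarrow>
        f (Suc n) * of_real (l (Suc n)) powr (- of_real \<sigma>) * (if n = m then 1 else 0))" for n
      by (intro tendsto_mult_left cc_lim)
    show "\<forall>\<^sub>F (n, j) in at_top \<times>\<^sub>F sequentially. norm (f (Suc n) * of_real (l (Suc n)) powr (- of_real \<sigma>) * cc (real j) n)
        \<le> norm (f (Suc n)) * l (Suc n) powr (- \<sigma>)"
    proof (intro always_eventually allI, clarify)
      fix n j
      have "norm (f (Suc n) * of_real (l (Suc n)) powr (- of_real \<sigma>)) = norm (f (Suc n)) * l (Suc n) powr (- \<sigma>)"
        using norm_dirichlet_term[OF l, of f n "of_real \<sigma>"] by simp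
      then show "norm (f (Suc n) * of_real (l (Suc n)) powr (- of_real \<sigma>) * cc (real j) n)
        \<le> norm (f (Suc n)) * l (Suc n) powr (- \<sigma>)"
        unfolding norm_mult[of "f (Suc n) * of_real (l (Suc n)) powr (- of_real \<sigma>)"] using cc1
        by (simp add: mult_left_le)
    qed
  qed auto
  moreover have "(\<Sum>n. f (Suc n) * of_real (l (Suc n)) powr (- of_real \<sigma>) * (if n = m then 1 else 0))
      = f (Suc m) * of_real (l (Suc m)) powr (- of_real \<sigma>)"
    by (subst suminf_finite[of "{m}"]) auto
  ultimately have "f (Suc m) * of_real (l (Suc m)) powr (- of_real \<sigma>) = 0"
    using I0 LIMSEQ_unique by metis
  then show ?thesis using pos[of m] by (auto simp: powr_def)
qed

text \<open>Otherwise \<open>\<phi>\<close> is bounded on \<open>Re s = \<delta> - \<gamma>\<close>, and the Gamma factors of the functional equation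
  force \<open>\<psi>\<close> to decay along \<open>Re s = \<gamma>\<close>, which a nonzero Dirichlet series cannot do.\<close>

lemma (in hecke_pair) abscissa_lower_bound:
  assumes g: "\<exists>n\<ge>1. g n \<noteq> 0" and \<tau>: "\<tau> > \<sigma>\<phi>"
  shows "\<delta> - \<gamma> < \<tau>"
proof (rule ccontr)
  assume "\<not> \<delta> - \<gamma> < \<tau>"
  then have le: "\<tau> \<le> \<delta> - \<gamma>" by simp
  obtain M where M: "\<And>s. Re s \<ge> \<tau> \<Longrightarrow> norm (\<phi> s) \<le> M" using phi_bounded[OF \<tau>] by blast
  have M0: "0 \<le> M" by (rule order_trans[OF norm_ge_zero M[of "of_real \<tau>"]]) simp
  define a where "a = 2 * \<gamma> - \<delta>"
  have a: "a > 0" using gamma_half by (simp add: a_def)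
  \<comment> \<open>Here the lower bound is required:
    \<open>norm (Gamma s) / norm (Gamma (\<delta> - s))\<close> grows at least like the positive
    power \<open>a\<close> of \<open>t\<close>, so boundedness of \<phi> forces \<psi> to
    decay.\<close>
  obtain K where K: "K > 0" "\<And>t. \<bar>t\<bar> \<ge> 1 \<Longrightarrow>
      \<bar>t\<bar> powr a * norm (Gamma (Complex (\<delta> - \<gamma>) t)) \<le> K * norm (Gamma (Complex (\<delta> - \<gamma> + a) t))"
    using Gamma_vertical_lower[of a "\<delta> - \<gamma>"] a by (metis less_imp_le)
  define P where "P = (2 * pi) powr (\<delta> - 2 * \<gamma>)"
  have P0: "P > 0" by (simp add: P_def)
  have bound: "norm (\<psi> (Complex \<gamma> t)) \<le> M * K / P * t powr - a" if t: "t \<ge> 1" for t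
  proof -
    define s where "s = Complex \<gamma> t"
    let ?z = "of_real \<delta> - s" and ?G = "norm (Gamma (Complex (\<delta> - \<gamma>) t))"
    have zc: "?z = cnj (Complex (\<delta> - \<gamma>) t)" by (simp add: s_def complex_eq_iff)
    have G: "norm (rGamma ?z) = inverse ?G"
      unfolding zc by (simp add: rGamma_inverse_Gamma cnj_Gamma[symmetric] norm_inverse)
    have Gpos: "?G > 0"
      using t not_nonpos_Int_if_Im[of "Complex (\<delta> - \<gamma>) t"] by (simp add: Gamma_eq_zero_iff)
    have Gs: "norm (Gamma s) > 0"
      using Gamma_nonzero_if_Re_pos[of s] gamma_half delta_pos by (simp add: s_def)
    have nP: "norm (of_real (2 * pi) powr (of_real \<delta> - 2 * s)) = P"
      unfolding P_def by (subst norm_powr_real_powr) (auto simp: s_def)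
    have "\<phi> ?z = of_real (2 * pi) powr (of_real \<delta> - 2 * s) * rGamma ?z * Gamma s * \<psi> s"
      using functional_equation_on_line[of ?z] by (simp add: algebra_simps s_def)
    then have "norm (\<phi> ?z) = P * inverse ?G * norm (Gamma s) * norm (\<psi> s)"
      by (simp only: norm_mult nP G)
    moreover have "norm (\<phi> ?z) \<le> M" using le by (intro M) (simp add: s_def)
    ultimately have "P * inverse ?G * norm (Gamma s) * norm (\<psi> s) \<le> M" by simp
    from mult_right_mono[OF this, of ?G]
    have "(P * norm (Gamma s)) * norm (\<psi> s) \<le> M * ?G"
      using Gpos by (simp add: field_simps)
    moreover have "?G \<le> K * norm (Gamma s) * t powr - a"
    proof -
      have "t powr a * ?G \<le> K * norm (Gamma s)" using K(2)[of t] t by (simp add: s_def a_def)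
      then have "t powr - a * (t powr a * ?G) \<le> t powr - a * (K * norm (Gamma s))"
        by (rule mult_left_mono) simp
      moreover have "t powr - a * t powr a = 1" using t by (simp add: powr_minus)
      ultimately show ?thesis by (simp only: mult.assoc[symmetric] mult_1) (simp only: mult_ac)
    qed
    ultimately have "(P * norm (Gamma s)) * norm (\<psi> s) \<le> M * (K * norm (Gamma s) * t powr - a)"
      using M0 by (meson mult_left_mono order_trans)
    also have "\<dots> = (P * norm (Gamma s)) * (M * K / P * t powr - a)"
      using P0 by simp
    finally show ?thesis
      unfolding s_def[symmetric] by (rule mult_left_le_imp_le) (use P0 Gs in simp)
  qed
  have "((\<lambda>t. \<psi> (Complex \<gamma> t)) \<longlongrightarrow> 0) at_top"
  proof (rule Lim_null_comparison)
    show "\<forall>\<^sub>F t in at_top. norm (\<psi> (Complex \<gamma> t)) \<le> M * K / P * t powr - a"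
      using eventually_ge_at_top[of 1] by eventually_elim (rule bound)
    have "((\<lambda>t. t powr - a) \<longlongrightarrow> 0) at_top" using a by (intro tendsto_neg_powr filterlim_ident) auto
    then show "((\<lambda>t. M * K / P * t powr - a) \<longlongrightarrow> 0) at_top" by (rule tendsto_mult_right_zero)
  qed
  then have "((\<lambda>t. dirichlet_series g mu (Complex \<gamma> t)) \<longlongrightarrow> 0) at_top"
    using psi_eq gamma_psi by simp
  then have "g (Suc m) = 0" for m
    using dirichlet_series_vanishing[OF mu meromorphic_dirichlet_abs_conv_at[OF mu psi gamma_psi]] by blast
  with g show False by (metis Suc_le_D One_nat_def)
qed

section \<open>Residues and the derivative at 1\<close>

lemma residue_simple_pole_times_analytic:
  assumes S: "open S" "p \<in> S" and f: "f holomorphic_on S - {p}" "is_pole f p" "zorder f p = -1"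
    and q: "q holomorphic_on S"
  shows "residue (\<lambda>w. f w * q w) p = residue f p * q p"
proof (rule residue_simple'[OF S])
  show "(\<lambda>w. f w * q w) holomorphic_on S - {p}"
    by (intro holomorphic_intros f holomorphic_on_subset[OF q]) auto
  have iso: "isolated_singularity_at f p"
    by (rule isolated_singularity_at_holomorphic[OF f(1) S])
  obtain r where r: "r > 0" "zor_poly f p holomorphic_on cball p r"
    using zorder_exist_pole[OF f(1) S f(2)] by blast
  have "continuous_on (ball p r) (zor_poly f p)"
    by (rule continuous_on_subset[OF holomorphic_on_imp_continuous_on[OF r(2)]]) auto
  then have "isCont (zor_poly f p) p"
    using r(1) by (simp add: continuous_on_eq_continuous_at)
  then have z: "(zor_poly f p \<longlongrightarrow> residue f p) (at p)"
    using residue_simple_pole[OF iso f(2,3)] by (simp add: isCont_def)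
  have "\<forall>\<^sub>F w in at p. zor_poly f p w = f w * (w - p)"
    using zor_poly_pole_eq[OF iso f(2)] f(3) by simp
  with z have lim: "((\<lambda>w. f w * (w - p)) \<longlongrightarrow> residue f p) (at p)"
    by (rule Lim_transform_eventually)
  have "isCont q p"
    using holomorphic_on_imp_continuous_on[OF q] S by (simp add: continuous_on_eq_continuous_at)
  then have "(q \<longlongrightarrow> q p) (at p)" by (simp add: isCont_def)
  from tendsto_mult[OF lim this]
  show "((\<lambda>w. f w * q w * (w - p)) \<longlongrightarrow> residue f p * q p) (at p)"
    by (simp add: mult_ac)
qed

text \<open>A single enumeration of all pairs of indices, in which the double Riesz mean becomes a
  truncated power series with its corners at the ratios of frequencies.\<close>

definition pair_coeff ::
    "(nat \<Rightarrow> complex) \<Rightarrow> (nat \<Rightarrow> real) \<Rightarrow> complex \<Rightarrow> (nat \<Rightarrow> complex) \<Rightarrow> (nat \<Rightarrow> real) \<Rightarrow> complex \<Rightarrow> nat \<Rightarrow> complex" where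
  "pair_coeff f l u g m v i = (case prod_decode i of (p, q) \<Rightarrow>
     f (Suc p) / of_real (l (Suc p)) powr u * (g (Suc q) / of_real (m (Suc q)) powr v))"

definition pair_ratio :: "(nat \<Rightarrow> real) \<Rightarrow> (nat \<Rightarrow> real) \<Rightarrow> nat \<Rightarrow> real" where
  "pair_ratio l m i = (case prod_decode i of (p, q) \<Rightarrow> l (Suc p) / m (Suc q))"

lemma dirichlet_quotient_summable:
  assumes "multiplicative_frequencies l" "abs_conv_at f l (Re s)"
  shows "summable (\<lambda>n. norm (f (Suc n) / of_real (l (Suc n)) powr s))"
    and "(\<Sum>n. f (Suc n) / of_real (l (Suc n)) powr s) = dirichlet_series f l s"
  using abs_conv_at_summable[OF assms order_refl]
  by (simp_all add: dirichlet_series_def powr_minus divide_inverse)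

context hecke_uv
begin

abbreviation A :: "nat \<Rightarrow> complex" where "A n \<equiv> f (Suc n) / of_real (lam (Suc n)) powr u"

abbreviation B :: "nat \<Rightarrow> complex" where "B n \<equiv> g (Suc n) / of_real (mu (Suc n)) powr v"

lemma a_summable: "summable (\<lambda>n. norm (A n))"
  and a_sum: "(\<Sum>n. A n) = \<phi> u"
  and b_summable: "summable (\<lambda>n. norm (B n))"
  and b_sum: "(\<Sum>n. B n) = \<psi> v"
  using dirichlet_quotient_summable[OF lam abs_conv_phi[OF u_gt]] dirichlet_quotient_summable[OF mu abs_conv_psi[OF v_gt]]
    phi_eq[OF u_gt] psi_eq[OF v_gt] by auto

lemma pair_coeff_summable: "summable (\<lambda>i. norm (pair_coeff f lam u g mu v i))"
  using double_series(1)[OF a_summable b_summable, of "\<lambda>_ _. 1" 1]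
  by (simp add: pair_coeff_def case_prod_unfold)

lemma pair_ratio_pos: "pair_ratio lam mu i > 0"
  using mult_freq_pos[OF lam] mult_freq_pos[OF mu] by (simp add: pair_ratio_def case_prod_unfold)

text \<open>Taking \<open>mu n ^ k\<close> out of \<open>(mu n * x - lam m) ^ k\<close> cancels the
  same factor in the denominator and moves the corner from \<open>lam m\<close> to
  \<open>lam m / mu n\<close>.\<close>

lemma D_eq_truncated_power_series:
  assumes x: "x > 0"
  shows "1 / fact k * D x = truncated_power_series (pair_coeff f lam u g mu v) (pair_ratio lam mu) k x"
proof -
  define q where "q m n = complex_of_real ((max 0 (x - lam (Suc m) / mu (Suc n))) ^ k / fact k)" for m n
  have q: "norm (q m n) \<le> x ^ k" for m n
  proof -
    have "lam (Suc m) / mu (Suc n) > 0" using mult_freq_pos[OF lam] mult_freq_pos[OF mu] by simp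
    then have "(max 0 (x - lam (Suc m) / mu (Suc n))) ^ k / fact k \<le> x ^ k / 1"
      using x by (intro frac_le power_mono) (auto intro: fact_ge_1)
    then show ?thesis by (simp add: q_def norm_divide norm_power)
  qed
  note sm = summable_norm_cancel[OF summable_norm_mult_bounded[OF a_summable q]]
  define X where "X n = g (Suc n) / of_real (mu (Suc n)) powr (v + of_nat k) * riesz_sum k f lam u (mu (Suc n) * x)" for n
  have summand: "B n * (\<Sum>m. A m * q m n)
      = 1 / fact k * X n" for n
  proof -
    define L where "L = mu (Suc n)"
    have L: "L > 0" using mult_freq_pos[OF mu] by (simp add: L_def)
    have term_eq: "(if lam (Suc m) \<le> L * x then A m * of_real ((L * x - lam (Suc m)) ^ k) else 0)
        = of_real (L ^ k) * fact k * (A m * q m n)" for m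
    proof -
      have "(L * x - lam (Suc m)) ^ k = L ^ k * (x - lam (Suc m) / L) ^ k"
        using L by (simp add: power_mult_distrib[symmetric] right_diff_distrib)
      moreover have "lam (Suc m) \<le> L * x \<longleftrightarrow> 0 \<le> x - lam (Suc m) / L"
        using L by (simp add: field_simps)
      ultimately show ?thesis
        using k_ge_1 by (auto simp: q_def L_def[symmetric] max_def)
    qed
    have "riesz_sum k f lam u (L * x) = of_real (L ^ k) * fact k * (\<Sum>m. A m * q m n)"
      using sums_unique[OF riesz_sum_sums[OF lam k_ge_1, of "L * x" f u]] unfolding term_eq suminf_mult[OF sm] .
    moreover have "of_real L powr (v + of_nat k) = of_real L powr v * of_real (L ^ k)"
      using L by (simp add: powr_add powr_nat)
    ultimately show "B n * (\<Sum>m. A m * q m n)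
        = 1 / fact k * X n"
      using L by (simp add: L_def[symmetric] X_def)
  qed
  have summ: "summable (\<lambda>n. B n * (\<Sum>m. A m * q m n))"
    by (rule summable_norm_cancel, rule summable_norm_mult_bounded[OF b_summable])
       (rule norm_suminf_mult_bounded[OF a_summable q])
  have "truncated_power_series (pair_coeff f lam u g mu v) (pair_ratio lam mu) k x
      = (\<Sum>n. B n * (\<Sum>m. A m * q m n))"
    unfolding double_series(2)[OF a_summable b_summable q, symmetric]
    by (simp add: truncated_power_series_def pair_coeff_def pair_ratio_def q_def case_prod_unfold)
  also have "\<dots> = (\<Sum>n. 1 / fact k * X n)"
    by (simp only: summand)
  also have "\<dots> = 1 / fact k * D x"
    using summ unfolding summand D_def X_def by (intro suminf_mult) (simp only: summable_cmult_iff, simp)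
  finally show ?thesis ..
qed

text \<open>\<open>C\<close> has winding number 1 about every point of \<open>pts\<close> to the
  right of \<open>\<delta> - \<gamma>\<close>, by assumption, and 0 about those to the left, as it
  stays in the strip. Hence it collects the same residues as the move of the line.\<close>

lemma contour_Riesz_mean_formula:
  assumes C: "valid_path C" "pathfinish C = pathstart C" "path_image C \<subseteq> {s. \<delta> - \<gamma> < Re s \<and> Re s < \<gamma>}"
    and poles: "\<And>z. is_pole \<phi> z \<Longrightarrow> encircles C z"
    and gamma_poles: "\<And>j. j \<le> k \<Longrightarrow> \<delta> - \<gamma> < Re u - real j \<Longrightarrow> encircles C (u - of_nat j)"
    and x: "x > 0"
  shows "1 / Gamma (of_nat k + 1) * D x =
      1 / (2 * of_real pi * \<i>) *
        contour_integral C (\<lambda>z. Gamma (z - u) / Gamma (z - u + of_nat k + 1)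
          * \<phi> z * \<psi> (v + u - z) * of_real x powr (z - u + of_nat k))
      + G_series \<gamma> \<delta> k g mu u v x"
proof -
  have CH: "path_image C \<subseteq> H" using C(3) c by (force simp: H_def)
  \<comment> \<open>The case \<open>j = 0\<close> of \<open>gamma_poles\<close>: a curve inside the
    strip cannot encircle a point outside it.\<close>
  have u_strip: "Re u < \<gamma>" if "\<delta> - \<gamma> < Re u"
  proof (rule ccontr)
    assume "\<not> Re u < \<gamma>"
    then have "winding_number C u = 0"
      by (intro winding_number_zero_outside_strip[OF C]) simp
    moreover have "encircles C u" using gamma_poles[of 0] that by simp
    ultimately show False by (simp add: encircles_def)
  qed
  have cases: "(encircles C p \<and> \<delta> - \<gamma> < Re p) \<or> Re p < \<delta> - \<gamma>" if p: "p \<in> pts" for p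
  proof -
    from p consider "is_pole \<phi> p" | j where "j \<le> k" "p = u - of_nat j" by (auto simp: pts_def)
    then show ?thesis
    proof cases
      case 1
      then show ?thesis using poles phi_strip by blast
    next
      case 2
      then show ?thesis using gamma_poles[of j] u_line[of j] by (cases "\<delta> - \<gamma> < Re u - real j") auto
    qed
  qed
  have sub: "path_image C \<subseteq> H - pts"
  proof
    fix z assume z: "z \<in> path_image C"
    have "z \<notin> pts" using cases[of z] z C(3) by (auto simp: encircles_def)
    then show "z \<in> H - pts" using CH z by blast
  qed
  have "contour_integral C (J x) = 2 * of_real pi * \<i> * (\<Sum>p | p \<in> pts \<and> \<delta> - \<gamma> < Re p \<and> Re p < c. residue (J x) p)"
  proof (rule contour_integral_eq_residues_in_strip[OF open_H convex_H finite_pts J_holomorphic[OF x] C(1,2) sub])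
    fix p assume p: "p \<in> pts"
    show "winding_number C p = (if \<delta> - \<gamma> < Re p \<and> Re p < c then 1 else 0)"
    proof (cases "\<delta> - \<gamma> < Re p")
      case True
      then show ?thesis using cases[OF p] pts_Re[OF p] by (auto simp: encircles_def)
    next
      case False
      then have "winding_number C p = 0"
        by (intro winding_number_zero_outside_strip[OF C]) simp
      with False show ?thesis by simp
    qed
  qed
  moreover have "contour_integral C (\<lambda>z. Gamma (z - u) / Gamma (z - u + of_nat k + 1)
          * \<phi> z * \<psi> (v + u - z) * of_real x powr (z - u + of_nat k)) = contour_integral C (J x)"
  proof (rule contour_integral_cong[OF refl])
    fix z assume z: "z \<in> path_image C"
    \<comment> \<open>\<open>Gamma (z - u)\<close> has further poles \<open>u - j\<close> with
      \<open>j > k\<close>, which are not in \<open>pts\<close>. If one lay on \<open>C\<close>,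
      then \<open>Re u < \<gamma>\<close> would give
      \<open>j < 2 \<gamma> - \<delta> < k\<close>.\<close>
    have "z - u \<notin> \<int>\<^sub>\<le>\<^sub>0"
    proof
      assume "z - u \<in> \<int>\<^sub>\<le>\<^sub>0"
      then obtain j where j: "z - u = - of_nat j" by (auto elim!: nonpos_Ints_cases')
      then have zj: "z = u - of_nat j" by (simp add: algebra_simps)
      have "z \<notin> pts" using sub z by blast
      then have "j > k" using zj by (auto simp: pts_def image_iff not_le[symmetric])
      moreover have "\<delta> - \<gamma> < Re u - real j" using z C(3) zj by auto
      moreover from this have "Re u < \<gamma>" by (intro u_strip) auto
      ultimately show False using k_gt by simp
    qed
    then have "Gamma (z - u) / Gamma (z - u + of_nat (Suc k)) = 1 / pochhammer (z - u) (Suc k)"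
      using pochhammer_Gamma[of "z - u" "Suc k"] by simp
    then show "Gamma (z - u) / Gamma (z - u + of_nat k + 1)
          * \<phi> z * \<psi> (v + u - z) * of_real x powr (z - u + of_nat k) = J x z"
      by (simp add: J_def Phi_def add_ac)
  qed
  moreover have "Gamma (of_nat k + 1) = (fact k :: complex)"
    using Gamma_fact[of k] by (simp add: add.commute)
  ultimately show ?thesis
    using Riesz_mean_formula[OF x] by simp
qed

lemma residue_logarithmic_kernel_at_u:
  assumes "\<not> is_pole \<phi> u"
  shows "residue (\<lambda>z. Phi z / (z - u)) u = \<phi> u * \<psi> v"
proof -
  have "residue (\<lambda>z. Phi z / (z - u)) u = Phi u"
    using open_H phi_finite Phi_holomorphic assms c
    by (intro residue_simple[of "H - {p. is_pole \<phi> p}"] open_Diff finite_imp_closed) (auto simp: H_def)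
  then show ?thesis by (simp add: Phi_def)
qed

text \<open>The pole is simple, so the cofactor is just evaluated at \<open>p\<close>; it is
  analytic there since \<open>Re p \<le> \<sigma>\<phi> < Re u\<close> separates \<open>p\<close>
  from \<open>u\<close>.\<close>

lemma residue_logarithmic_kernel_at_pole:
  assumes p: "is_pole \<phi> p"
  shows "residue (\<lambda>z. Phi z / (z - u)) p = residue \<phi> p / (p - u) * \<psi> (v + u - p)"
proof -
  define U where "U = H - (({q. is_pole \<phi> q} \<union> {u}) - {p})"
  have pu: "p \<noteq> u" using phi_pole_le[OF p] u_gt by auto
  have Rp: "Re p < c" using pts_Re[of p] p by (simp add: pts_def)
  have "residue (\<lambda>z. \<phi> z * (\<psi> (v + u - z) / (z - u))) p = residue \<phi> p * (\<psi> (v + u - p) / (p - u))"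
  proof (rule residue_simple_pole_times_analytic)
    show "open U" unfolding U_def using open_H phi_finite by (intro open_Diff finite_imp_closed) auto
    show "p \<in> U" using Rp c by (simp add: U_def H_def)
    show "\<phi> holomorphic_on U - {p}"
      by (rule holomorphic_on_subset[OF nicely_meromorphic_holomorphic_off_poles[OF phi_nicely]]) (auto simp: U_def)
    show "is_pole \<phi> p" "zorder \<phi> p = - 1" using p phi_poles by (auto simp: simple_real_poles_def)
    have "\<not> is_pole \<psi> (v + u - z)" if "z \<in> H" for z
      using psi_pole_le[of "v + u - z"] that by (auto simp: H_def)
    then have "(\<lambda>z. \<psi> (v + u - z)) holomorphic_on U"
      by (intro holomorphic_on_compose_gen[OF _ nicely_meromorphic_holomorphic_off_poles[OF psi_nicely], unfolded o_def]
            holomorphic_intros) (auto simp: U_def)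
    then show "(\<lambda>z. \<psi> (v + u - z) / (z - u)) holomorphic_on U"
      using pu by (intro holomorphic_intros) (auto simp: U_def)
  qed
  then show ?thesis by (simp add: Phi_def)
qed

text \<open>The Meijer series is never differentiated itself: for \<open>x > 0\<close> it equals a
  truncated power series minus an integral over a fixed rectangle, and both have explicit
  derivatives in \<open>x\<close>.\<close>

lemma G_series_has_kth_deriv:
  assumes Re_u: "\<delta> - \<gamma> < Re u"
  shows "has_kth_deriv k (\<lambda>x. G_series \<gamma> \<delta> k g mu u v x)
      (step_series (pair_coeff f lam u g mu v) (pair_ratio lam mu) 1
        - (\<phi> u * \<psi> v + (\<Sum>p | is_pole \<phi> p. residue \<phi> p / (p - u) * \<psi> (v + u - p)))) 1"
proof -
  let ?a = "pair_coeff f lam u g mu v" and ?r = "pair_ratio lam mu"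
  obtain b where b: "\<And>p. p \<in> pts \<Longrightarrow> norm p \<le> b"
    using finite_imp_bounded[OF finite_pts] by (auto simp: bounded_iff)
  \<comment> \<open>High enough that the rectangle contains every point of \<open>pts\<close>
    between the two lines.\<close>
  define Hh where "Hh = \<bar>b\<bar> + 1"
  have Hh: "Hh > 0" by (simp add: Hh_def)
  have edge: "Re p \<noteq> \<delta> - \<gamma> \<and> Re p \<noteq> c \<and> \<bar>Im p\<bar> < Hh" if "p \<in> pts" for p
    using pts_Re[OF that] b[OF that] abs_Im_le_cmod[of p] by (auto simp: Hh_def)
  define Q where "Q = rectpath (Complex (\<delta> - \<gamma>) (- Hh)) (Complex c Hh)"
  define R where "R m x = contour_integral Q
      (\<lambda>z. Phi z * (of_real x powr (z - u + of_nat m) / pochhammer (z - u) (Suc m)))" for m and x :: real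
  have strip: "{z. \<delta> - \<gamma> \<le> Re z \<and> Re z \<le> c} \<subseteq> H" using c by (auto simp: H_def)
  have QH: "path_image Q \<subseteq> H - pts"
    unfolding Q_def by (rule contour_integral_rectpath_residues(2)[OF open_H convex_H strip finite_pts J_holomorphic[of 1] c(4) edge Hh]) auto
  have contPhi: "continuous_on (path_image Q) Phi"
    by (rule holomorphic_on_imp_continuous_on, rule holomorphic_on_subset[OF Phi_holomorphic]) (use QH in \<open>auto simp: pts_def\<close>)
  have R_deriv: "(R (Suc m) has_vector_derivative R m x) (at x)" if "Suc m \<le> k" "x > 0" for m x
    unfolding R_def Q_def
  proof (rule rectpath_Riesz_kernel_derivative)
    show "z \<noteq> u - of_nat j" if "z \<in> path_image (rectpath (Complex (\<delta> - \<gamma>) (- Hh)) (Complex c Hh))" "j \<le> Suc m" for z j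
      using QH that \<open>Suc m \<le> k\<close> by (auto simp: Q_def pts_def)
  qed (use contPhi \<open>x > 0\<close> in \<open>auto simp: Q_def\<close>)
  \<comment> \<open>The \<open>i\<close>-th derivative, both terms having dropped to order
    \<open>k - i\<close>. At \<open>i = k - 1\<close> the order is 1, and only the symmetric limit
    is left.\<close>
  define E where "E i x = truncated_power_series ?a ?r (k - i) x - 1 / (2 * of_real pi * \<i>) * R (k - i) x" for i x
  have Rk: "R k x = 2 * of_real pi * \<i> * (\<Sum>p | p \<in> pts \<and> \<delta> - \<gamma> < Re p \<and> Re p < c. residue (J x) p)" if x: "x > 0" for x
    using contour_integral_rectpath_residues(1)[OF open_H convex_H strip finite_pts J_holomorphic[OF x] c(4) edge Hh]
    by (simp add: R_def Q_def J_def[abs_def])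
  \<comment> \<open>At order 0 the kernel is \<open>1 / (z - u)\<close>, so the poles
    \<open>u - j\<close> with \<open>j \<ge> 1\<close> have disappeared.\<close>
  have R0: "R 0 1 = 2 * of_real pi * \<i> * (\<phi> u * \<psi> v + (\<Sum>p | is_pole \<phi> p. residue \<phi> p / (p - u) * \<psi> (v + u - p)))"
  proof -
    let ?P = "insert u {p. is_pole \<phi> p}"
    have u0: "\<not> is_pole \<phi> u" using phi_pole_le[of u] u_gt by auto
    have Psub: "?P \<subseteq> pts" by (auto simp: pts_def image_iff intro!: bexI[of _ 0])
    have hol: "(\<lambda>z. Phi z / (z - u)) holomorphic_on H - ?P"
      by (intro holomorphic_intros holomorphic_on_subset[OF Phi_holomorphic]) auto
    have "R 0 1 = contour_integral Q (\<lambda>z. Phi z / (z - u))"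
      by (simp add: R_def)
    also have "\<dots> = 2 * of_real pi * \<i> * (\<Sum>p | p \<in> ?P \<and> \<delta> - \<gamma> < Re p \<and> Re p < c. residue (\<lambda>z. Phi z / (z - u)) p)"
      unfolding Q_def using phi_finite Psub
      by (intro contour_integral_rectpath_residues(1)[OF open_H convex_H strip _ hol c(4) edge Hh]) auto
    \<comment> \<open>The assumption \<open>Re_u\<close> is what puts \<open>u\<close> inside the
      rectangle; without its residue the product \<open>\<phi> u * \<psi> v\<close> would be
      missing.\<close>
    also have "{p. p \<in> ?P \<and> \<delta> - \<gamma> < Re p \<and> Re p < c} = ?P"
      using Psub pts_Re Re_u phi_strip by auto
    also have "(\<Sum>p\<in>?P. residue (\<lambda>z. Phi z / (z - u)) p)
        = \<phi> u * \<psi> v + (\<Sum>p | is_pole \<phi> p. residue \<phi> p / (p - u) * \<psi> (v + u - p))"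
      using u0 phi_finite by (simp add: residue_logarithmic_kernel_at_u residue_logarithmic_kernel_at_pole)
    finally show ?thesis .
  qed
  show ?thesis
  proof (rule has_kth_derivI[OF k_ge_1, where D = E])
    fix i and x :: real assume i: "Suc i < k" and x: "x > 0"
    then obtain j where j: "k - i = Suc (Suc j)" "k - Suc i = Suc j"
      by (metis Suc_diff_Suc Suc_lessD)
    show "(E i has_vector_derivative E (Suc i) x) (at x)"
      unfolding E_def j using i x j
      by (intro has_vector_derivative_diff has_vector_derivative_mult_right R_deriv
            truncated_power_series_derivative pair_coeff_summable pair_ratio_pos) auto
  next
    fix x :: real assume x: "x > 0"
    show "G_series \<gamma> \<delta> k g mu u v x = E 0 x"
      using Riesz_mean_formula[OF x] D_eq_truncated_power_series[OF x] by (simp add: E_def Rk[OF x] eq_diff_eq add.commute)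
  next
    have k1: "k - (k - 1) = 1" using k_ge_1 by simp
    have "(R 1 has_vector_derivative R 0 1) (at 1)" using R_deriv[of 0 1] k_ge_1 by simp
    note * = tendsto_diff[OF
        truncated_linear_series_symmetric_derivative[OF pair_coeff_summable, of "pair_ratio lam mu" 1, OF pair_ratio_pos]
        tendsto_mult_left[OF symmetric_quotient_tendsto[OF this], of "1 / (2 * of_real pi * \<i>)"]]
    have split: "(a - w * b - (a' - w * b')) / d = (a - a') / d - w * ((b - b') / d)" for a b a' b' d w :: complex
      by (simp add: diff_divide_distrib right_diff_distrib)
    have "((\<lambda>h. (E (k - 1) (1 + h) - E (k - 1) (1 - h)) / of_real (2 * h)) \<longlongrightarrow>
        step_series ?a ?r 1 - 1 / (2 * of_real pi * \<i>) * R 0 1) (at_right 0)"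
      unfolding E_def k1 split by (rule *)
    then show "((\<lambda>h. (E (k - 1) (1 + h) - E (k - 1) (1 - h)) / of_real (2 * h)) \<longlongrightarrow>
        step_series ?a ?r 1 - (\<phi> u * \<psi> v + (\<Sum>p | is_pole \<phi> p. residue \<phi> p / (p - u) * \<psi> (v + u - p)))) (at_right 0)"
      unfolding R0 by simp
  qed simp
qed

text \<open>The jump functions of a ratio and of its reciprocal at 1 add up to 1, also on the
  diagonal. The two evaluations in \<open>double_series\<close> bring both sums to the same order of
  summation, so the weights can be added.\<close>

lemma step_series_complementary:
  "step_series (pair_coeff f lam u g mu v) (pair_ratio lam mu) 1
    + step_series (pair_coeff g mu v f lam u) (pair_ratio mu lam) 1 = \<phi> u * \<psi> v"
proof -
  define s where "s r = (if r < 1 then 1 else if r = 1 then 1 / 2 else 0 :: complex)" for r :: real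
  define q q' where "q m n = s (lam (Suc m) / mu (Suc n))" and "q' n m = s (mu (Suc n) / lam (Suc m))" for m n
  have q: "norm (q m n) \<le> 1" "norm (q' n m) \<le> 1" for m n by (auto simp: q_def q'_def s_def)
  have qq: "q m n + q' n m = 1" for m n
  proof -
    have "lam (Suc m) > 0" "mu (Suc n) > 0" using mult_freq_pos[OF lam] mult_freq_pos[OF mu] by auto
    then show ?thesis by (auto simp: q_def q'_def s_def divide_simps)
  qed
  have 1: "step_series (pair_coeff f lam u g mu v) (pair_ratio lam mu) 1 = (\<Sum>n. B n * (\<Sum>m. A m * q m n))"
    unfolding double_series(2)[OF a_summable b_summable q(1), symmetric]
    unfolding step_series_def pair_coeff_def pair_ratio_def q_def s_def case_prod_unfold by (rule refl)
  have 2: "step_series (pair_coeff g mu v f lam u) (pair_ratio mu lam) 1 = (\<Sum>n. B n * (\<Sum>m. A m * q' n m))"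
    unfolding double_series(3)[OF b_summable a_summable q(2), symmetric]
    unfolding step_series_def pair_coeff_def pair_ratio_def q'_def s_def case_prod_unfold by (rule refl)
  have inner: "(\<Sum>m. A m * q m n) + (\<Sum>m. A m * q' n m) = \<phi> u" for n
  proof -
    have "(\<Sum>m. A m * q m n) + (\<Sum>m. A m * q' n m) = (\<Sum>m. A m * q m n + A m * q' n m)"
      by (intro suminf_add summable_norm_cancel[OF summable_norm_mult_bounded[OF a_summable, where K = 1]] q)
    also have "\<dots> = (\<Sum>m. A m)"
      by (simp only: distrib_left[symmetric] qq mult_1_right)
    finally show ?thesis by (simp only: a_sum)
  qed
  have sn: "summable (\<lambda>n. B n * (\<Sum>m. A m * w n m))" if "\<And>n m. norm (w n m) \<le> 1" for w
    by (rule summable_norm_cancel, rule summable_norm_mult_bounded[OF b_summable])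
       (rule norm_suminf_mult_bounded[OF a_summable that])
  have "(\<Sum>n. B n * (\<Sum>m. A m * q m n)) + (\<Sum>n. B n * (\<Sum>m. A m * q' n m))
      = (\<Sum>n. B n * (\<Sum>m. A m * q m n) + B n * (\<Sum>m. A m * q' n m))"
    by (intro suminf_add sn[of "\<lambda>n m. q m n"] sn[of q'] q)
  also have "\<dots> = (\<Sum>n. B n * \<phi> u)"
    by (simp only: distrib_left[symmetric] inner)
  also have "\<dots> = (\<Sum>n. B n) * \<phi> u"
    using summable_norm_cancel[OF b_summable] by (rule suminf_mult2[symmetric])
  finally show ?thesis unfolding 1 2 b_sum by (simp add: mult.commute)
qed

end

text \<open>A curve around \<open>S\<close> and the poles of \<phi> and \<psi> need not enclose the
  kernel poles \<open>u - j\<close> or \<open>v - j\<close>. Each Riesz formula therefore asks that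
  those to the right of \<open>\<delta> - \<gamma>\<close>, which the moving line crosses, be
  encircled as well; \<open>u_line\<close> and \<open>v_line\<close> keep them off the line itself.
  For the derivative formula \<open>C\<close> serves to locate \<open>S\<close> and the poles in the
  strip.\<close>

theorem theorem3p1:
  fixes lam mu :: "nat \<Rightarrow> real"
    and f g :: "nat \<Rightarrow> complex"
    and \<phi> \<psi> :: "complex \<Rightarrow> complex"
    and \<delta> \<sigma>\<phi> \<sigma>\<psi> \<gamma> :: real
    and S :: "complex set"
    and C :: "real \<Rightarrow> complex"
    and k :: nat
    and u v :: complex
  assumes lam: "multiplicative_frequencies lam"
    and mu: "multiplicative_frequencies mu"
    and f_nonzero: "\<exists>n\<ge>1. f n \<noteq> 0"
    and g_nonzero: "\<exists>n\<ge>1. g n \<noteq> 0"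
    and delta_pos: "\<delta> > 0"
    and phi: "meromorphic_dirichlet \<phi> f lam \<sigma>\<phi>"
    and psi: "meromorphic_dirichlet \<psi> g mu \<sigma>\<psi>"
    and functional_equation: "hecke_functional_equation \<delta> S \<phi> \<psi>"
    and phi_poles: "simple_real_poles \<phi>"
    and psi_poles: "simple_real_poles \<psi>"
    and phi_abscissa: "(\<exists>p. is_pole \<phi> p) \<Longrightarrow> \<sigma>\<phi> \<le> \<delta>"
    and psi_abscissa: "(\<exists>p. is_pole \<psi> p) \<Longrightarrow> \<sigma>\<psi> \<le> \<delta>"
    and C_path: "valid_path C"
    and C_closed: "pathfinish C = pathstart C"
    and C_encircles: "\<And>z. z \<in> S \<or> is_pole \<phi> z \<or> is_pole \<psi> z \<Longrightarrow> encircles C z"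
    and gamma_gt: "\<gamma> > max \<sigma>\<phi> \<sigma>\<psi>"
    and gamma_gt_half: "\<gamma> > \<delta> / 2"
    and C_strip: "path_image C \<subseteq> {s. \<delta> - \<gamma> < Re s \<and> Re s < \<gamma>}"
    and k_gt: "real k > 2 * \<gamma> - \<delta>"
    and u_gt: "Re u > \<sigma>\<phi>"
    and v_gt: "Re v > \<sigma>\<psi>"
    and uv_gt: "Re u + Re v - \<gamma> > max \<sigma>\<phi> \<sigma>\<psi>"
    and u_line: "\<And>j. j \<le> k \<Longrightarrow> \<delta> - Re u + real j \<noteq> \<gamma>"
    and v_line: "\<And>j. j \<le> k \<Longrightarrow> \<delta> - Re v + real j \<noteq> \<gamma>"
  shows
    "(\<exists>A B. has_kth_deriv k (\<lambda>x. G_series \<gamma> \<delta> k f lam v u x) A 1 \<and>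
            has_kth_deriv k (\<lambda>x. G_series \<gamma> \<delta> k g mu u v x) B 1 \<and>
            \<phi> u * \<psi> v =
              - (\<Sum>p | is_pole \<psi> p. residue \<psi> p / (p - v) * \<phi> (v + u - p))
              - (\<Sum>p | is_pole \<phi> p. residue \<phi> p / (p - u) * \<psi> (v + u - p))
              - A - B) \<and>
     ((\<forall>j\<le>k. \<delta> - \<gamma> < Re u - real j \<longrightarrow> encircles C (u - of_nat j)) \<longrightarrow>
        (\<forall>x::real. x > 0 \<longrightarrow>
           1 / Gamma (of_nat k + 1) *
             (\<Sum>n. g (Suc n) / of_real (mu (Suc n)) powr (v + of_nat k)
                     * riesz_sum k f lam u (mu (Suc n) * x)) =
           1 / (2 * of_real pi * \<i>) *
             contour_integral C (\<lambda>z. Gamma (z - u) / Gamma (z - u + of_nat k + 1)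
               * \<phi> z * \<psi> (v + u - z) * of_real x powr (z - u + of_nat k))
           + G_series \<gamma> \<delta> k g mu u v x)) \<and>
     ((\<forall>j\<le>k. \<delta> - \<gamma> < Re v - real j \<longrightarrow> encircles C (v - of_nat j)) \<longrightarrow>
        (\<forall>x::real. x > 0 \<longrightarrow>
           1 / Gamma (of_nat k + 1) *
             (\<Sum>m. f (Suc m) / of_real (lam (Suc m)) powr (u + of_nat k)
                     * riesz_sum k g mu v (lam (Suc m) * x)) =
           1 / (2 * of_real pi * \<i>) *
             contour_integral C (\<lambda>z. Gamma (z - v) / Gamma (z - v + of_nat k + 1)
               * \<psi> z * \<phi> (v + u - z) * of_real x powr (z - v + of_nat k))
           + G_series \<gamma> \<delta> k f lam v u x))"
proof -
  have strip: "\<delta> - \<gamma> < Re z \<and> Re z < \<gamma>" if "encircles C z" for z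
  proof (rule ccontr)
    assume "\<not> (\<delta> - \<gamma> < Re z \<and> Re z < \<gamma>)"
    then have "winding_number C z = 0"
      by (rule winding_number_zero_outside_strip[OF C_path C_closed C_strip])
    with that show False by (simp add: encircles_def)
  qed
  have pair: "hecke_pair lam mu f g \<phi> \<psi> \<delta> \<sigma>\<phi> \<sigma>\<psi> \<gamma> S"
    using lam mu phi psi functional_equation phi_poles psi_poles delta_pos gamma_gt gamma_gt_half
      strip C_encircles
    by unfold_locales auto
  interpret P: hecke_uv lam mu f g \<phi> \<psi> \<delta> \<sigma>\<phi> \<sigma>\<psi> \<gamma> S u v k
    using k_gt u_gt v_gt uv_gt u_line
    by (intro hecke_uv.intro pair, unfold_locales) auto
  \<comment> \<open>The same results with both series exchanged and \<open>S\<close> reflected,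
    which give the statements about \<open>f\<close>.\<close>
  interpret Q: hecke_uv mu lam g f \<psi> \<phi> \<delta> \<sigma>\<psi> \<sigma>\<phi> \<gamma> "(\<lambda>s. of_real \<delta> - s) ` S" v u k
    using k_gt u_gt v_gt uv_gt v_line
    by (intro hecke_uv.intro P.swap, unfold_locales) auto
  \<comment> \<open>A nonzero coefficient of \<open>g\<close> bounds \<open>Re u\<close>, and one of
    \<open>f\<close> bounds \<open>Re v\<close>: decay along \<open>Re s = \<gamma>\<close> is
    excluded for the series on the other side of the functional equation.\<close>
  have Re_u: "\<delta> - \<gamma> < Re u" by (rule P.abscissa_lower_bound[OF g_nonzero u_gt])
  have Re_v: "\<delta> - \<gamma> < Re v" by (rule Q.abscissa_lower_bound[OF f_nonzero v_gt])
  show ?thesis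
  proof (intro conjI impI allI)
    show "\<exists>A B. has_kth_deriv k (\<lambda>x. G_series \<gamma> \<delta> k f lam v u x) A 1 \<and>
            has_kth_deriv k (\<lambda>x. G_series \<gamma> \<delta> k g mu u v x) B 1 \<and>
            \<phi> u * \<psi> v =
              - (\<Sum>p | is_pole \<psi> p. residue \<psi> p / (p - v) * \<phi> (v + u - p))
              - (\<Sum>p | is_pole \<phi> p. residue \<phi> p / (p - u) * \<psi> (v + u - p))
              - A - B"
      using Q.G_series_has_kth_deriv[OF Re_v] P.G_series_has_kth_deriv[OF Re_u] P.step_series_complementary
      by (intro exI conjI) (assumption, assumption, simp add: algebra_simps)
  next
    fix x :: real
    assume "\<forall>j\<le>k. \<delta> - \<gamma> < Re u - real j \<longrightarrow> encircles C (u - of_nat j)" "x > 0"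
    then show "1 / Gamma (of_nat k + 1) *
             (\<Sum>n. g (Suc n) / of_real (mu (Suc n)) powr (v + of_nat k)
                     * riesz_sum k f lam u (mu (Suc n) * x)) =
           1 / (2 * of_real pi * \<i>) *
             contour_integral C (\<lambda>z. Gamma (z - u) / Gamma (z - u + of_nat k + 1)
               * \<phi> z * \<psi> (v + u - z) * of_real x powr (z - u + of_nat k))
           + G_series \<gamma> \<delta> k g mu u v x"
      using P.contour_Riesz_mean_formula[OF C_path C_closed C_strip, of x] C_encircles
      unfolding P.D_def by simp
  next
    fix x :: real
    assume "\<forall>j\<le>k. \<delta> - \<gamma> < Re v - real j \<longrightarrow> encircles C (v - of_nat j)" "x > 0"
    then show "1 / Gamma (of_nat k + 1) *
             (\<Sum>m. f (Suc m) / of_real (lam (Suc m)) powr (u + of_nat k)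
                     * riesz_sum k g mu v (lam (Suc m) * x)) =
           1 / (2 * of_real pi * \<i>) *
             contour_integral C (\<lambda>z. Gamma (z - v) / Gamma (z - v + of_nat k + 1)
               * \<psi> z * \<phi> (v + u - z) * of_real x powr (z - v + of_nat k))
           + G_series \<gamma> \<delta> k f lam v u x"
      using Q.contour_Riesz_mean_formula[OF C_path C_closed C_strip, of x] C_encircles
      unfolding Q.D_def by (simp add: add.commute[of u v])
  qed
qed

end
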